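(* Let $1\le p<\infty$, $0<\theta\le\infty$, $\omega\in\Omega_\theta$, $v\in\mathcal W(\mathbb{R}^n)$, and $X:=LM_{p\theta,\omega}(\mathbb{R}^n,v)$. For measurable $f$ and measurable $A\subset\mathbb{R}^n$ put $N_A(f):=\|f\|_{p',A,v^{1-p'}}=\big(\int_A|f|^{p'}v^{1-p'}\big)^{1/p'}$ if $p>1$, and $N_A(f):=\operatorname{ess\,sup}_A|f|v^{-1}$ if $p=1$. (i) If $0<\theta\le1$, then $\|f\|_{X'}\approx\sup_{t>0}N_{{}^cB(0,t)}(f)\,\|\omega\|_{\theta,(t,\infty)}^{-1}$. (ii) If $1<\theta\le\infty$, then $$\|f\|_{X'}\approx\Big(\int_{(0,\infty)}N_{{}^cB(0,t)}(f)^{\theta'}\,d\Big(\|\omega\|_{\theta,(t-,\infty)}^{-\theta'}\Big)\Big)^{1/\theta'}+\frac{N_{\mathbb{R}^n}(f)}{\|\omega\|_{\theta,(0,\infty)}},$$ where $\theta'=\theta/(\theta-1)$ ($\theta'=1$ if $\theta=\infty$). In both cases the constants of equivalence are independent of $f$.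
   Context: $B(0,r)$ is the open ball of radius $r$ centered at $0$, ${}^cB(0,r):=\mathbb{R}^n\setminus B(0,r)$; $p'=p/(p-1)$ for $1<p<\infty$. $\|g\|_{\theta,A}:=(\int_A|g|^\theta)^{1/\theta}$ (ess sup if $\theta=\infty$). $\mathcal W(\mathbb{R}^n)$: measurable functions positive and finite a.e. $LM_{p\theta,\omega}(\mathbb{R}^n,v)$ is the set of $f$ locally in $L_p(v)$ with $\|f\|_X:=\big\|\omega(r)\big(\int_{B(0,r)}|f|^pv\big)^{1/p}\big\|_{\theta,(0,\infty)}<\infty$. $\Omega_\theta$: measurable $\omega\ge0$ on $(0,\infty)$ with $0<\|\omega\|_{\theta,(t,\infty)}<\infty$ for all $t>0$. The associate space norm is $\|f\|_{X'}:=\sup\{\int_{\mathbb{R}^n}|fg|:\|g\|_X\le1\}$. $\|\omega\|_{\theta,(t-,\infty)}:=\lim_{s\to t-}\|\omega\|_{\theta,(s,\infty)}$, and the integral is the Lebesgue–Stieltjes integral with respect to the non-decreasing, left-continuous function $t\mapsto\|\omega\|_{\theta,(t-,\infty)}^{-\theta'}$. Conventions $0/0=0$, $0\cdot(\pm\infty)=0$, $1/(\pm\infty)=0$. *)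

theory Defs
  imports "HOL-Analysis.Analysis"
begin

text \<open>Real power of an extended nonnegative real; used only with positive exponents
  (so that 0 to the r is 0 and infinity to the r is infinity).\<close>
definition epow :: "ennreal \<Rightarrow> real \<Rightarrow> ennreal" where
  "epow x r = (if x = \<infinity> then \<infinity> else ennreal (enn2real x powr r))"

definition esssup_on :: "'a measure \<Rightarrow> 'a set \<Rightarrow> ('a \<Rightarrow> ennreal) \<Rightarrow> ennreal" where
  "esssup_on M A g = Inf {c. AE x in M. x \<in> A \<longrightarrow> g x \<le> c}"

definition lnorm :: "ennreal \<Rightarrow> real set \<Rightarrow> (real \<Rightarrow> ennreal) \<Rightarrow> ennreal" where
  "lnorm \<theta> A g = (if \<theta> = \<infinity> then esssup_on lebesgue A g
     else epow (\<integral>\<^sup>+ x\<in>A. epow (g x) (enn2real \<theta>) \<partial>lebesgue) (1 / enn2real \<theta>))"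

definition wnorm :: "ennreal \<Rightarrow> (real \<Rightarrow> real) \<Rightarrow> real \<Rightarrow> ennreal" where
  "wnorm \<theta> \<omega> t = lnorm \<theta> ({t<..} \<inter> {0<..}) (\<lambda>r. ennreal (\<omega> r))"

definition Omega :: "ennreal \<Rightarrow> (real \<Rightarrow> real) set" where
  "Omega \<theta> = {\<omega>. \<omega> \<in> borel_measurable lebesgue \<and> (\<forall>t>0. 0 \<le> \<omega> t) \<and>
      (\<forall>t>0. 0 < wnorm \<theta> \<omega> t \<and> wnorm \<theta> \<omega> t < \<infinity>)}"

definition Wts :: "('a::euclidean_space \<Rightarrow> real) set" where
  "Wts = {v. v \<in> borel_measurable lebesgue \<and> (AE x in lebesgue. 0 < v x)}"

definition LMnorm :: "real \<Rightarrow> ennreal \<Rightarrow> (real \<Rightarrow> real) \<Rightarrow> ('a::euclidean_space \<Rightarrow> real)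
    \<Rightarrow> ('a \<Rightarrow> real) \<Rightarrow> ennreal" where
  "LMnorm p \<theta> \<omega> v g = lnorm \<theta> {0<..}
     (\<lambda>r. ennreal (\<omega> r) * epow (\<integral>\<^sup>+ x\<in>ball 0 r. ennreal (\<bar>g x\<bar> powr p * v x) \<partial>lebesgue) (1 / p))"

definition LM :: "real \<Rightarrow> ennreal \<Rightarrow> (real \<Rightarrow> real) \<Rightarrow> ('a::euclidean_space \<Rightarrow> real)
    \<Rightarrow> ('a \<Rightarrow> real) set" where
  "LM p \<theta> \<omega> v = {g. g \<in> borel_measurable lebesgue \<and>
      (\<forall>K. compact K \<longrightarrow> (\<integral>\<^sup>+ x\<in>K. ennreal (\<bar>g x\<bar> powr p * v x) \<partial>lebesgue) < \<infinity>) \<and>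
      LMnorm p \<theta> \<omega> v g < \<infinity>}"

definition assoc_norm :: "real \<Rightarrow> ennreal \<Rightarrow> (real \<Rightarrow> real) \<Rightarrow> ('a::euclidean_space \<Rightarrow> real)
    \<Rightarrow> ('a \<Rightarrow> real) \<Rightarrow> ennreal" where
  "assoc_norm p \<theta> \<omega> v f = (SUP g\<in>{g\<in>LM p \<theta> \<omega> v. LMnorm p \<theta> \<omega> v g \<le> 1}.
      \<integral>\<^sup>+ x. ennreal \<bar>f x * g x\<bar> \<partial>lebesgue)"

definition conj_exp :: "real \<Rightarrow> real" where
  "conj_exp p = p / (p - 1)"

definition Nf :: "real \<Rightarrow> ('a::euclidean_space \<Rightarrow> real) \<Rightarrow> 'a set \<Rightarrow> ('a \<Rightarrow> real) \<Rightarrow> ennreal" where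
  "Nf p v A f = (if p = 1 then esssup_on lebesgue A (\<lambda>x. ennreal (\<bar>f x\<bar> / v x))
     else epow (\<integral>\<^sup>+ x\<in>A. ennreal (\<bar>f x\<bar> powr conj_exp p * v x powr (1 - conj_exp p)) \<partial>lebesgue)
                (1 / conj_exp p))"

definition theta_conj :: "ennreal \<Rightarrow> real" where
  "theta_conj \<theta> = (if \<theta> = \<infinity> then 1 else enn2real \<theta> / (enn2real \<theta> - 1))"

definition wnorm_left :: "ennreal \<Rightarrow> (real \<Rightarrow> real) \<Rightarrow> real \<Rightarrow> ennreal" where
  "wnorm_left \<theta> \<omega> t = Lim (at_left t) (\<lambda>s. wnorm \<theta> \<omega> s)"

text \<open>The non-decreasing, left-continuous function t to the norm over (t-,infinity) to the power -theta'.\<close>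
definition Fw :: "ennreal \<Rightarrow> (real \<Rightarrow> real) \<Rightarrow> real \<Rightarrow> real" where
  "Fw \<theta> \<omega> t = enn2real (inverse (epow (wnorm_left \<theta> \<omega> t) (theta_conj \<theta>)))"

text \<open>Lebesgue--Stieltjes measure of a non-decreasing left-continuous F, so that
  [a,b) has measure F b - F a; obtained by reflecting the right-continuous case.\<close>
definition ls_measure_left :: "(real \<Rightarrow> real) \<Rightarrow> real measure" where
  "ls_measure_left F = distr (interval_measure (\<lambda>s. - F (- s))) borel uminus"

end

(* Write N(t) for the weighted L_{p'} norm of f off the ball of radius t, and W(t) for the norm
   of omega over (t, infinity). Radii are grouped into dyadic blocks 2^-(k+1) < W(t) <= 2^-k,
   with left end points r_k, and space into the corresponding annuli.

   Upper bounds: Hoelder on each annulus reduces int |f g| to a sum of N(r_k) G_k, where G_k is the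
   weighted L_p norm of g on the k-th annulus. For finite theta, W is continuous, so
   the block after the k-th one carries omega^theta-mass at least a constant times 2^(-k theta);
   hence the sequence 2^-k G_k is bounded in l^theta by the norm of g in X. For theta <= 1 one uses
   that l^theta embeds in l^1, and for theta > 1 Hoelder's inequality for series.

   Lower bounds: L_p duality gives functions g_k of unit norm supported off the ball of radius r_k
   which almost attain N(r_k). For theta > 1 the test functions are the sums of 2^k a_k g_k with a
   in the unit ball of l^theta; that their norm in X is at most 2 is a discrete Hardy inequality.

   The Stieltjes integral is compared with the sum of (2^k N(r_k))^theta' after writing the
   Stieltjes measure as the image of Lebesgue measure under the generalised inverse of F: in the new
   variable y the dyadic blocks are 2^(k theta') <= y < 2^((k+1) theta'), and the extra term
   N(0) / W(0) accounts for the missing range 0 < y <= F(0). *)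

theory Submission
  imports Defs
begin

section \<open>Powers of extended nonnegative reals\<close>

text \<open>Why indices are shifted by one: if \<open>W 0\<close> is finite, the lowest block may
  carry an arbitrarily small share of mass, while the block after a nonempty annulus is full (for
  finite \<theta>). So annulus k is paired with block k + 1. For infinite \<theta> there is no mass
  to count, and \<open>W\<close> may jump or stay away from 0. The bound on G_k then comes pointwise
  from \<omega>(r) times the local norm of g, and some levels may be empty, which the estimates have
  to exclude. In (i) the lower bound needs just one dual function for each t: with unit norm and
  support off the ball of radius t, it has norm at most W(t) in X. The same argument at t = 0 gives
  the extra term of (ii). N(t) may be infinite, so duality is stated for every c < N(t), and the
  sequence argument is run under a finite associate norm, the other case being trivial. W(0) may be
  infinite as well; then F(0) = 0 and the extra term vanishes.\<close>

lemma epow_top [simp]: "epow top r = top"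
  by (simp add: epow_def)

lemma epow_ennreal: "0 \<le> x \<Longrightarrow> epow (ennreal x) r = ennreal (x powr r)"
  by (simp add: epow_def)

lemma epow_0 [simp]: "epow 0 r = 0"
  by (simp add: epow_def)

lemma epow_1 [simp]: "epow 1 r = 1"
  by (simp add: epow_def)

lemma epow_one [simp]: "epow x 1 = x"
  by (cases x) (auto simp: epow_def)

lemma epow_mono: "x \<le> y \<Longrightarrow> 0 \<le> r \<Longrightarrow> epow x r \<le> epow y r"
  by (cases x; cases y) (auto simp: epow_ennreal top_unique intro!: ennreal_leI powr_mono2)

lemma epow_epow: "0 < r \<Longrightarrow> 0 < s \<Longrightarrow> epow (epow x r) s = epow x (r * s)"
  by (cases x) (auto simp: epow_ennreal powr_powr)

lemma epow_inverse_left [simp]: "0 < r \<Longrightarrow> epow (epow x r) (1 / r) = x"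
  by (simp add: epow_epow)

lemma epow_inverse_right [simp]: "0 < r \<Longrightarrow> epow (epow x (1 / r)) r = x"
  by (simp add: epow_epow)

lemma epow_le_epow_iff [simp]: "0 < r \<Longrightarrow> epow x r \<le> epow y r \<longleftrightarrow> x \<le> y"
  by (metis epow_inverse_left epow_mono less_imp_le zero_less_divide_1_iff)

lemma epow_inverse_le_iff: "0 < r \<Longrightarrow> epow x (1 / r) \<le> y \<longleftrightarrow> x \<le> epow y r"
  by (metis epow_inverse_right epow_le_epow_iff)

lemma epow_le_iff: "0 < r \<Longrightarrow> epow x r \<le> y \<longleftrightarrow> x \<le> epow y (1 / r)"
  by (metis epow_inverse_right epow_le_epow_iff)

lemma le_epow_inverse_iff: "0 < r \<Longrightarrow> y \<le> epow x (1 / r) \<longleftrightarrow> epow y r \<le> x"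
  by (metis epow_inverse_right epow_le_epow_iff)

lemma epow_mult: "0 < r \<Longrightarrow> epow (x * y) r = epow x r * epow y r"
proof (cases x; cases y)
  fix a b :: real
  assume "x = ennreal a" "0 \<le> a" "y = ennreal b" "0 \<le> b" "0 < r"
  then show ?thesis
    by (simp add: epow_ennreal powr_mult flip: ennreal_mult)
next
  fix a :: real
  assume "x = ennreal a" "0 \<le> a" "y = top" "0 < r"
  then show ?thesis
    by (cases "a = 0") (auto simp: epow_ennreal ennreal_mult_eq_top_iff epow_def)
next
  fix a :: real
  assume "y = ennreal a" "0 \<le> a" "x = top" "0 < r"
  then show ?thesis
    by (cases "a = 0") (auto simp: epow_ennreal ennreal_mult_eq_top_iff epow_def)
qed simp

lemma epow_eq_0_iff [simp]: "epow x r = 0 \<longleftrightarrow> x = 0"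
  by (cases x) (auto simp: epow_def)

lemma epow_eq_top_iff [simp]: "epow x r = top \<longleftrightarrow> x = top"
  by (auto simp: epow_def)

lemma borel_measurable_epow [measurable]:
  assumes [measurable]: "f \<in> borel_measurable M"
  shows "(\<lambda>x. epow (f x) r) \<in> borel_measurable M"
  unfolding epow_def by measurable

text \<open>Jensen's inequality for t^p with weights proportional to c. It yields both Minkowski's
  inequality in \<open>Lp_norm_sum_le\<close> and the discrete Hardy inequality in
  \<open>weighted_profile_le\<close>.\<close>

lemma powr_sum_le:
  fixes c x :: "'i \<Rightarrow> real" and p :: real
  assumes "finite K" "1 \<le> p" "\<And>k. k \<in> K \<Longrightarrow> 0 \<le> c k" "\<And>k. k \<in> K \<Longrightarrow> 0 \<le> x k"
  shows "(\<Sum>k\<in>K. c k * x k) powr p \<le> (\<Sum>k\<in>K. c k) powr (p - 1) * (\<Sum>k\<in>K. c k * x k powr p)"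
proof -
  \<comment> \<open>Discarding the zero terms makes the total weight positive and puts all points
    into the open half-line, where convexity is applied. Enlarging \<open>L\<close> to
    \<open>K\<close> at the end only increases both factors.\<close>
  define L where "L = {k \<in> K. 0 < c k \<and> 0 < x k}"
  define s where "s = (\<Sum>k\<in>L. c k)"
  have L: "finite L" "L \<subseteq> K" using assms by (auto simp: L_def)
  show ?thesis
  proof (cases "L = {}")
    case True
    then have "\<And>k. k \<in> K \<Longrightarrow> c k * x k = 0" using assms(3,4) by (force simp: L_def)
    then have "(\<Sum>k\<in>K. c k * x k) = 0" by (rule sum.neutral[rule_format])
    then show ?thesis using assms by (auto intro!: mult_nonneg_nonneg sum_nonneg)
  next
    case False
    then have s: "s > 0" unfolding s_def using L by (intro sum_pos) (auto simp: L_def)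
    have sK: "s \<le> (\<Sum>k\<in>K. c k)" unfolding s_def using L assms by (intro sum_mono2) auto
    have "(\<Sum>k\<in>K. c k * x k) = (\<Sum>k\<in>L. c k * x k)"
      using assms L by (intro sum.mono_neutral_right) (force simp: L_def)+
    also have "\<dots> = s * (\<Sum>k\<in>L. (c k / s) *\<^sub>R x k)"
      using s by (simp add: sum_distrib_left)
    finally have "(\<Sum>k\<in>K. c k * x k) powr p = s powr p * (\<Sum>k\<in>L. (c k / s) *\<^sub>R x k) powr p"
      using s by (auto simp: powr_mult L_def intro!: powr_mult sum_nonneg)
    also have "(\<Sum>k\<in>L. (c k / s) *\<^sub>R x k) powr p \<le> (\<Sum>k\<in>L. (c k / s) * x k powr p)"
    proof (rule convex_on_sum[OF _ _ powr_convex[OF assms(2)]])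
      show "(\<Sum>k\<in>L. c k / s) = 1" using s by (simp add: s_def flip: sum_divide_distrib)
    qed (use L False s in \<open>auto simp: L_def\<close>)
    also have "s powr p * \<dots> = s powr (p - 1) * (\<Sum>k\<in>L. c k * x k powr p)"
      using s by (simp add: powr_diff sum_distrib_left)
    also have "\<dots> \<le> (\<Sum>k\<in>K. c k) powr (p - 1) * (\<Sum>k\<in>K. c k * x k powr p)"
      using L assms s sK by (intro mult_mono powr_mono2 sum_mono2) (auto intro!: sum_nonneg)
    finally show ?thesis by (simp add: s mult_left_mono)
  qed
qed

text \<open>The factors 1/p and 1/q are dropped, which is harmless up to constants and is the source
  of the 2 in \<open>Holder_nn_integral\<close>.\<close>

lemma Youngs_inequality_epow:
  assumes "1 < p" "1 < q" "1 / p + 1 / q = 1"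
  shows "x * y \<le> epow x p + epow y q"
proof (cases x; cases y)
  fix a b :: real
  assume *: "x = ennreal a" "0 \<le> a" "y = ennreal b" "0 \<le> b"
  have "a * b \<le> a powr p / p + b powr q / q"
    using Youngs_inequality assms * by blast
  also have "\<dots> \<le> a powr p / 1 + b powr q / 1"
    using assms by (intro add_mono divide_left_mono) auto
  finally show ?thesis
    using * by (simp add: epow_ennreal flip: ennreal_mult ennreal_plus)
qed auto

text \<open>Young's inequality for the functions divided by their norms: the right-hand side then
  integrates to 1 + 1. The measure is general because the inequality serves Lebesgue measure as well
  as series over \<open>count_space\<close>.\<close>

lemma Holder_nn_integral:
  assumes "1 < p" "1 < q" "1 / p + 1 / q = 1"
    and [measurable]: "f \<in> borel_measurable M" "g \<in> borel_measurable M"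
  shows "(\<integral>\<^sup>+ x. f x * g x \<partial>M)
    \<le> 2 * (epow (\<integral>\<^sup>+ x. epow (f x) p \<partial>M) (1 / p) * epow (\<integral>\<^sup>+ x. epow (g x) q \<partial>M) (1 / q))"
proof -
  define A where "A = (\<integral>\<^sup>+ x. epow (f x) p \<partial>M)"
  define B where "B = (\<integral>\<^sup>+ x. epow (g x) q \<partial>M)"
  \<comment> \<open>A zero norm makes the product vanish almost everywhere even if the other norm is
    infinite, so this case has to precede the one where the bound is infinite.\<close>
  consider "A = 0 \<or> B = 0" | "A \<noteq> 0 \<and> B \<noteq> 0 \<and> (A = top \<or> B = top)"
    | "A \<noteq> 0" "A \<noteq> top" "B \<noteq> 0" "B \<noteq> top" by blast
  then show ?thesis
  proof cases
    case 1
    then have "AE x in M. f x * g x = 0"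
      by (auto simp: A_def B_def nn_integral_0_iff_AE)
    then show ?thesis
      by (simp add: nn_integral_0_iff_AE[THEN iffD2])
  next
    case 2
    then have "epow A (1 / p) * epow B (1 / q) = top"
      by (auto simp: ennreal_mult_eq_top_iff)
    then show ?thesis
      unfolding A_def[symmetric] B_def[symmetric] by (simp add: ennreal_mult_top)
  next
    case 3
    define a where "a = epow A (1 / p)"
    define b where "b = epow B (1 / q)"
    have ab: "a \<noteq> 0" "b \<noteq> 0" "a \<noteq> top" "b \<noteq> top"
      using 3 by (auto simp: a_def b_def )
    have inv1: "u * inverse u = 1" if "u \<noteq> 0" "u \<noteq> top" for u :: ennreal
      using that by (cases u) (auto simp: inverse_ennreal simp flip: ennreal_mult)
    have epi: "epow (inverse u) r * epow u r = 1" if "u \<noteq> 0" "u \<noteq> top" "0 < r" for u r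
      using that by (simp add: inv1 mult.commute[of "inverse u"] flip: epow_mult)
    have "(\<integral>\<^sup>+ x. f x * g x \<partial>M) = (\<integral>\<^sup>+ x. (a * b) * ((inverse a * f x) * (inverse b * g x)) \<partial>M)"
    proof (rule nn_integral_cong)
      fix x
      have "(a * b) * ((inverse a * f x) * (inverse b * g x))
         = (a * inverse a) * (b * inverse b) * (f x * g x)" by (simp add: ac_simps)
      then show "f x * g x = (a * b) * ((inverse a * f x) * (inverse b * g x))"
        by (simp add: inv1 ab)
    qed
    also have "\<dots> = (a * b) * (\<integral>\<^sup>+ x. (inverse a * f x) * (inverse b * g x) \<partial>M)"
      by (rule nn_integral_cmult) measurable
    also have "\<dots> \<le> (a * b) * (\<integral>\<^sup>+ x. epow (inverse a) p * epow (f x) p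
                              + epow (inverse b) q * epow (g x) q \<partial>M)"
      using assms(1,2) Youngs_inequality_epow[OF assms(1-3)]
      by (intro mult_left_mono nn_integral_mono) (auto simp flip: epow_mult)
    also have "\<dots> = (a * b) * (epow (inverse a) p * A + epow (inverse b) q * B)"
      by (subst nn_integral_add) (auto simp: nn_integral_cmult A_def B_def)
    also have "epow (inverse a) p * A + epow (inverse b) q * B = 2"
      using assms epi[of a p] epi[of b q] ab by (simp add: a_def b_def)
    finally show ?thesis
      by (simp add: mult.commute flip: A_def B_def a_def b_def)
  qed
qed

text \<open>The infimum is attained: some sequence of admissible constants has the same infimum, and
  countably many exceptional null sets have a null union.\<close>

lemma esssup_on_le_iff:
  "esssup_on M A g \<le> c \<longleftrightarrow> (AE x in M. x \<in> A \<longrightarrow> g x \<le> c)"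
proof
  assume le: "esssup_on M A g \<le> c"
  define C where "C = {c. AE x in M. x \<in> A \<longrightarrow> g x \<le> c}"
  have "top \<in> C" by (simp add: C_def)
  then have "C \<noteq> {}" by blast
  from ennreal_Inf_countable_INF[OF this] obtain h :: "nat \<Rightarrow> ennreal"
    where h: "range h \<subseteq> C" "Inf C = (INF i. h i)" by blast
  then have "AE x in M. \<forall>i. x \<in> A \<longrightarrow> g x \<le> h i"
    by (subst AE_all_countable) (auto simp: C_def)
  then show "AE x in M. x \<in> A \<longrightarrow> g x \<le> c"
  proof eventually_elim
    case (elim x)
    show ?case
    proof
      assume "x \<in> A"
      then have "g x \<le> Inf C" using elim by (auto simp: h(2) intro: INF_greatest)
      then show "g x \<le> c" using le by (simp add: esssup_on_def C_def)
    qed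
  qed
qed (auto simp: esssup_on_def intro: Inf_lower)

lemma AE_le_esssup_on: "AE x in M. x \<in> A \<longrightarrow> g x \<le> esssup_on M A g"
  using esssup_on_le_iff by blast

section \<open>Stieltjes measures as images of Lebesgue measure\<close>

text \<open>A Galois connection between \<open>F\<close> and its generalised inverse. Left
  continuity gives the step from right to left: \<open>F\<close> exceeds y already at some point
  before c.\<close>

lemma left_inverse_less_iff:
  fixes F :: "real \<Rightarrow> real"
  assumes "mono F" "\<And>t. continuous (at_left t) F" "F a \<le> y" "y < F b"
  shows "Sup {t. F t \<le> y} < c \<longleftrightarrow> y < F c"
proof
  have bdd: "bdd_above {t. F t \<le> y}"
    using assms(1,4) by (intro bdd_aboveI[of _ b]) (smt (verit, best) mem_Collect_eq monoD)
  { assume *: "Sup {t. F t \<le> y} < c"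
    show "y < F c"
    proof (rule ccontr)
      assume "\<not> y < F c"
      then have "c \<le> Sup {t. F t \<le> y}" by (intro cSup_upper bdd) simp
      then show False using * by simp
    qed }
  { assume "y < F c"
    have "(F \<longlongrightarrow> F c) (at_left c)" using assms(2) by (simp add: continuous_within)
    then have "eventually (\<lambda>s. y < F s) (at_left c)" using \<open>y < F c\<close> by (rule order_tendstoD)
    then obtain s where s: "s < c" "\<And>t. s < t \<Longrightarrow> t < c \<Longrightarrow> y < F t"
      by (auto simp: eventually_at_left[of "c - 1" c])
    have "y < F ((s + c) / 2)" using s by simp
    then have "Sup {t. F t \<le> y} \<le> (s + c) / 2"
      using assms(1,3)
      by (intro cSup_least) (blast, metis mem_Collect_eq monoD leD le_less_trans nle_le)
    then show "Sup {t. F t \<le> y} < c" using s(1) by simp }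
qed

text \<open>Under reflection the left-continuous \<open>F\<close> becomes right-continuous and
  [a, b) becomes (-b, -a], the kind of interval whose \<open>interval_measure\<close> is
  known.\<close>

lemma emeasure_ls_measure_left:
  assumes "mono F" "\<And>t. continuous (at_left t) F" "a \<le> b"
  shows "emeasure (ls_measure_left F) {a..<b} = F b - F a"
proof -
  have "continuous (at_right s) (\<lambda>s. - F (- s))" for s
  proof -
    have "(F \<longlongrightarrow> F (- s)) (at_left (- s))" using assms(2) by (simp add: continuous_within)
    then have "((\<lambda>s. F (- s)) \<longlongrightarrow> F (- s)) (at_right s)"
      by (simp add: filterlim_at_right_to_0 filterlim_at_left_to_right filterlim_def filtermap_filtermap at_left_minus)
    then show ?thesis unfolding continuous_within by (rule tendsto_minus)
  qed
  then have "emeasure (interval_measure (\<lambda>s. - F (- s))) {- b<..- a} = F b - F a"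
    using assms by (subst emeasure_interval_measure_Ioc) (auto simp: mono_def)
  moreover have "uminus -` {a..<b} = {- b<..- a}" by auto
  ultimately show ?thesis
    by (simp add: ls_measure_left_def emeasure_distr)
qed

text \<open>The quantile transform. By \<open>left_inverse_less_iff\<close>, \<open>T\<close> pulls
  [a, b) back to [F a, F b), whose length is the Stieltjes mass of [a, b), and half-open intervals
  form an intersection-stable generator. Off \<open>J\<close> the value of \<open>T\<close> would be
  the supremum of an empty or an unbounded set.\<close>

lemma ls_measure_left_eq_distr:
  fixes F :: "real \<Rightarrow> real"
  assumes F: "mono F" "\<And>t. continuous (at_left t) F"
  defines "J \<equiv> {y. (\<exists>a. F a \<le> y) \<and> (\<exists>b. y < F b)}" and "T \<equiv> \<lambda>y. Sup {t. F t \<le> y}"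
  shows "J \<in> sets borel" "T \<in> borel_measurable (restrict_space lborel J)"
    "ls_measure_left F = distr (restrict_space lborel J) borel T"
proof -
  have "J = (\<Union>n::nat. {F (- real n)..<F (real n)})"
  proof safe
    fix y assume "y \<in> J"
    then obtain a b where ab: "F a \<le> y" "y < F b" by (auto simp: J_def)
    obtain n :: nat where n: "max (- a) b \<le> real n" using real_arch_simple by blast
    then have "F (- real n) \<le> F a" "F b \<le> F (real n)" by (auto intro!: monoD[OF F(1)])
    with ab show "y \<in> (\<Union>n::nat. {F (- real n)..<F (real n)})" by (intro UN_I[of n]) auto
  qed (auto simp: J_def)
  then show J: "J \<in> sets borel" by simp
  have less: "T y < c \<longleftrightarrow> y < F c" if "y \<in> J" for y c
    using that left_inverse_less_iff[OF F] by (auto simp: J_def T_def)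
  show T: "T \<in> borel_measurable (restrict_space lborel J)"
  proof (rule borel_measurableI_less)
    fix c
    have "{y \<in> space (restrict_space lborel J). T y < c} = J \<inter> {..<F c}"
      by (auto simp: less space_restrict_space)
    then show "{y \<in> space (restrict_space lborel J). T y < c} \<in> sets (restrict_space lborel J)"
      using J by (auto simp: sets_restrict_space)
  qed
  define E where "E = range (\<lambda>(a, b). {a..<b :: real})"
  show "ls_measure_left F = distr (restrict_space lborel J) borel T"
  proof (rule measure_eqI_generator_eq[where E = E and \<Omega> = UNIV and A = "\<lambda>n. {- real n..<real n}"])
    show "Int_stable E" by (auto simp: E_def Int_stable_def)
    have "sets borel = sigma_sets UNIV E"
      unfolding E_def by (subst borel_eq_atLeastLessThan) simp
    then show "sets (ls_measure_left F) = sigma_sets UNIV E"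
      "sets (distr (restrict_space lborel J) borel T) = sigma_sets UNIV E"
      by (auto simp: ls_measure_left_def)
    show "range (\<lambda>n. {- real n..<real n}) \<subseteq> E" by (auto simp: E_def)
    show "(\<Union>n. {- real n..<real n}) = UNIV"
    proof -
      have "\<exists>n. - real n \<le> x \<and> x < real n" for x
        using reals_Archimedean2[of "\<bar>x\<bar>"]
        by (metis abs_less_iff less_imp_le minus_less_iff)
      then show ?thesis by auto
    qed
    show "emeasure (ls_measure_left F) {- real n..<real n} \<noteq> \<infinity>" for n
      by (subst emeasure_ls_measure_left[OF F]) auto
    show "emeasure (ls_measure_left F) X = emeasure (distr (restrict_space lborel J) borel T) X"
      if "X \<in> E" for X
    proof -
      from that obtain a b where X: "X = {a..<b}" by (auto simp: E_def)
      show ?thesis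
      proof (cases "a \<le> b")
        case True
        have "emeasure (distr (restrict_space lborel J) borel T) X
            = emeasure (restrict_space lborel J) (T -` X \<inter> J)"
          using T by (subst emeasure_distr) (auto simp: X space_restrict_space)
        also have "T -` X \<inter> J = {F a..<F b}"
        proof -
          have "{F a..<F b} \<subseteq> J" by (auto simp: J_def)
          moreover have "y \<in> T -` X \<longleftrightarrow> y \<in> {F a..<F b}" if "y \<in> J" for y
            using less[OF that, of a] less[OF that, of b] by (auto simp: X)
          ultimately show ?thesis by blast
        qed
        also have "emeasure (restrict_space lborel J) {F a..<F b} = emeasure lborel {F a..<F b}"
          using J by (intro emeasure_restrict_space) (auto simp: J_def)
        also have "\<dots> = F b - F a" using True F(1) by (simp add: mono_def)
        finally show ?thesis using emeasure_ls_measure_left[OF F True] by (simp add: X)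
      qed (auto simp: X)
    qed
  qed (auto simp: E_def)
qed

lemma nn_integral_ls_measure_left:
  fixes F :: "real \<Rightarrow> real" and h :: "real \<Rightarrow> ennreal"
  assumes F: "mono F" "\<And>t. continuous (at_left t) F" and h: "h \<in> borel_measurable borel"
  shows "(\<integral>\<^sup>+ t. h t \<partial>ls_measure_left F)
    = (\<integral>\<^sup>+ y\<in>{y. (\<exists>a. F a \<le> y) \<and> (\<exists>b. y < F b)}. h (Sup {t. F t \<le> y}) \<partial>lborel)"
proof -
  note * = ls_measure_left_eq_distr[OF F]
  show ?thesis
    using *(1) *(2) h by (simp add: *(3) nn_integral_distr nn_integral_restrict_space)
qed

section \<open>Weighted norms and duality\<close>

lemma lnorm_finite_def:
  "\<theta> \<noteq> \<infinity> \<Longrightarrow> lnorm \<theta> A g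
    = epow (\<integral>\<^sup>+ x\<in>A. epow (g x) (enn2real \<theta>) \<partial>lebesgue) (1 / enn2real \<theta>)"
  by (simp add: lnorm_def)

lemma lnorm_le_iff:
  assumes "0 < \<theta>"
  shows "lnorm \<theta> A g \<le> c \<longleftrightarrow>
    (if \<theta> = \<infinity> then AE x in lebesgue. x \<in> A \<longrightarrow> g x \<le> c
     else (\<integral>\<^sup>+ x\<in>A. epow (g x) (enn2real \<theta>) \<partial>lebesgue) \<le> epow c (enn2real \<theta>))"
  using assms
  by (auto simp: lnorm_def esssup_on_le_iff epow_inverse_le_iff enn2real_positive_iff less_top)

text \<open>The alternative \<open>g x = 0\<close> allows B to be smaller than A. This is how the
  local norms of a function supported off the ball of radius t, which vanish for r up to t, are
  compared with \<open>W t\<close>.\<close>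

lemma lnorm_mono:
  assumes "0 < \<theta>" "AE x in lebesgue. x \<in> A \<longrightarrow> g x = 0 \<or> (x \<in> B \<and> g x \<le> h x)"
  shows "lnorm \<theta> A g \<le> lnorm \<theta> B h"
proof (cases "\<theta> = \<infinity>")
  case True
  have "AE x in lebesgue. x \<in> A \<longrightarrow> g x \<le> lnorm \<theta> B h"
    using assms(2) AE_le_esssup_on[where M = lebesgue and A = B and g = h]
    by eventually_elim (auto simp: True lnorm_def)
  then show ?thesis by (simp add: lnorm_le_iff assms True)
next
  case False
  have "AE x in lebesgue. epow (g x) (enn2real \<theta>) * indicator A x
      \<le> epow (h x) (enn2real \<theta>) * indicator B x"
    using assms(2) by eventually_elim (auto intro!: epow_mono simp: indicator_def)
  then show ?thesis unfolding lnorm_finite_def[OF False]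
    by (intro epow_mono nn_integral_mono_AE) auto
qed

lemma lnorm_cmult_le:
  assumes "0 < \<theta>" "g \<in> borel_measurable lebesgue" "A \<in> sets lebesgue"
  shows "lnorm \<theta> A (\<lambda>x. c * g x) \<le> c * lnorm \<theta> A g"
proof (cases "\<theta> = \<infinity>")
  case True
  have "AE x in lebesgue. x \<in> A \<longrightarrow> c * g x \<le> c * lnorm \<theta> A g"
    using AE_le_esssup_on[where M = lebesgue and A = A and g = g]
    by eventually_elim (auto simp: True lnorm_def mult_left_mono)
  then show ?thesis by (simp add: lnorm_le_iff assms True)
next
  case False
  note [measurable] = assms(2,3)
  have "0 < enn2real \<theta>" using assms False by (simp add: enn2real_positive_iff less_top)
  then show ?thesis unfolding lnorm_finite_def[OF False]
    by (simp add: epow_mult nn_integral_cmult mult.assoc)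
qed

section \<open>Weighted L_p norms and their duality with \<open>Nf\<close>\<close>

definition Lp_norm :: "real \<Rightarrow> ('a::euclidean_space \<Rightarrow> real) \<Rightarrow> 'a set \<Rightarrow> ('a \<Rightarrow> real) \<Rightarrow> ennreal" where
  "Lp_norm p v A g = epow (\<integral>\<^sup>+ x\<in>A. ennreal (\<bar>g x\<bar> powr p * v x) \<partial>lebesgue) (1 / p)"

lemma LMnorm_eq: "LMnorm p \<theta> \<omega> v g = lnorm \<theta> {0<..} (\<lambda>r. ennreal (\<omega> r) * Lp_norm p v (ball 0 r) g)"
  by (simp add: LMnorm_def Lp_norm_def)

lemma Lp_norm_mono: "0 \<le> p \<Longrightarrow> A \<subseteq> B \<Longrightarrow> Lp_norm p v A g \<le> Lp_norm p v B g"
  unfolding Lp_norm_def by (intro epow_mono nn_integral_mono) (auto simp: indicator_def)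

lemma Lp_norm_le_iff: "0 < p \<Longrightarrow> Lp_norm p v A g \<le> c \<longleftrightarrow>
    (\<integral>\<^sup>+ x\<in>A. ennreal (\<bar>g x\<bar> powr p * v x) \<partial>lebesgue) \<le> epow c p"
  by (simp add: Lp_norm_def epow_inverse_le_iff)

text \<open>Continuity from below of the measure with density |g|^p v.\<close>

lemma Lp_norm_UN_le:
  fixes A :: "nat \<Rightarrow> 'a::euclidean_space set"
  assumes "0 < p" "incseq A" and [measurable]: "\<And>n. A n \<in> sets lebesgue"
      "v \<in> borel_measurable lebesgue" "g \<in> borel_measurable lebesgue"
    and "\<And>n. Lp_norm p v (A n) g \<le> c"
  shows "Lp_norm p v (\<Union>n. A n) g \<le> c"
proof -
  let ?h = "\<lambda>x. ennreal (\<bar>g x\<bar> powr p * v x)"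
  have "(\<integral>\<^sup>+ x\<in>(\<Union>n. A n). ?h x \<partial>lebesgue) = emeasure (density lebesgue ?h) (\<Union>n. A n)"
    by (simp add: emeasure_density)
  also have "\<dots> = (SUP n. emeasure (density lebesgue ?h) (A n))"
    using assms(2) by (intro SUP_emeasure_incseq[symmetric]) auto
  also have "\<dots> \<le> epow c p"
    using assms(6) by (intro SUP_least) (simp add: emeasure_density Lp_norm_le_iff[OF assms(1)])
  finally show ?thesis by (simp add: Lp_norm_le_iff[OF assms(1)])
qed

lemma conj_exp_gt_1: "1 < p \<Longrightarrow> 1 < conj_exp p"
  by (simp add: conj_exp_def field_simps)

lemma conj_exp_add: "1 < p \<Longrightarrow> 1 / p + 1 / conj_exp p = 1"
  by (simp add: conj_exp_def field_simps)

lemma Nf_le_iff: "1 \<le> p \<Longrightarrow> Nf p v A f \<le> c \<longleftrightarrow>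
    (if p = 1 then AE x in lebesgue. x \<in> A \<longrightarrow> ennreal (\<bar>f x\<bar> / v x) \<le> c
     else (\<integral>\<^sup>+ x\<in>A. ennreal (\<bar>f x\<bar> powr conj_exp p * v x powr (1 - conj_exp p)) \<partial>lebesgue)
        \<le> epow c (conj_exp p))"
  using conj_exp_gt_1[of p] by (auto simp: Nf_def esssup_on_le_iff epow_inverse_le_iff)

lemma Nf_mono_AE:
  assumes "1 \<le> p" "AE x in lebesgue. x \<in> A \<longrightarrow> x \<in> B"
  shows "Nf p v A f \<le> Nf p v B f"
proof (cases "p = 1")
  case True
  have "AE x in lebesgue. x \<in> A \<longrightarrow> ennreal (\<bar>f x\<bar> / v x) \<le> Nf p v B f"
    using assms(2) AE_le_esssup_on[where M = lebesgue and A = B and g = "\<lambda>x. ennreal (\<bar>f x\<bar> / v x)"]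
    by eventually_elim (auto simp: Nf_def True)
  then show ?thesis using True by (simp add: Nf_le_iff)
next
  case False
  then have "0 < conj_exp p" using conj_exp_gt_1[of p] assms(1) by simp
  then show ?thesis unfolding Nf_def using False assms(2)
    by (auto intro!: epow_mono nn_integral_mono_AE elim!: eventually_mono simp: indicator_def)
qed

lemma Nf_mono: "1 \<le> p \<Longrightarrow> A \<subseteq> B \<Longrightarrow> Nf p v A f \<le> Nf p v B f"
  by (intro Nf_mono_AE) auto

lemma Nf_empty [simp]: "1 \<le> p \<Longrightarrow> Nf p v {} f = 0"
  using Nf_le_iff[of p v "{}" f 0] by auto

lemma Nf_UN_le:
  fixes A :: "nat \<Rightarrow> 'a::euclidean_space set"
  assumes p: "1 \<le> p" and "incseq A" and [measurable]: "\<And>n. A n \<in> sets lebesgue"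
      "v \<in> borel_measurable lebesgue" "f \<in> borel_measurable lebesgue"
    and le: "\<And>n. Nf p v (A n) f \<le> c"
  shows "Nf p v (\<Union>n. A n) f \<le> c"
proof (cases "p = 1")
  case True
  have "AE x in lebesgue. \<forall>n. x \<in> A n \<longrightarrow> ennreal (\<bar>f x\<bar> / v x) \<le> c"
    using le True by (subst AE_all_countable) (simp add: Nf_le_iff)
  then show ?thesis using True by (auto simp: Nf_le_iff elim!: eventually_mono)
next
  case False
  let ?h = "\<lambda>x. ennreal (\<bar>f x\<bar> powr conj_exp p * v x powr (1 - conj_exp p))"
  have "(\<integral>\<^sup>+ x\<in>(\<Union>n. A n). ?h x \<partial>lebesgue) = emeasure (density lebesgue ?h) (\<Union>n. A n)"
    by (simp add: emeasure_density)
  also have "\<dots> = (SUP n. emeasure (density lebesgue ?h) (A n))"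
    using assms(2) by (intro SUP_emeasure_incseq[symmetric]) auto
  also have "\<dots> \<le> epow c (conj_exp p)"
    using le False p by (intro SUP_least) (simp add: emeasure_density Nf_le_iff)
  finally show ?thesis using False p by (simp add: Nf_le_iff)
qed

text \<open>For p > 1 split f g as (f v^(-1/p)) (g v^(1/p)); raising the first factor to the power
  p' produces v^(1 - p').\<close>

lemma weighted_Holder:
  fixes v :: "'a::euclidean_space \<Rightarrow> real"
  assumes p: "1 \<le> p" and v: "v \<in> Wts"
    and [measurable]: "f \<in> borel_measurable lebesgue" "g \<in> borel_measurable lebesgue" "A \<in> sets lebesgue"
  shows "(\<integral>\<^sup>+ x\<in>A. ennreal \<bar>f x * g x\<bar> \<partial>lebesgue) \<le> 2 * (Nf p v A f * Lp_norm p v A g)"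
proof -
  have [measurable]: "v \<in> borel_measurable lebesgue" and vpos: "AE x in lebesgue. 0 < v x"
    using v by (auto simp: Wts_def)
  show ?thesis
  proof (cases "p = 1")
    case True
    have "(\<integral>\<^sup>+ x\<in>A. ennreal \<bar>f x * g x\<bar> \<partial>lebesgue)
      \<le> (\<integral>\<^sup>+ x. Nf p v A f * (ennreal (\<bar>g x\<bar> powr p * v x) * indicator A x) \<partial>lebesgue)"
      using vpos AE_le_esssup_on[where M = lebesgue and A = A and g = "\<lambda>x. ennreal (\<bar>f x\<bar> / v x)"]
    proof (intro nn_integral_mono_AE, eventually_elim)
      case (elim x)
      show ?case
      proof (cases "x \<in> A")
        case xA: True
        have "ennreal \<bar>f x * g x\<bar> = ennreal (\<bar>f x\<bar> / v x) * ennreal (\<bar>g x\<bar> powr p * v x)"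
          using elim True by (simp add: abs_mult flip: ennreal_mult)
        also have "\<dots> \<le> Nf p v A f * ennreal (\<bar>g x\<bar> powr p * v x)"
          using elim xA True by (intro mult_right_mono) (auto simp: Nf_def)
        finally show ?thesis using xA by simp
      qed simp
    qed
    also have "\<dots> = 1 * (Nf p v A f * Lp_norm p v A g)"
      using True by (simp add: nn_integral_cmult Lp_norm_def)
    also have "\<dots> \<le> 2 * (Nf p v A f * Lp_norm p v A g)"
      by (intro mult_right_mono) auto
    finally show ?thesis .
  next
    case False
    then have p1: "1 < p" using p by simp
    define q where "q = conj_exp p"
    have q: "1 < q" "1 / q + 1 / p = 1" using conj_exp_gt_1[OF p1] conj_exp_add[OF p1] by (auto simp: q_def)
    define F where "F = (\<lambda>x. ennreal (\<bar>f x\<bar> * v x powr (- (1 / p))) * indicator A x)"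
    define G where "G = (\<lambda>x. ennreal (\<bar>g x\<bar> * v x powr (1 / p)) * indicator A x)"
    have [measurable]: "F \<in> borel_measurable lebesgue" "G \<in> borel_measurable lebesgue"
      unfolding F_def G_def by measurable
    have "(\<integral>\<^sup>+ x\<in>A. ennreal \<bar>f x * g x\<bar> \<partial>lebesgue) = (\<integral>\<^sup>+ x. F x * G x \<partial>lebesgue)"
      using vpos
      by (intro nn_integral_cong_AE) (auto elim!: eventually_mono
          simp: F_def G_def indicator_def powr_minus abs_mult simp flip: ennreal_mult)
    also have "\<dots> \<le> 2 * (epow (\<integral>\<^sup>+ x. epow (F x) q \<partial>lebesgue) (1 / q)
        * epow (\<integral>\<^sup>+ x. epow (G x) p \<partial>lebesgue) (1 / p))"
      using q p1 by (intro Holder_nn_integral) auto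
    also have "(\<integral>\<^sup>+ x. epow (F x) q \<partial>lebesgue)
      = (\<integral>\<^sup>+ x\<in>A. ennreal (\<bar>f x\<bar> powr q * v x powr (1 - q)) \<partial>lebesgue)"
    proof (rule nn_integral_cong)
      fix x
      have "- (1 / p) * q = 1 - q" using p1 by (simp add: q_def conj_exp_def field_simps)
      then show "epow (F x) q = ennreal (\<bar>f x\<bar> powr q * v x powr (1 - q)) * indicator A x"
        by (simp add: F_def indicator_def epow_ennreal powr_mult powr_powr)
    qed
    also have "(\<integral>\<^sup>+ x. epow (G x) p \<partial>lebesgue)
      = (\<integral>\<^sup>+ x\<in>A. ennreal (\<bar>g x\<bar> powr p * v x) \<partial>lebesgue)"
      using vpos p1
      by (intro nn_integral_cong_AE) (auto elim!: eventually_mono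
          simp: G_def indicator_def epow_ennreal powr_mult powr_powr)
    finally show ?thesis using False by (simp add: Nf_def Lp_norm_def q_def)
  qed
qed

text \<open>Prepares the duality argument: on the truncated set f is bounded, v is bounded and
  bounded away from 0, and the measure is finite, so that the extremal function can be
  normalised.\<close>

lemma Nf_truncate:
  fixes v f :: "'a::euclidean_space \<Rightarrow> real"
  assumes p: "1 \<le> p" and v: "v \<in> Wts"
    and f [measurable]: "f \<in> borel_measurable lebesgue" and [measurable]: "A \<in> sets lebesgue"
    and c: "c < Nf p v A f"
  obtains n :: nat where "c < Nf p v (A \<inter> {x. 1 / real (Suc n) \<le> v x \<and> v x \<le> real n \<and> \<bar>f x\<bar> \<le> real n} \<inter> ball 0 (real n)) f"
proof -
  have vm [measurable]: "v \<in> borel_measurable lebesgue" and vpos: "AE x in lebesgue. 0 < v x"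
    using v by (auto simp: Wts_def)
  define D where "D n = A \<inter> {x. 1 / real (Suc n) \<le> v x \<and> v x \<le> real n \<and> \<bar>f x\<bar> \<le> real n} \<inter> ball 0 (real n)" for n :: nat
  have Dmeas: "D n \<in> sets lebesgue" for n
  proof -
    have "D n = A \<inter> (v -` {1 / real (Suc n)..real n} \<inter> space lebesgue)
        \<inter> (f -` {- real n..real n} \<inter> space lebesgue) \<inter> ball 0 (real n)"
      by (auto simp: D_def abs_le_iff)
    also have "\<dots> \<in> sets lebesgue"
      by (intro sets.Int measurable_sets[of _ lebesgue borel]) simp_all
    finally show ?thesis .
  qed
  have inc: "incseq D"
  proof (rule incseq_SucI, rule subsetI)
    fix n x assume "x \<in> D n"
    moreover have "1 / real (Suc (Suc n)) \<le> 1 / real (Suc n)" by (intro divide_left_mono) auto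
    ultimately show "x \<in> D (Suc n)" by (auto simp: D_def)
  qed
  \<comment> \<open>As v is positive almost everywhere, the truncations exhaust A up to a null
    set.\<close>
  have "x \<in> (\<Union>n. D n)" if "x \<in> A" "0 < v x" for x
  proof -
    obtain N1 :: nat where N1: "Max {v x, \<bar>f x\<bar>, norm x, 1 / v x} < real N1"
      using reals_Archimedean2 by blast
    then have "1 < real N1 * v x" using that by (simp add: field_simps)
    then have "1 \<le> v x * (1 + real N1)" using that by (simp add: field_simps)
    then have "x \<in> D N1" using N1 that by (auto simp: D_def field_simps)
    then show ?thesis by blast
  qed
  then have "Nf p v A f \<le> Nf p v (\<Union>n. D n) f"
    using p vpos by (intro Nf_mono_AE) (auto elim!: eventually_mono)
  then have "\<not> Nf p v (\<Union>n. D n) f \<le> c" using c by simp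
  then obtain n where "\<not> Nf p v (D n) f \<le> c"
    using Nf_UN_le[OF p inc Dmeas vm f] by blast
  then show thesis using that by (simp add: D_def not_le)
qed

text \<open>Converse of Hoelder's inequality through a normalised extremal function.
  \<open>Nf\<close> may be infinite, and for p = 1 the supremum need not be attained; hence the
  arbitrary c below it.\<close>

lemma Nf_dual:
  fixes v f :: "'a::euclidean_space \<Rightarrow> real"
  assumes p: "1 \<le> p" and v: "v \<in> Wts"
    and f [measurable]: "f \<in> borel_measurable lebesgue" and A [measurable]: "A \<in> sets lebesgue"
    and c: "c < Nf p v A f"
  obtains g :: "'a \<Rightarrow> real" where "g \<in> borel_measurable lebesgue" "\<And>x. 0 \<le> g x"
    "\<And>x. x \<notin> A \<Longrightarrow> g x = 0" "Lp_norm p v UNIV g \<le> 1"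
    "c \<le> (\<integral>\<^sup>+ x. ennreal (\<bar>f x\<bar> * g x) \<partial>lebesgue)"
proof -
  have [measurable]: "v \<in> borel_measurable lebesgue"
    using v by (auto simp: Wts_def)
  obtain n :: nat where n: "c < Nf p v (A \<inter> {x. 1 / real (Suc n) \<le> v x \<and> v x \<le> real n \<and> \<bar>f x\<bar> \<le> real n} \<inter> ball 0 (real n)) f"
    using Nf_truncate[OF p v f A c] by blast
  define D where "D = A \<inter> {x. 1 / real (Suc n) \<le> v x \<and> v x \<le> real n \<and> \<bar>f x\<bar> \<le> real n} \<inter> ball 0 (real n)"
  have "D = A \<inter> (v -` {1 / real (Suc n)..real n} \<inter> space lebesgue)
      \<inter> (f -` {- real n..real n} \<inter> space lebesgue) \<inter> ball 0 (real n)"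
    by (auto simp: D_def abs_le_iff)
  also have "\<dots> \<in> sets lebesgue"
    by (intro sets.Int measurable_sets[of _ lebesgue borel]) simp_all
  finally have [measurable]: "D \<in> sets lebesgue" .
  have DA: "D \<subseteq> A" by (auto simp: D_def)
  have Dv: "0 < v x" "1 / real (Suc n) \<le> v x" "v x \<le> real n" "\<bar>f x\<bar> \<le> real n" if "x \<in> D" for x
  proof -
    have "0 < 1 / real (Suc n)" by simp
    also have "\<dots> \<le> v x" using that by (auto simp: D_def)
    finally show "0 < v x" .
  qed (use that in \<open>auto simp: D_def\<close>)
  have "emeasure lebesgue D \<le> emeasure lebesgue (ball (0::'a) (real n))"
    by (intro emeasure_mono) (auto simp: D_def)
  also have "\<dots> < \<infinity>" using emeasure_lborel_ball_finite[of "0::'a" "real n"] by simp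
  finally have Dfin: "emeasure lebesgue D < \<infinity>" .
  have nD: "c < Nf p v D f" using n by (simp add: D_def)
  have bounded: "(\<integral>\<^sup>+ x\<in>E. ennreal (h x) \<partial>lebesgue) < \<infinity>"
    if "E \<in> sets lebesgue" "E \<subseteq> D" "\<And>x. x \<in> E \<Longrightarrow> h x \<le> K" for E h K
  proof -
    have "(\<integral>\<^sup>+ x\<in>E. ennreal (h x) \<partial>lebesgue) \<le> (\<integral>\<^sup>+ x. ennreal K * indicator E x \<partial>lebesgue)"
      using that by (intro nn_integral_mono) (auto simp: indicator_def intro!: ennreal_leI)
    also have "\<dots> = ennreal K * emeasure lebesgue E"
      using that by (simp add: nn_integral_cmult)
    also have "\<dots> \<le> ennreal K * emeasure lebesgue D"
      using that by (intro mult_left_mono emeasure_mono) auto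
    also have "\<dots> < \<infinity>" using Dfin by (simp add: ennreal_mult_less_top)
    finally show ?thesis .
  qed
  show thesis
  proof (cases "p = 1")
    case True
    \<comment> \<open>For p = 1 the mass is concentrated where |f| / v exceeds c. This set has
      positive weighted measure because c is below the essential supremum over
      \<open>D\<close>.\<close>
    define E where "E = {x \<in> D. c < ennreal (\<bar>f x\<bar> / v x)}"
    have "E = D \<inter> {x \<in> space lebesgue. c < ennreal (\<bar>f x\<bar> / v x)}" by (auto simp: E_def)
    also have "\<dots> \<in> sets lebesgue" by measurable
    finally have [measurable]: "E \<in> sets lebesgue" .
    define s where "s = (\<integral>\<^sup>+ x\<in>E. ennreal (v x) \<partial>lebesgue)"
    have "s < \<infinity>" unfolding s_def
      by (rule bounded[of _ _ "real n"]) (auto simp: E_def Dv)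
    moreover have "s \<noteq> 0"
    proof
      assume "s = 0"
      then have "AE x in lebesgue. ennreal (v x) * indicator E x = 0"
        by (simp add: s_def nn_integral_0_iff_AE)
      then have "AE x in lebesgue. x \<in> D \<longrightarrow> ennreal (\<bar>f x\<bar> / v x) \<le> c"
      proof eventually_elim
        case (elim x)
        then show ?case using Dv(1)[of x] by (cases "x \<in> E") (auto simp: E_def)
      qed
      then have "Nf p v D f \<le> c" using True by (simp add: Nf_le_iff)
      then show False using nD by simp
    qed
    ultimately obtain t where t: "s = ennreal t" "0 < t"
      by (cases s) (auto simp: ennreal_eq_0_iff)
    define g where "g = (\<lambda>x. indicator E x / t)"
    have int: "(\<integral>\<^sup>+ x. ennreal (v x / t) * indicator E x \<partial>lebesgue) = 1"
    proof -
      have "(\<integral>\<^sup>+ x. ennreal (v x / t) * indicator E x \<partial>lebesgue)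
        = (\<integral>\<^sup>+ x. ennreal (1 / t) * (ennreal (v x) * indicator E x) \<partial>lebesgue)"
        using t by (intro nn_integral_cong) (auto simp: indicator_def E_def Dv less_imp_le simp flip: ennreal_mult)
      also have "\<dots> = ennreal (1 / t) * s" by (simp add: nn_integral_cmult s_def)
      also have "\<dots> = 1" using t by (simp flip: ennreal_mult)
      finally show ?thesis .
    qed
    show thesis
    proof (rule that[of g])
      show "g \<in> borel_measurable lebesgue" unfolding g_def by measurable
      show "0 \<le> g x" "x \<notin> A \<Longrightarrow> g x = 0" for x
        using t DA by (auto simp: g_def E_def indicator_def)
      have "(\<integral>\<^sup>+ x\<in>UNIV. ennreal (\<bar>g x\<bar> powr p * v x) \<partial>lebesgue)
         = (\<integral>\<^sup>+ x. ennreal (v x / t) * indicator E x \<partial>lebesgue)"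
        using t True by (intro nn_integral_cong) (auto simp: g_def indicator_def)
      then show "Lp_norm p v UNIV g \<le> 1" using p int by (simp add: Lp_norm_le_iff)
      have "c = c * (\<integral>\<^sup>+ x. ennreal (v x / t) * indicator E x \<partial>lebesgue)" using int by simp
      also have "\<dots> = (\<integral>\<^sup>+ x. c * (ennreal (v x / t) * indicator E x) \<partial>lebesgue)"
        by (simp add: nn_integral_cmult)
      also have "\<dots> \<le> (\<integral>\<^sup>+ x. ennreal (\<bar>f x\<bar> * g x) \<partial>lebesgue)"
      proof (intro nn_integral_mono)
        fix x
        show "c * (ennreal (v x / t) * indicator E x) \<le> ennreal (\<bar>f x\<bar> * g x)"
        proof (cases "x \<in> E")
          case True
          then have "0 < v x" "c \<le> ennreal (\<bar>f x\<bar> / v x)" by (auto simp: E_def Dv)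
          then have "c * ennreal (v x / t) \<le> ennreal (\<bar>f x\<bar> / v x) * ennreal (v x / t)"
            by (intro mult_right_mono) auto
          also have "\<dots> = ennreal (\<bar>f x\<bar> * g x)"
            using \<open>0 < v x\<close> t True by (simp add: g_def flip: ennreal_mult)
          finally show ?thesis using True by simp
        qed simp
      qed
      finally show "c \<le> (\<integral>\<^sup>+ x. ennreal (\<bar>f x\<bar> * g x) \<partial>lebesgue)" .
    qed
  next
    case False
    then have p1: "1 < p" using p by simp
    define q where "q = conj_exp p"
    have q: "1 < q" "1 / q + 1 / p = 1" using conj_exp_gt_1[OF p1] conj_exp_add[OF p1] by (auto simp: q_def)
    have qp: "(q - 1) * p = q" "(1 - q) * p = - q"
      using p1 by (auto simp: q_def conj_exp_def field_simps)
    define h where "h = (\<lambda>x. \<bar>f x\<bar> powr q * v x powr (1 - q))"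
    have [measurable]: "h \<in> borel_measurable lebesgue" unfolding h_def by measurable
    define J where "J = (\<integral>\<^sup>+ x\<in>D. ennreal (h x) \<partial>lebesgue)"
    have "epow c q < J"
      using nD False p1 by (auto simp: Nf_le_iff J_def h_def q_def simp flip: not_le)
    moreover have "J < \<infinity>" unfolding J_def
    proof (rule bounded[of _ _ "real n powr q * (1 / real (Suc n)) powr (1 - q)"])
      fix x assume "x \<in> D"
      then show "h x \<le> real n powr q * (1 / real (Suc n)) powr (1 - q)"
        unfolding h_def using q Dv[of x] by (intro mult_mono powr_mono2 powr_mono2') auto
    qed auto
    moreover from calculation(1) have "J \<noteq> 0" by auto
    ultimately obtain t where t: "J = ennreal t" "0 < t"
      by (cases J) (auto simp: less_le)
    \<comment> \<open>The equality case of Hoelder's inequality: |g|^p v is proportional to |f|^q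
      v^(1 - q), and t^(1/p) normalises it. Pairing with |f| gives t / t^(1/p) = t^(1/q).\<close>
    define g where "g = (\<lambda>x. indicator D x * (\<bar>f x\<bar> powr (q - 1) * v x powr (1 - q)) / t powr (1 / p))"
    show thesis
    proof (rule that[of g])
      show "g \<in> borel_measurable lebesgue" unfolding g_def by measurable
      show "0 \<le> g x" "x \<notin> A \<Longrightarrow> g x = 0" for x
        using t DA by (auto simp: g_def indicator_def)
      have "(\<integral>\<^sup>+ x\<in>UNIV. ennreal (\<bar>g x\<bar> powr p * v x) \<partial>lebesgue)
         = (\<integral>\<^sup>+ x. ennreal (1 / t) * (ennreal (h x) * indicator D x) \<partial>lebesgue)"
      proof (intro nn_integral_cong)
        fix x
        show "ennreal (\<bar>g x\<bar> powr p * v x) * indicator UNIV x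
           = ennreal (1 / t) * (ennreal (h x) * indicator D x)"
        proof (cases "x \<in> D")
          case True
          have "\<bar>g x\<bar> powr p * v x = \<bar>f x\<bar> powr q * (v x powr (- q) * v x) / t"
            using True t p1 by (simp add: g_def powr_divide powr_mult powr_powr qp)
          also have "v x powr (- q) * v x = v x powr (1 - q)"
            using Dv(1)[OF True] powr_mult_base[of "v x" "- q"] by (simp add: mult.commute)
          finally show ?thesis
            using True t by (simp add: h_def flip: ennreal_mult)
        qed (use p1 in \<open>simp add: g_def\<close>)
      qed
      also have "\<dots> = ennreal (1 / t) * J" by (simp add: nn_integral_cmult J_def)
      also have "\<dots> = 1" using t by (simp flip: ennreal_mult)
      finally show "Lp_norm p v UNIV g \<le> 1" using p1 by (simp add: Lp_norm_le_iff)
      have "c \<le> epow J (1 / q)"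
        using \<open>epow c q < J\<close> q by (simp add: le_epow_inverse_iff)
      also have "\<dots> = ennreal (t / t powr (1 / p))"
      proof -
        have "1 / q = 1 - 1 / p" using q by simp
        then show ?thesis using t by (simp add: epow_ennreal powr_diff)
      qed
      also have "\<dots> = ennreal (1 / t powr (1 / p)) * J" using t by (simp flip: ennreal_mult)
      also have "\<dots> = (\<integral>\<^sup>+ x. ennreal (1 / t powr (1 / p)) * (ennreal (h x) * indicator D x) \<partial>lebesgue)"
        by (simp add: nn_integral_cmult J_def)
      also have "\<dots> = (\<integral>\<^sup>+ x. ennreal (\<bar>f x\<bar> * g x) \<partial>lebesgue)"
      proof (intro nn_integral_cong)
        fix x
        have "\<bar>f x\<bar> * \<bar>f x\<bar> powr (q - 1) = \<bar>f x\<bar> powr q"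
          using powr_mult_base[of "\<bar>f x\<bar>" "q - 1"] by simp
        then show "ennreal (1 / t powr (1 / p)) * (ennreal (h x) * indicator D x) = ennreal (\<bar>f x\<bar> * g x)"
          using t by (simp add: g_def h_def indicator_def flip: ennreal_mult mult.assoc)
      qed
      finally show "c \<le> (\<integral>\<^sup>+ x. ennreal (\<bar>f x\<bar> * g x) \<partial>lebesgue)" .
    qed
  qed
qed

section \<open>Dyadic blocks of the weight\<close>

text \<open>Such a set is empty, the whole line or a half-line. This supplies the measurability of
  monotone functions and of the level sets.\<close>

lemma up_closed_borel:
  fixes U :: "real set"
  assumes "\<And>s t. s \<in> U \<Longrightarrow> s \<le> t \<Longrightarrow> t \<in> U"
  shows "U \<in> sets borel"
proof (cases "U = {} \<or> \<not> bdd_below U")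
  case True
  then have "U = {} \<or> U = UNIV"
    using assms by (metis UNIV_eq_I bdd_belowI linear)
  then show ?thesis by auto
next
  case False
  have "{Inf U<..} \<subseteq> U"
    using False assms cInf_less_iff[of U] by (force intro: less_imp_le)
  moreover have "U \<subseteq> {Inf U..}" using False by (auto intro: cInf_lower)
  ultimately have "U = (if Inf U \<in> U then {Inf U..} else {Inf U<..})"
    by (auto simp: le_less)
  then show ?thesis by (metis atLeast_borel greaterThan_borel)
qed

lemma antimono_borel_measurable:
  fixes h :: "real \<Rightarrow> ennreal"
  assumes "antimono h"
  shows "h \<in> borel_measurable borel"
proof (rule borel_measurableI_greater)
  fix y
  have "- {x. y < h x} \<in> sets borel"
    using assms by (intro up_closed_borel) (auto simp: antimono_def not_less intro: order_trans)
  then have "- (- {x. y < h x}) \<in> sets borel" by (rule borel_comp)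
  then show "{x \<in> space borel. y < h x} \<in> sets borel" by simp
qed

definition pow2 :: "int \<Rightarrow> ennreal" where "pow2 k = ennreal (2 powr of_int k)"

lemma pow2_0 [simp]: "pow2 0 = 1"
  by (simp add: pow2_def)

lemma pow2_eq_0 [simp]: "pow2 k \<noteq> 0" and pow2_eq_top [simp]: "pow2 k \<noteq> top"
  and pow2_less_top [simp]: "pow2 k < top"
  by (auto simp: pow2_def ennreal_eq_0_iff)

lemma pow2_add: "pow2 (j + k) = pow2 j * pow2 k"
  by (simp add: pow2_def powr_add ennreal_mult)

lemma pow2_mult_minus [simp]: "pow2 k * pow2 (- k) = 1" "pow2 (- k) * pow2 k = 1"
  by (simp_all flip: pow2_add)

lemma inverse_pow2: "inverse (pow2 k) = pow2 (- k)"
  by (simp add: pow2_def inverse_ennreal powr_minus)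

lemma epow_pow2: "epow (pow2 k) r = ennreal (2 powr (of_int k * r))"
  by (simp add: pow2_def epow_ennreal powr_powr)

text \<open>Only the set with index \<kappa> x can contain x, so the series has a single term.
  Blocks, annuli and dyadic intervals are all families of this kind, and the lemma is applied after
  a sum and an integral have been interchanged.\<close>

lemma nn_integral_count_space_indicator_disjoint:
  assumes "\<And>k x. x \<in> B k \<Longrightarrow> k = \<kappa> x"
  shows "(\<integral>\<^sup>+ k. h k * indicator (B k) x \<partial>count_space UNIV) = h (\<kappa> x) * indicator (B (\<kappa> x)) x"
proof -
  have "(\<integral>\<^sup>+ k. h k * indicator (B k) x \<partial>count_space UNIV)
    = (\<integral>\<^sup>+ k. h k * indicator (B k) x \<partial>count_space {\<kappa> x})"
    using assms by (intro nn_integral_count_space_eq) (auto simp: indicator_def)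
  then show ?thesis by (simp add: nn_integral_count_space_finite del: sum_mult_indicator)
qed

lemma AE_lebesgue_neq: "AE x in lebesgue. x \<noteq> (a::'a::euclidean_space)"
  by (rule AE_I'[of "{a}"]) (auto simp: negligible_iff_null_sets[symmetric])

section \<open>The tail norm of the weight and its dyadic levels\<close>

locale weight_profile =
  fixes \<theta> :: ennreal and \<omega> :: "real \<Rightarrow> real"
  assumes theta_pos: "0 < \<theta>" and omega: "\<omega> \<in> Omega \<theta>"
begin

abbreviation W :: "real \<Rightarrow> ennreal" where "W \<equiv> wnorm \<theta> \<omega>"

lemma omega_measurable [measurable]: "\<omega> \<in> borel_measurable lebesgue"
  using omega by (simp add: Omega_def)

lemma W_antimono: "s \<le> t \<Longrightarrow> W t \<le> W s"
  unfolding wnorm_def by (intro lnorm_mono theta_pos) auto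

lemma W_pos [simp]: "0 < W t"
proof -
  have "0 < W (max t 1)" using omega by (simp add: Omega_def)
  also have "\<dots> \<le> W t" by (intro W_antimono) simp
  finally show ?thesis .
qed

lemma W_neq_0 [simp]: "W t \<noteq> 0"
  using W_pos[of t] by (metis less_irrefl)

lemma W_finite: "0 < t \<Longrightarrow> W t < top"
  using omega by (simp add: Omega_def)

lemma W_le_iff: "W t \<le> c \<longleftrightarrow>
    (if \<theta> = \<infinity> then AE r in lebesgue. r \<in> {t<..} \<inter> {0<..} \<longrightarrow> ennreal (\<omega> r) \<le> c
     else (\<integral>\<^sup>+ r\<in>{t<..} \<inter> {0<..}. epow (ennreal (\<omega> r)) (enn2real \<theta>) \<partial>lebesgue) \<le> epow c (enn2real \<theta>))"
  unfolding wnorm_def by (rule lnorm_le_iff[OF theta_pos])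

lemma W_le_iff_AE:
  assumes "\<theta> = \<infinity>"
  shows "W t \<le> c \<longleftrightarrow> (AE r in lebesgue. t < r \<longrightarrow> 0 < r \<longrightarrow> ennreal (\<omega> r) \<le> c)"
  unfolding W_le_iff by (simp add: assms imp_conjL)

text \<open>For finite \<theta> the mass of (t, infinity) is \<open>W t\<close> to the power
  \<theta>, so continuity of measures becomes continuity of \<open>W\<close>. For infinite \<theta>
  the exponent is the junk value 0, and pointwise bounds take over.\<close>

definition omega_measure :: "real measure" where
  "omega_measure = density lebesgue (\<lambda>r. epow (ennreal (\<omega> r)) (enn2real \<theta>) * indicator {0<..} r)"

lemma sets_omega_measure [simp, measurable_cong]: "sets omega_measure = sets lebesgue"
  by (simp add: omega_measure_def)

lemma emeasure_omega_measure:
  "A \<in> sets lebesgue \<Longrightarrow> emeasure omega_measure A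
    = (\<integral>\<^sup>+ r\<in>A \<inter> {0<..}. epow (ennreal (\<omega> r)) (enn2real \<theta>) \<partial>lebesgue)"
proof -
  assume A: "A \<in> sets lebesgue"
  have [measurable]: "(indicator {0<..} :: real \<Rightarrow> ennreal) \<in> borel_measurable lebesgue"
    by (rule borel_measurable_indicator) simp
  have "(\<lambda>r. epow (ennreal (\<omega> r)) (enn2real \<theta>) * indicator {0<..} r) \<in> borel_measurable lebesgue"
    by measurable
  from emeasure_density[OF this A] show ?thesis
    unfolding omega_measure_def by (auto intro!: nn_integral_cong simp: indicator_def)
qed

lemma omega_measure_mono_AE:
  assumes "A \<in> sets lebesgue" "B \<in> sets lebesgue" "AE r in lebesgue. r \<in> A \<longrightarrow> 0 < r \<longrightarrow> r \<in> B"
  shows "emeasure omega_measure A \<le> emeasure omega_measure B"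
  using assms by (auto simp: emeasure_omega_measure indicator_def elim!: eventually_mono intro!: nn_integral_mono_AE)

lemma theta_real_pos: "\<theta> \<noteq> \<infinity> \<Longrightarrow> 0 < enn2real \<theta>"
  using theta_pos by (simp add: enn2real_positive_iff less_top)

lemma W_le_iff_omega_measure: "\<theta> \<noteq> \<infinity> \<Longrightarrow> W t \<le> c \<longleftrightarrow> emeasure omega_measure {t<..} \<le> epow c (enn2real \<theta>)"
  by (simp add: W_le_iff emeasure_omega_measure)

lemma omega_measure_greaterThan: "\<theta> \<noteq> \<infinity> \<Longrightarrow> emeasure omega_measure {t<..} = epow (W t) (enn2real \<theta>)"
  by (simp add: emeasure_omega_measure wnorm_def lnorm_def theta_real_pos)

text \<open>An open half-line is a countable union of smaller ones, whichever kind of norm is used.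
  In this form the fact also applies at t = 0, where finiteness of \<open>W\<close> is not known
  beforehand.\<close>

lemma W_right_continuous:
  assumes "\<And>s. t < s \<Longrightarrow> W s \<le> c"
  shows "W t \<le> c"
proof (cases "\<theta> = \<infinity>")
  case True
  have "AE r in lebesgue. \<forall>n. t + 1 / real (Suc n) < r \<longrightarrow> 0 < r \<longrightarrow> ennreal (\<omega> r) \<le> c"
    using assms by (subst AE_all_countable) (simp flip: W_le_iff_AE[OF True])
  then have "AE r in lebesgue. t < r \<longrightarrow> 0 < r \<longrightarrow> ennreal (\<omega> r) \<le> c"
  proof eventually_elim
    case (elim r)
    show ?case
    proof (intro impI)
      assume r: "t < r" "0 < r"
      then obtain n where "inverse (real (Suc n)) < r - t" using reals_Archimedean[of "r - t"] by auto
      then show "ennreal (\<omega> r) \<le> c" using elim r by (auto simp: inverse_eq_divide algebra_simps)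
    qed
  qed
  then show ?thesis by (simp add: W_le_iff_AE[OF True])
next
  case False
  have "{t<..} = (\<Union>n. {t + 1 / real (Suc n)<..})"
  proof safe
    fix r assume "t < r"
    then obtain n where "inverse (real (Suc n)) < r - t" using reals_Archimedean[of "r - t"] by auto
    then show "r \<in> (\<Union>n. {t + 1 / real (Suc n)<..})"
      by (intro UN_I[of n]) (auto simp: inverse_eq_divide algebra_simps)
  next
    fix r n assume "t + 1 / real (Suc n) < r"
    then show "t < r" by (smt (verit) divide_pos_pos of_nat_0_less_iff zero_less_Suc)
  qed
  then have "emeasure omega_measure {t<..} = (SUP n. emeasure omega_measure {t + 1 / real (Suc n)<..})"
    by (simp only:) (subst SUP_emeasure_incseq, auto simp: incseq_Suc_iff frac_le intro: order.strict_trans1[rotated] add_left_mono)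
  also have "\<dots> \<le> epow c (enn2real \<theta>)"
    using assms[of "t + 1 / real (Suc n)" for n] False
    by (intro SUP_least) (simp add: W_le_iff_omega_measure)
  finally show ?thesis using False by (simp add: W_le_iff_omega_measure)
qed

text \<open>The floor makes the bound W \<le> 2^-k the closed one, so that by right continuity
  \<open>level_above k\<close> contains its left end point if that is positive. Only t > 0 is
  meaningful: \<open>W 0\<close> may be infinite, and its real value is then 0.\<close>

definition level :: "real \<Rightarrow> int" where "level t = \<lfloor>- log 2 (enn2real (W t))\<rfloor>"

lemma le_level_iff:
  assumes "0 < t" shows "k \<le> level t \<longleftrightarrow> W t \<le> pow2 (- k)"
proof -
  obtain w where w: "W t = ennreal w" "0 < w"
    using W_finite[OF assms] W_pos[of t] by (cases "W t") auto
  have "k \<le> level t \<longleftrightarrow> log 2 w \<le> - of_int k"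
    using w by (auto simp: level_def le_floor_iff)
  also have "\<dots> \<longleftrightarrow> w \<le> 2 powr (- of_int k)" using w by (simp add: log_le_iff)
  finally show ?thesis using w by (simp add: pow2_def)
qed

lemma level_less_iff: "0 < t \<Longrightarrow> level t < k \<longleftrightarrow> pow2 (- k) < W t"
  using le_level_iff[of t k] by (auto simp flip: not_le)

lemma level_mono: "0 < s \<Longrightarrow> s \<le> t \<Longrightarrow> level s \<le> level t"
  using le_level_iff[of s "level s"] le_level_iff[of t "level s"] W_antimono[of s t] by (auto intro: order_trans)

definition level_above :: "int \<Rightarrow> real set" where "level_above k = {t. 0 < t \<and> k \<le> level t}"

(* A junk value if level_above k is empty, which happens for theta = infinity and large k
   when W has a positive limit at infinity. *)
definition rad :: "int \<Rightarrow> real" where "rad k = Inf (level_above k)"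

definition block :: "int \<Rightarrow> real set" where "block k = {t. 0 < t \<and> level t = k}"

lemma level_above_up: "s \<in> level_above k \<Longrightarrow> s \<le> t \<Longrightarrow> t \<in> level_above k"
  using level_mono[of s t] by (auto simp: level_above_def)

lemma level_above_measurable [measurable]: "level_above k \<in> sets borel"
  using level_above_up by (rule up_closed_borel)

lemma block_eq: "block k = level_above k - level_above (k + 1)"
  by (auto simp: block_def level_above_def)

lemma block_measurable [measurable]: "block k \<in> sets borel"
  by (simp add: block_eq sets.Diff)

lemma bdd_below_level_above: "bdd_below (level_above k)"
  by (auto simp: level_above_def intro!: bdd_belowI[of _ 0])

lemma rad_le: "t \<in> level_above k \<Longrightarrow> rad k \<le> t"
  unfolding rad_def by (intro cInf_lower bdd_below_level_above)

lemma rad_nonneg: "level_above k \<noteq> {} \<Longrightarrow> 0 \<le> rad k"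
  unfolding rad_def by (intro cInf_greatest) (auto simp: level_above_def)

lemma rad_less: "level_above k \<noteq> {} \<Longrightarrow> rad k < t \<Longrightarrow> t \<in> level_above k"
  unfolding rad_def by (subst (asm) cInf_less_iff) (auto simp: bdd_below_level_above intro: level_above_up)

text \<open>Right continuity carries the bound to the left end point, even if this is 0 and
  therefore outside \<open>level_above k\<close>.\<close>

lemma W_rad_le:
  assumes "level_above k \<noteq> {}" shows "W (rad k) \<le> pow2 (- k)"
proof (rule W_right_continuous)
  fix s assume "rad k < s"
  then have "0 < s" "k \<le> level s" using rad_less[OF assms] by (auto simp: level_above_def)
  then show "W s \<le> pow2 (- k)" by (simp add: le_level_iff)
qed

lemma rad_in_level_above: "level_above k \<noteq> {} \<Longrightarrow> 0 < rad k \<Longrightarrow> rad k \<in> level_above k"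
  by (simp add: level_above_def le_level_iff W_rad_le)

lemma AE_level_above: "AE r in lebesgue. r \<in> level_above k \<longrightarrow> r \<in> {rad k<..} \<inter> {0<..}"
  using AE_lebesgue_neq[of "rad k"]
proof eventually_elim
  case (elim r)
  then show ?case using rad_le[of r k] by (auto simp: level_above_def)
qed

lemma omega_measure_level_above_le:
  assumes "\<theta> \<noteq> \<infinity>" shows "emeasure omega_measure (level_above k) \<le> epow (pow2 (- k)) (enn2real \<theta>)"
proof (cases "level_above k = {}")
  case False
  have "emeasure omega_measure (level_above k) \<le> emeasure omega_measure {rad k<..}"
    using AE_level_above[of k] by (intro omega_measure_mono_AE) (auto elim!: eventually_mono)
  also have "\<dots> \<le> epow (pow2 (- k)) (enn2real \<theta>)"
    using W_rad_le[OF False] assms by (simp add: W_le_iff_omega_measure)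
  finally show ?thesis .
qed simp

lemma omega_measure_greaterThan_finite: "\<theta> \<noteq> \<infinity> \<Longrightarrow> 0 < t \<Longrightarrow> emeasure omega_measure {t<..} \<noteq> \<infinity>"
  using W_finite[of t] by (simp add: omega_measure_greaterThan)

text \<open>The masses of the tails are finite and tend to 0 by continuity from above, so every
  level is reached.\<close>

lemma level_above_nonempty:
  assumes "\<theta> \<noteq> \<infinity>" shows "level_above k \<noteq> {}"
proof -
  have "(INF n. emeasure omega_measure {real (Suc n)<..}) = emeasure omega_measure (\<Inter>n. {real (Suc n)<..})"
    using omega_measure_greaterThan_finite[OF assms]
    by (intro INF_emeasure_decseq) (auto simp: decseq_Suc_iff simp del: of_nat_Suc)
  also have "(\<Inter>n. {real (Suc n)<..}) = {}"
  proof -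
    have "\<exists>n. \<not> real (Suc n) < x" for x
      using real_arch_simple[of x] by (metis not_less of_nat_Suc le_add_same_cancel2 order_trans zero_le_one add.commute)
    then show ?thesis by blast
  qed
  finally have "(INF n. emeasure omega_measure {real (Suc n)<..}) < epow (pow2 (- k)) (enn2real \<theta>)"
    by (simp add: epow_pow2)
  then obtain n where "emeasure omega_measure {real (Suc n)<..} < epow (pow2 (- k)) (enn2real \<theta>)"
    by (auto simp: INF_less_iff)
  then have "W (real (Suc n)) \<le> pow2 (- k)" using assms by (simp add: W_le_iff_omega_measure)
  then have "real (Suc n) \<in> level_above k" by (simp add: level_above_def le_level_iff)
  then show ?thesis by blast
qed

text \<open>Positive points left of \<open>rad k\<close> have not reached level k, so their tails
  have mass above 2^(-k \<theta>); continuity from above passes this on to \<open>rad k\<close>. The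
  point t of lower level forces \<open>rad k\<close> to be positive and so leaves room on its
  left.\<close>

lemma le_omega_measure_level_above:
  assumes fin: "\<theta> \<noteq> \<infinity>" and t: "0 < t" "level t < k"
  shows "epow (pow2 (- k)) (enn2real \<theta>) \<le> emeasure omega_measure (level_above k)"
proof -
  define a where "a = rad k"
  have ne: "level_above k \<noteq> {}" by (rule level_above_nonempty[OF fin])
  have "t \<le> s" if "s \<in> level_above k" for s
    using level_mono[of s t] that t by (force simp: level_above_def)
  then have "t \<le> a" unfolding a_def rad_def using ne by (intro cInf_greatest)
  with t have a: "0 < a" by simp
  \<comment> \<open>These points increase to a; the shift by 2 makes them positive from n = 0
    on.\<close>
  define s where "s n = a - a / real (n + 2)" for n
  have s: "0 < s n" "s n < a" for n
    using a by (auto simp: s_def field_simps intro: add_pos_nonneg)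
  have incs: "s m \<le> s n" if "m \<le> n" for m n
    using a that by (auto simp: s_def intro!: divide_left_mono)
  have "epow (pow2 (- k)) (enn2real \<theta>) \<le> emeasure omega_measure {s n<..}" for n
  proof -
    have "s n \<notin> level_above k" using rad_le[of "s n" k] s[of n] by (auto simp: a_def)
    then have "pow2 (- k) < W (s n)" using s[of n] by (auto simp: level_above_def level_less_iff not_le)
    then show ?thesis using fin by (simp add: omega_measure_greaterThan theta_real_pos)
  qed
  then have "epow (pow2 (- k)) (enn2real \<theta>) \<le> (INF n. emeasure omega_measure {s n<..})"
    by (rule INF_greatest)
  also have "\<dots> = emeasure omega_measure (\<Inter>n. {s n<..})"
    using omega_measure_greaterThan_finite[OF fin s(1)] incs
    by (intro INF_emeasure_decseq) (auto simp: decseq_def intro: le_less_trans)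
  also have "\<dots> \<le> emeasure omega_measure (level_above k)"
  proof (rule omega_measure_mono_AE)
    have "(\<lambda>n. a / real (n + 2)) \<longlonglongrightarrow> 0"
      using lim_const_over_n[THEN LIMSEQ_ignore_initial_segment, of a 2] .
    then have lim: "s \<longlonglongrightarrow> a" unfolding s_def using tendsto_diff[OF tendsto_const[of a]] by fastforce
    show "AE r in lebesgue. r \<in> (\<Inter>n. {s n<..}) \<longrightarrow> 0 < r \<longrightarrow> r \<in> level_above k"
      using AE_lebesgue_neq[of a]
    proof eventually_elim
      case (elim r)
      show ?case
      proof (intro impI)
        assume "r \<in> (\<Inter>n. {s n<..})"
        then have "\<forall>n. s n \<le> r" by (auto intro: less_imp_le)
        then have "a \<le> r" using LIMSEQ_le_const2[OF lim] by blast
        then show "r \<in> level_above k" using elim rad_less[OF ne, of r] by (simp add: a_def)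
      qed
    qed
  qed auto
  finally show ?thesis .
qed

lemma omega_measure_block_le: "\<theta> \<noteq> \<infinity> \<Longrightarrow> emeasure omega_measure (block k) \<le> epow (pow2 (- k)) (enn2real \<theta>)"
  using omega_measure_level_above_le[of k] emeasure_mono[of "block k" "level_above k" omega_measure] by (auto simp: block_eq intro: order_trans)

text \<open>The mass from level k on is at least 2^(-k \<theta>), that from level k + 1 on at most
  2^-\<theta> times this number; the block carries the difference.\<close>

lemma le_omega_measure_block:
  assumes fin: "\<theta> \<noteq> \<infinity>" and t: "0 < t" "level t < k"
  shows "epow (pow2 (- k)) (enn2real \<theta>)
    \<le> ennreal (1 / (1 - 2 powr - enn2real \<theta>)) * emeasure omega_measure (block k)"
proof -
  define \<delta> where "\<delta> = 2 powr - enn2real \<theta>"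
  have \<delta>: "0 < \<delta>" "\<delta> < 1" using theta_real_pos[OF fin] by (auto simp: \<delta>_def powr_less_one)
  define c where "c = 2 powr (- of_int k * enn2real \<theta>)"
  have c: "0 < c" "epow (pow2 (- k)) (enn2real \<theta>) = ennreal c"
    by (auto simp: c_def epow_pow2)
  have c': "epow (pow2 (- (k + 1))) (enn2real \<theta>) = ennreal (c * \<delta>)"
    by (simp add: c_def \<delta>_def epow_pow2 algebra_simps flip: powr_add)
  have "ennreal c \<le> emeasure omega_measure (level_above k)" using le_omega_measure_level_above[OF fin t] c by simp
  also have "\<dots> = emeasure omega_measure (block k \<union> level_above (k + 1))"
    by (rule arg_cong[where f = "emeasure omega_measure"]) (auto simp: block_eq level_above_def)
  also have "\<dots> \<le> emeasure omega_measure (block k) + emeasure omega_measure (level_above (k + 1))"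
    by (intro emeasure_subadditive) auto
  also have "\<dots> \<le> emeasure omega_measure (block k) + ennreal (c * \<delta>)"
    using omega_measure_level_above_le[OF fin, of "k + 1"] c' by (intro add_left_mono) simp
  finally have *: "ennreal c \<le> emeasure omega_measure (block k) + ennreal (c * \<delta>)" .
  show ?thesis
  proof (cases "emeasure omega_measure (block k)")
    case (real m)
    then have "c \<le> m + c * \<delta>" using * c \<delta> by (simp flip: ennreal_plus)
    then have "c \<le> 1 / (1 - \<delta>) * m" using \<delta> by (simp add: field_simps)
    then show ?thesis using real c \<delta> by (simp add: \<delta>_def[symmetric] ennreal_leI flip: ennreal_mult)
  next
    case top
    then show ?thesis using \<delta> by (simp add: \<delta>_def[symmetric] ennreal_mult_top ennreal_eq_0_iff)
  qed
qed

lemma AE_omega_le_block: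
  assumes "\<theta> = \<infinity>" shows "AE r in lebesgue. r \<in> block k \<longrightarrow> ennreal (\<omega> r) \<le> pow2 (- k)"
proof (cases "level_above k = {}")
  case False
  then have "AE r in lebesgue. rad k < r \<longrightarrow> 0 < r \<longrightarrow> ennreal (\<omega> r) \<le> pow2 (- k)"
    using W_rad_le[OF False] by (simp add: W_le_iff_AE[OF assms])
  with AE_level_above[of k] show ?thesis
    by eventually_elim (auto simp: block_eq)
qed (simp add: block_eq)

end

section \<open>Upper estimates\<close>

locale morrey = weight_profile +
  fixes p :: real and v :: "'a::euclidean_space \<Rightarrow> real"
  assumes p: "1 \<le> p" and v: "v \<in> Wts"
begin

lemma p_pos: "0 < p" using p by simp

lemma v_measurable [measurable]: "v \<in> borel_measurable lebesgue"
  using v by (simp add: Wts_def)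

definition annulus :: "int \<Rightarrow> 'a set" where "annulus k = {x. norm x \<in> block k}"

lemma annulus_measurable [measurable]: "annulus k \<in> sets lebesgue"
proof -
  have "annulus k = norm -` block k \<inter> space borel" by (auto simp: annulus_def)
  also have "\<dots> \<in> sets borel" by (rule measurable_sets[OF borel_measurable_norm]) auto
  finally show ?thesis by simp
qed

lemma ball_measurable [measurable]: "ball (0::'a) t \<in> sets lebesgue" "- ball (0::'a) t \<in> sets lebesgue"
  by simp_all

lemma annulus_subset_ball: "s \<in> level_above (k + 1) \<Longrightarrow> annulus k \<subseteq> ball 0 s"
proof
  fix x assume s: "s \<in> level_above (k + 1)" and "x \<in> annulus k"
  then have x: "0 < norm x" "level (norm x) = k" by (auto simp: annulus_def block_def)
  have "norm x < s"
  proof (rule ccontr)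
    assume "\<not> norm x < s"
    then have "norm x \<in> level_above (k + 1)" using level_above_up[OF s] by simp
    then show False using x by (simp add: level_above_def)
  qed
  then show "x \<in> ball 0 s" by simp
qed

text \<open>Annulus k is weighed by the mass of block k + 1: for r in that block the ball of radius
  r contains the annulus, and a point of the annulus supplies the lower level that
  \<open>le_omega_measure_block\<close> asks for. In the constant, 2^\<theta> pays for passing from
  2^-(k+1) to 2^-k, and the denominator is the share of mass in a full block.\<close>

lemma sum_annulus_le:
  assumes fin: "\<theta> \<noteq> \<infinity>" and g: "LMnorm p \<theta> \<omega> v g \<le> 1"
  shows "(\<integral>\<^sup>+ k. epow (pow2 (- k) * Lp_norm p v (annulus k) g) (enn2real \<theta>) \<partial>count_space UNIV)
    \<le> ennreal (2 powr enn2real \<theta> / (1 - 2 powr - enn2real \<theta>))" (is "_ \<le> ennreal ?K")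
proof -
  let ?\<theta> = "enn2real \<theta>"
  note \<theta> = theta_real_pos[OF fin]
  define G where "G k = Lp_norm p v (annulus k) g" for k
  let ?w = "\<lambda>r. epow (ennreal (\<omega> r)) ?\<theta>"
  have summand: "epow (pow2 (- k) * G k) ?\<theta>
    \<le> ennreal ?K * (\<integral>\<^sup>+ r. ?w r * epow (G k) ?\<theta> * indicator (block (k + 1)) r \<partial>lebesgue)" for k
  proof (cases "annulus k = {}")
    case True
    then have "G k = 0" by (simp add: G_def Lp_norm_def)
    then show ?thesis by simp
  next
    case False
    then obtain x where "x \<in> annulus k" by blast
    then have t: "0 < norm x" "level (norm x) < k + 1" by (auto simp: annulus_def block_def)
    have block: "block (k + 1) \<in> sets lebesgue" by simp
    have "pow2 (- k) = pow2 1 * pow2 (- (k + 1))" by (simp flip: pow2_add)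
    then have "epow (pow2 (- k)) ?\<theta> = ennreal (2 powr ?\<theta>) * epow (pow2 (- (k + 1))) ?\<theta>"
      using \<theta> by (simp add: epow_mult epow_pow2)
    also have "\<dots> \<le> ennreal (2 powr ?\<theta>) * (ennreal (1 / (1 - 2 powr - ?\<theta>)) * emeasure omega_measure (block (k + 1)))"
      using le_omega_measure_block[OF fin t] by (intro mult_left_mono) auto
    also have "\<dots> = ennreal ?K * emeasure omega_measure (block (k + 1))"
      using \<theta> by (simp add: ennreal_mult'[symmetric] powr_less_one less_imp_le flip: mult.assoc)
    finally have "epow (pow2 (- k) * G k) ?\<theta> \<le> ennreal ?K * (emeasure omega_measure (block (k + 1)) * epow (G k) ?\<theta>)"
      using \<theta> by (simp add: epow_mult mult_right_mono flip: mult.assoc)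
    also have "emeasure omega_measure (block (k + 1)) * epow (G k) ?\<theta>
      = (\<integral>\<^sup>+ r. ?w r * indicator (block (k + 1)) r * epow (G k) ?\<theta> \<partial>lebesgue)"
      using block by (subst nn_integral_multc) (auto simp: emeasure_omega_measure block_def Int_def intro!: arg_cong2[where f = "(*)"] nn_integral_cong split: split_indicator)
    finally show ?thesis by (simp add: ac_simps)
  qed
  have "(\<integral>\<^sup>+ k. epow (pow2 (- k) * G k) ?\<theta> \<partial>count_space UNIV)
    \<le> (\<integral>\<^sup>+ k. ennreal ?K * (\<integral>\<^sup>+ r. ?w r * epow (G k) ?\<theta> * indicator (block (k + 1)) r \<partial>lebesgue) \<partial>count_space UNIV)"
    by (intro nn_integral_mono summand)
  also have "\<dots> = ennreal ?K * (\<integral>\<^sup>+ k. \<integral>\<^sup>+ r. ?w r * epow (G k) ?\<theta> * indicator (block (k + 1)) r \<partial>lebesgue \<partial>count_space UNIV)"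
    by (rule nn_integral_cmult) simp
  also have "\<dots> = ennreal ?K * (\<integral>\<^sup>+ r. \<integral>\<^sup>+ k. ?w r * epow (G k) ?\<theta> * indicator (block (k + 1)) r \<partial>count_space UNIV \<partial>lebesgue)"
  proof (rule arg_cong[OF nn_integral_count_space_nn_integral[symmetric]])
    fix k :: int
    have "(indicator (block (k + 1)) :: real \<Rightarrow> ennreal) \<in> borel_measurable lebesgue"
      by (rule borel_measurable_indicator) simp
    moreover have "(\<lambda>r. ?w r * epow (G k) ?\<theta>) \<in> borel_measurable lebesgue"
      by measurable
    ultimately show "(\<lambda>r. ?w r * epow (G k) ?\<theta> * indicator (block (k + 1)) r) \<in> borel_measurable lebesgue"
      by (rule borel_measurable_times_ennreal[rotated])
  qed simp
  \<comment> \<open>Each r lies in one block only, so the inner series reduces to one annulus, and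
    that annulus lies in the ball of radius r.\<close>
  also have "\<dots> \<le> ennreal ?K * (\<integral>\<^sup>+ r\<in>{0<..}. epow (ennreal (\<omega> r) * Lp_norm p v (ball 0 r) g) ?\<theta> \<partial>lebesgue)"
  proof (intro mult_left_mono nn_integral_mono)
    fix r
    have "(\<integral>\<^sup>+ k. ?w r * epow (G k) ?\<theta> * indicator (block (k + 1)) r \<partial>count_space UNIV)
      = ?w r * epow (G (level r - 1)) ?\<theta> * indicator (block (level r - 1 + 1)) r"
      by (rule nn_integral_count_space_indicator_disjoint[where B = "\<lambda>k. block (k + 1)" and \<kappa> = "\<lambda>r. level r - 1"])
        (auto simp: block_def)
    also have "\<dots> \<le> epow (ennreal (\<omega> r) * Lp_norm p v (ball 0 r) g) ?\<theta> * indicator {0<..} r"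
    proof (cases "0 < r")
      case True
      then have "annulus (level r - 1) \<subseteq> ball 0 r" by (intro annulus_subset_ball) (simp add: level_above_def)
      then have "G (level r - 1) \<le> Lp_norm p v (ball 0 r) g" unfolding G_def using p by (intro Lp_norm_mono) auto
      then show ?thesis using \<theta> True by (auto simp: epow_mult block_def intro!: mult_left_mono)
    qed (simp add: block_def)
    finally show "(\<integral>\<^sup>+ k. ?w r * epow (G k) ?\<theta> * indicator (block (k + 1)) r \<partial>count_space UNIV)
      \<le> epow (ennreal (\<omega> r) * Lp_norm p v (ball 0 r) g) ?\<theta> * indicator {0<..} r" .
  qed auto
  also have "\<dots> \<le> ennreal ?K * 1"
    using g fin by (intro mult_left_mono) (auto simp: LMnorm_eq lnorm_le_iff[OF theta_pos])
  finally show ?thesis by (simp add: G_def)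
qed

text \<open>Let \<phi>(s) be the norm of g on the ball of radius s. By monotonicity \<omega>(r)
  \<phi>(s) \<le> 1 for almost every r > s, hence \<open>W s\<close> is at most 1 / \<phi>(s), while
  the level of s bounds it below by 2^-k. This replaces the counting of mass when \<theta> is
  infinite.\<close>

lemma Lp_norm_ball_le:
  assumes inf: "\<theta> = \<infinity>" and g: "LMnorm p \<theta> \<omega> v g \<le> 1" and s: "0 < s" "level s < k"
  shows "Lp_norm p v (ball 0 s) g \<le> pow2 k"
proof -
  let ?\<phi> = "\<lambda>s. Lp_norm p v (ball 0 s) g"
  have "AE r in lebesgue. r \<in> {0<..} \<longrightarrow> ennreal (\<omega> r) * ?\<phi> r \<le> 1"
    using g unfolding LMnorm_eq lnorm_le_iff[OF theta_pos] by (simp add: inf)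
  then have "AE r in lebesgue. s < r \<longrightarrow> 0 < r \<longrightarrow> ennreal (\<omega> r) \<le> inverse (?\<phi> s)"
  proof eventually_elim
    case (elim r)
    show ?case
    proof (intro impI)
      assume "s < r" "0 < r"
      then have "?\<phi> s \<le> ?\<phi> r" using p by (intro Lp_norm_mono) auto
      then have le: "ennreal (\<omega> r) * ?\<phi> s \<le> 1"
        using elim \<open>0 < r\<close> by (meson greaterThan_iff mult_left_mono order_trans zero_le)
      show "ennreal (\<omega> r) \<le> inverse (?\<phi> s)"
      proof (cases "?\<phi> s = 0 \<or> ?\<phi> s = top")
        case True
        then show ?thesis using le by (auto simp: ennreal_mult_eq_top_iff ennreal_mult_top top_unique split: if_splits)
      next
        case False
        then have "ennreal (\<omega> r) = ennreal (\<omega> r) * ?\<phi> s / ?\<phi> s"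
          by (simp add: ennreal_mult_divide_eq)
        also have "\<dots> \<le> 1 / ?\<phi> s" using le by (rule divide_right_mono_ennreal)
        finally show ?thesis by (simp add: divide_ennreal_def)
      qed
    qed
  qed
  then have "W s \<le> inverse (?\<phi> s)" by (simp add: W_le_iff_AE[OF inf])
  moreover have "pow2 (- k) < W s" using s by (simp add: level_less_iff)
  ultimately have "pow2 (- k) \<le> inverse (?\<phi> s)" by simp
  then have "?\<phi> s * pow2 (- k) \<le> ?\<phi> s * inverse (?\<phi> s)" by (rule mult_left_mono) simp
  also have "\<dots> \<le> 1"
    by (cases "?\<phi> s = 0"; cases "?\<phi> s = top") (auto simp: less_top simp flip: divide_ennreal_def)
  finally have "?\<phi> s * pow2 (- k) * pow2 k \<le> 1 * pow2 k" by (rule mult_right_mono) simp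
  then show ?thesis by (simp add: mult.assoc)
qed

text \<open>\<open>W\<close> may jump at the outer end of the annulus, so the bound is taken at
  radii of level at most k and passed to the limit.\<close>

lemma Lp_norm_annulus_le:
  assumes inf: "\<theta> = \<infinity>" and [measurable]: "g \<in> borel_measurable lebesgue" and g: "LMnorm p \<theta> \<omega> v g \<le> 1"
  shows "Lp_norm p v (annulus k) g \<le> pow2 (k + 1)"
proof (cases "annulus k = {}")
  case True
  then show ?thesis by (simp add: Lp_norm_def)
next
  case False
  then obtain x0 where "x0 \<in> annulus k" by blast
  then have x0: "0 < norm x0" "level (norm x0) = k" by (auto simp: annulus_def block_def)
  \<comment> \<open>These radii increase to infinity if level k + 1 is never reached, and otherwise
    to \<open>rad (k + 1)\<close> from strictly inside.\<close>
  obtain b :: "nat \<Rightarrow> real" where b: "incseq b" "\<And>n. 0 < b n" "\<And>n. level (b n) < k + 1"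
      "annulus k \<subseteq> (\<Union>n. ball 0 (b n))"
  proof (cases "level_above (k + 1) = {}")
    case True
    have "\<exists>n. norm x < 1 + real n" for x :: 'a
      using reals_Archimedean2[of "norm x"] by (metis add.commute less_add_one order.strict_trans)
    then show thesis
      using True by (intro that[of "\<lambda>n. real (Suc n)"]) (auto simp: incseq_def level_above_def not_le)
  next
    case False
    define a where "a = rad (k + 1)"
    have "norm x0 \<le> t" if "t \<in> level_above (k + 1)" for t
      using level_mono[of t "norm x0"] x0 that by (force simp: level_above_def)
    then have "norm x0 \<le> a" unfolding a_def rad_def using False by (intro cInf_greatest)
    with x0(1) have a: "0 < a" by (rule less_le_trans)
    define s where "s n = a - a / real (n + 2)" for n
    have s: "0 < s n" "s n < a" for n
      using a by (auto simp: s_def field_simps intro: add_pos_nonneg)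
    have "s n \<notin> level_above (k + 1)" for n using rad_le[of "s n" "k + 1"] s[of n] by (auto simp: a_def)
    then have "level (s n) < k + 1" for n using s[of n] by (auto simp: level_above_def not_le)
    moreover have "incseq s" using a by (auto simp: incseq_def s_def intro!: divide_left_mono)
    moreover have "annulus k \<subseteq> (\<Union>n. ball 0 (s n))"
    proof
      fix x assume "x \<in> annulus k"
      then have "x \<in> ball 0 a"
        unfolding a_def using annulus_subset_ball[OF rad_in_level_above[OF False]] a by (auto simp: a_def)
      moreover have "s \<longlonglongrightarrow> a - 0" unfolding s_def
        using lim_const_over_n[THEN LIMSEQ_ignore_initial_segment, of a 2]
        by (rule tendsto_diff[OF tendsto_const])
      ultimately have "eventually (\<lambda>n. norm x < s n) sequentially"
        by (intro order_tendstoD) auto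
      then obtain n where "norm x < s n" by (auto simp: eventually_sequentially)
      then show "x \<in> (\<Union>n. ball 0 (s n))" by auto
    qed
    ultimately show thesis using that s by blast
  qed
  have "Lp_norm p v (annulus k) g \<le> Lp_norm p v (\<Union>n. ball 0 (b n)) g" using b p by (intro Lp_norm_mono) auto
  also have "\<dots> \<le> pow2 (k + 1)"
    using b(1) Lp_norm_ball_le[OF inf g b(2,3)] p_pos
    by (intro Lp_norm_UN_le) (auto simp: incseq_def subset_ball)
  finally show ?thesis .
qed

text \<open>The annuli cover everything but the origin, which is a null set.\<close>

lemma integral_le_sum_annulus:
  assumes [measurable]: "f \<in> borel_measurable lebesgue" "g \<in> borel_measurable lebesgue"
  shows "(\<integral>\<^sup>+ x. ennreal \<bar>f x * g x\<bar> \<partial>lebesgue)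
    \<le> 2 * (\<integral>\<^sup>+ k. Nf p v (annulus k) f * Lp_norm p v (annulus k) g \<partial>count_space UNIV)"
proof -
  have "(\<integral>\<^sup>+ x. ennreal \<bar>f x * g x\<bar> \<partial>lebesgue)
    \<le> (\<integral>\<^sup>+ x. \<integral>\<^sup>+ k. ennreal \<bar>f x * g x\<bar> * indicator (annulus k) x \<partial>count_space UNIV \<partial>lebesgue)"
    using AE_lebesgue_neq[of "0::'a"]
  proof (intro nn_integral_mono_AE, eventually_elim)
    case (elim x)
    have "(\<integral>\<^sup>+ k. ennreal \<bar>f x * g x\<bar> * indicator (annulus k) x \<partial>count_space UNIV)
      = ennreal \<bar>f x * g x\<bar> * indicator (annulus (level (norm x))) x"
      by (rule nn_integral_count_space_indicator_disjoint[where \<kappa> = "\<lambda>x. level (norm x)" and B = annulus])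
        (auto simp: annulus_def block_def)
    then show ?case using elim by (simp add: annulus_def block_def)
  qed
  also have "\<dots> = (\<integral>\<^sup>+ k. (\<integral>\<^sup>+ x\<in>annulus k. ennreal \<bar>f x * g x\<bar> \<partial>lebesgue) \<partial>count_space UNIV)"
    by (rule nn_integral_count_space_nn_integral) auto
  also have "\<dots> \<le> (\<integral>\<^sup>+ k. 2 * (Nf p v (annulus k) f * Lp_norm p v (annulus k) g) \<partial>count_space UNIV)"
    using p v by (intro nn_integral_mono weighted_Holder) auto
  finally show ?thesis by (simp add: nn_integral_cmult)
qed

text \<open>The bound is given for t > 0 only, but \<open>rad k\<close> may be 0. So balls of radius
  1 / (n + 1) are removed from the annulus first, and then n tends to infinity.\<close>

lemma Nf_annulus_le:
  assumes [measurable]: "f \<in> borel_measurable lebesgue"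
    and S: "\<And>t. 0 < t \<Longrightarrow> Nf p v (- ball 0 t) f / W t \<le> S"
  shows "Nf p v (annulus k) f \<le> S * pow2 (- k)"
proof (cases "level_above k = {}")
  case True
  then have "annulus k = {}" by (auto simp: annulus_def block_eq)
  then show ?thesis using p by simp
next
  case False
  define A where "A n = annulus k \<inter> - ball 0 (1 / real (Suc n))" for n
  have "Nf p v (A n) f \<le> S * pow2 (- k)" for n
  proof -
    define t where "t = max (1 / real (Suc n)) (rad k)"
    have t: "0 < t" by (auto simp: t_def less_max_iff_disj)
    have "Nf p v (A n) f \<le> Nf p v (- ball 0 t) f"
      using p by (intro Nf_mono) (auto simp: A_def t_def annulus_def block_eq not_less less_max_iff_disj dest!: rad_le)
    also have "\<dots> = Nf p v (- ball 0 t) f / W t * W t"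
      using W_finite[OF t] by (simp add: ennreal_divide_times ennreal_divide_self)
    also have "\<dots> \<le> S * W t" using S[OF t] by (rule mult_right_mono) simp
    also have "W t \<le> W (rad k)" by (rule W_antimono) (simp add: t_def)
    also have "W (rad k) \<le> pow2 (- k)" by (rule W_rad_le[OF False])
    finally show ?thesis by (simp add: mult_left_mono)
  qed
  moreover have inc: "incseq A"
  proof (rule incseq_SucI)
    fix n
    have "ball (0::'a) (1 / real (Suc (Suc n))) \<subseteq> ball 0 (1 / real (Suc n))"
      by (intro subset_ball divide_left_mono) auto
    then show "A n \<subseteq> A (Suc n)" by (auto simp: A_def)
  qed
  moreover have "A n \<in> sets lebesgue" for n by (simp add: A_def sets.Int)
  ultimately have "Nf p v (\<Union>n. A n) f \<le> S * pow2 (- k)"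
    using p by (intro Nf_UN_le) auto
  moreover have "annulus k \<subseteq> (\<Union>n. A n)"
  proof
    fix x assume x: "x \<in> annulus k"
    then have "0 < norm x" by (auto simp: annulus_def block_def)
    then obtain n where "inverse (real (Suc n)) < norm x" using reals_Archimedean by blast
    then show "x \<in> (\<Union>n. A n)" using x by (auto simp: A_def inverse_eq_divide not_less intro!: exI[of _ n])
  qed
  ultimately show ?thesis using Nf_mono[OF p] order_trans by blast
qed

lemma integral_le_Sup:
  assumes \<theta>1: "\<theta> \<le> 1"
  shows "\<exists>C>0. \<forall>f g S. f \<in> borel_measurable lebesgue \<longrightarrow> g \<in> borel_measurable lebesgue \<longrightarrow>
    LMnorm p \<theta> \<omega> v g \<le> 1 \<longrightarrow> (\<forall>t>0. Nf p v (- ball 0 t) f / W t \<le> S) \<longrightarrow>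
    (\<integral>\<^sup>+ x. ennreal \<bar>f x * g x\<bar> \<partial>lebesgue) \<le> ennreal C * S"
proof -
  have fin: "\<theta> \<noteq> \<infinity>" using \<theta>1 by (auto simp: top_unique)
  let ?\<theta> = "enn2real \<theta>"
  define \<theta>' where "\<theta>' = ?\<theta>"
  have \<theta>: "0 < \<theta>'" "\<theta>' \<le> 1" using theta_real_pos[OF fin] \<theta>1 fin
    by (auto simp: \<theta>'_def enn2real_leI)
  define K where "K = 2 powr \<theta>' / (1 - 2 powr - \<theta>')"
  have K: "0 < K" using \<theta> by (simp add: K_def powr_less_one)
  define D where "D = K powr (1 / \<theta>')"
  have D: "0 < D" using K by (simp add: D_def)
  \<comment> \<open>The embedding of l^\<theta> in l^1, term by term: each term is at most D =
    K^(1/\<theta>), so x = x^(1 - \<theta>) x^\<theta> is at most D^(1 - \<theta>)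
    x^\<theta>.\<close>
  have x_le: "x \<le> ennreal (D powr (1 - \<theta>')) * epow x \<theta>'" if "epow x \<theta>' \<le> ennreal K" for x
  proof -
    have "x \<le> ennreal D"
      using that \<theta> K by (simp add: epow_le_iff epow_ennreal D_def)
    then obtain y where y: "x = ennreal y" "0 \<le> y" "y \<le> D"
      using D by (cases x) (auto simp: top_unique)
    have "y \<le> D powr (1 - \<theta>') * y powr \<theta>'"
    proof (cases "y = 0")
      case False
      then have "y = y powr (1 - \<theta>') * y powr \<theta>'" using y by (simp flip: powr_add)
      also have "\<dots> \<le> D powr (1 - \<theta>') * y powr \<theta>'"
        using y \<theta> by (intro mult_right_mono powr_mono2) auto
      finally show ?thesis .
    qed simp
    then show ?thesis using y by (simp add: epow_ennreal ennreal_leI flip: ennreal_mult)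
  qed
  show ?thesis
  proof (intro exI[of _ "2 * (D powr (1 - \<theta>') * K)"] conjI allI impI)
    show "0 < 2 * (D powr (1 - \<theta>') * K)" using K D by simp
    fix f g :: "'a \<Rightarrow> real" and S
    assume f [measurable]: "f \<in> borel_measurable lebesgue" and [measurable]: "g \<in> borel_measurable lebesgue"
      and g: "LMnorm p \<theta> \<omega> v g \<le> 1" and S: "\<forall>t>0. Nf p v (- ball 0 t) f / W t \<le> S"
    define x where "x k = pow2 (- k) * Lp_norm p v (annulus k) g" for k
    have sum: "(\<integral>\<^sup>+ k. epow (x k) \<theta>' \<partial>count_space UNIV) \<le> ennreal K"
      using sum_annulus_le[OF fin g] by (simp add: x_def K_def \<theta>'_def)
    have xK: "epow (x k) \<theta>' \<le> ennreal K" for k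
      using nn_integral_ge_point[of k UNIV "\<lambda>k. epow (x k) \<theta>'"] sum by (auto intro: order_trans)
    have "(\<integral>\<^sup>+ x. ennreal \<bar>f x * g x\<bar> \<partial>lebesgue)
      \<le> 2 * (\<integral>\<^sup>+ k. Nf p v (annulus k) f * Lp_norm p v (annulus k) g \<partial>count_space UNIV)"
      by (rule integral_le_sum_annulus) measurable
    also have "\<dots> \<le> 2 * (\<integral>\<^sup>+ k. S * (ennreal (D powr (1 - \<theta>')) * epow (x k) \<theta>') \<partial>count_space UNIV)"
    proof (intro mult_left_mono nn_integral_mono)
      fix k
      have "Nf p v (annulus k) f * Lp_norm p v (annulus k) g \<le> S * pow2 (- k) * Lp_norm p v (annulus k) g"
        using S by (intro mult_right_mono Nf_annulus_le f) auto
      also have "\<dots> = S * x k" by (simp add: x_def mult.assoc)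
      also have "\<dots> \<le> S * (ennreal (D powr (1 - \<theta>')) * epow (x k) \<theta>')"
        using x_le[OF xK] by (rule mult_left_mono) simp
      finally show "Nf p v (annulus k) f * Lp_norm p v (annulus k) g \<le> S * (ennreal (D powr (1 - \<theta>')) * epow (x k) \<theta>')" .
    qed simp
    also have "\<dots> = 2 * (S * (ennreal (D powr (1 - \<theta>')) * (\<integral>\<^sup>+ k. epow (x k) \<theta>' \<partial>count_space UNIV)))"
      by (simp add: nn_integral_cmult)
    also have "\<dots> \<le> 2 * (S * (ennreal (D powr (1 - \<theta>')) * ennreal K))"
      using sum by (intro mult_left_mono) auto
    also have "\<dots> = ennreal (2 * (D powr (1 - \<theta>') * K)) * S"
      using K by (simp add: ennreal_mult ac_simps)
    finally show "(\<integral>\<^sup>+ x. ennreal \<bar>f x * g x\<bar> \<partial>lebesgue) \<le> ennreal (2 * (D powr (1 - \<theta>') * K)) * S" .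
  qed
qed

lemma theta_conj_facts:
  assumes "1 < \<theta>"
  shows "1 \<le> theta_conj \<theta>"
    and "\<theta> \<noteq> \<infinity> \<Longrightarrow> 1 < enn2real \<theta> \<and> 1 < theta_conj \<theta> \<and> 1 / theta_conj \<theta> + 1 / enn2real \<theta> = 1"
    and "\<theta> = \<infinity> \<Longrightarrow> theta_conj \<theta> = 1"
proof -
  show *: "1 < enn2real \<theta> \<and> 1 < theta_conj \<theta> \<and> 1 / theta_conj \<theta> + 1 / enn2real \<theta> = 1" if "\<theta> \<noteq> \<infinity>"
  proof -
    have "ennreal 1 < ennreal (enn2real \<theta>)" using assms that by (simp add: less_top)
    then have "1 < enn2real \<theta>" by (subst (asm) ennreal_less_iff) auto
    then show ?thesis using that by (simp add: theta_conj_def field_simps)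
  qed
  show "theta_conj \<theta> = 1" if "\<theta> = \<infinity>" using that by (simp add: theta_conj_def)
  with * show "1 \<le> theta_conj \<theta>" by fastforce
qed

text \<open>The factors 2^k and 2^-k are shared out between f and g. For infinite \<theta> the
  conjugate exponent is 1 and a bound on each annulus suffices. For finite \<theta> one factor 2 of
  the constant comes from the annuli, the other from Hoelder's inequality for series.\<close>

lemma integral_le_sum_pow:
  assumes \<theta>1: "1 < \<theta>"
  shows "\<exists>C>0. \<forall>f g. f \<in> borel_measurable lebesgue \<longrightarrow> g \<in> borel_measurable lebesgue \<longrightarrow>
    LMnorm p \<theta> \<omega> v g \<le> 1 \<longrightarrow>
    (\<integral>\<^sup>+ x. ennreal \<bar>f x * g x\<bar> \<partial>lebesgue) \<le> ennreal C *
      epow (\<integral>\<^sup>+ k. epow (pow2 k * Nf p v (annulus k) f) (theta_conj \<theta>) \<partial>count_space UNIV) (1 / theta_conj \<theta>)"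
proof (cases "\<theta> = \<infinity>")
  case True
  show ?thesis
  proof (intro exI[of _ 4] conjI allI impI)
    fix f g :: "'a \<Rightarrow> real"
    assume [measurable]: "f \<in> borel_measurable lebesgue" "g \<in> borel_measurable lebesgue"
      and g: "LMnorm p \<theta> \<omega> v g \<le> 1"
    have "(\<integral>\<^sup>+ x. ennreal \<bar>f x * g x\<bar> \<partial>lebesgue)
      \<le> 2 * (\<integral>\<^sup>+ k. Nf p v (annulus k) f * Lp_norm p v (annulus k) g \<partial>count_space UNIV)"
      by (rule integral_le_sum_annulus) measurable
    also have "\<dots> \<le> 2 * (\<integral>\<^sup>+ k. Nf p v (annulus k) f * pow2 (k + 1) \<partial>count_space UNIV)"
      using g by (intro mult_left_mono nn_integral_mono Lp_norm_annulus_le[OF True]) auto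
    also have "\<dots> = 2 * (\<integral>\<^sup>+ k. pow2 1 * (pow2 k * Nf p v (annulus k) f) \<partial>count_space UNIV)"
      by (simp add: pow2_add ac_simps)
    also have "\<dots> = 2 * (pow2 1 * (\<integral>\<^sup>+ k. pow2 k * Nf p v (annulus k) f \<partial>count_space UNIV))"
      by (simp add: nn_integral_cmult)
    also have "\<dots> = ennreal 4 * (\<integral>\<^sup>+ k. pow2 k * Nf p v (annulus k) f \<partial>count_space UNIV)"
      by (simp add: pow2_def flip: mult.assoc)
    finally show "(\<integral>\<^sup>+ x. ennreal \<bar>f x * g x\<bar> \<partial>lebesgue) \<le> ennreal 4 *
      epow (\<integral>\<^sup>+ k. epow (pow2 k * Nf p v (annulus k) f) (theta_conj \<theta>) \<partial>count_space UNIV) (1 / theta_conj \<theta>)"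
      by (simp add: theta_conj_facts(3)[OF \<theta>1 True])
  qed simp
next
  case fin: False
  define \<theta>' where "\<theta>' = enn2real \<theta>"
  define q where "q = theta_conj \<theta>"
  have q: "1 < \<theta>'" "1 < q" "1 / q + 1 / \<theta>' = 1"
    using theta_conj_facts(2)[OF \<theta>1 fin] by (auto simp: q_def \<theta>'_def)
  define K where "K = 2 powr \<theta>' / (1 - 2 powr - \<theta>')"
  have K: "0 < K" using q by (simp add: K_def powr_less_one)
  define D where "D = K powr (1 / \<theta>')"
  have D: "0 < D" using K by (simp add: D_def)
  show ?thesis
  proof (intro exI[of _ "4 * D"] conjI allI impI)
    show "0 < 4 * D" using D by simp
    fix f g :: "'a \<Rightarrow> real"
    assume [measurable]: "f \<in> borel_measurable lebesgue" "g \<in> borel_measurable lebesgue"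
      and g: "LMnorm p \<theta> \<omega> v g \<le> 1"
    define x where "x k = pow2 (- k) * Lp_norm p v (annulus k) g" for k
    define y where "y k = pow2 k * Nf p v (annulus k) f" for k
    have "(\<integral>\<^sup>+ k. epow (x k) \<theta>' \<partial>count_space UNIV) \<le> ennreal K"
      using sum_annulus_le[OF fin g] by (simp add: x_def K_def \<theta>'_def)
    then have sum: "epow (\<integral>\<^sup>+ k. epow (x k) \<theta>' \<partial>count_space UNIV) (1 / \<theta>') \<le> ennreal D"
      using q K by (simp add: epow_inverse_le_iff D_def epow_ennreal powr_powr)
    have "(\<integral>\<^sup>+ x. ennreal \<bar>f x * g x\<bar> \<partial>lebesgue)
      \<le> 2 * (\<integral>\<^sup>+ k. Nf p v (annulus k) f * Lp_norm p v (annulus k) g \<partial>count_space UNIV)"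
      by (rule integral_le_sum_annulus) measurable
    also have "(\<integral>\<^sup>+ k. Nf p v (annulus k) f * Lp_norm p v (annulus k) g \<partial>count_space UNIV)
      = (\<integral>\<^sup>+ k. y k * x k \<partial>count_space UNIV)"
    proof (rule nn_integral_cong)
      fix k
      have "y k * x k = (pow2 k * pow2 (- k)) * (Nf p v (annulus k) f * Lp_norm p v (annulus k) g)"
        unfolding x_def y_def by (simp only: ac_simps)
      then show "Nf p v (annulus k) f * Lp_norm p v (annulus k) g = y k * x k" by simp
    qed
    also have "\<dots> \<le> 2 * (epow (\<integral>\<^sup>+ k. epow (y k) q \<partial>count_space UNIV) (1 / q)
        * epow (\<integral>\<^sup>+ k. epow (x k) \<theta>' \<partial>count_space UNIV) (1 / \<theta>'))"
      using q by (intro Holder_nn_integral) auto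
    also have "\<dots> \<le> 2 * (epow (\<integral>\<^sup>+ k. epow (y k) q \<partial>count_space UNIV) (1 / q) * ennreal D)"
      using sum by (intro mult_left_mono) auto
    also have "2 * \<dots> = ennreal (4 * D) * epow (\<integral>\<^sup>+ k. epow (y k) q \<partial>count_space UNIV) (1 / q)"
      using D by (simp add: ennreal_mult ac_simps)
    finally show "(\<integral>\<^sup>+ x. ennreal \<bar>f x * g x\<bar> \<partial>lebesgue) \<le> ennreal (4 * D) *
      epow (\<integral>\<^sup>+ k. epow (pow2 k * Nf p v (annulus k) f) (theta_conj \<theta>) \<partial>count_space UNIV) (1 / theta_conj \<theta>)"
      by (simp add: y_def q_def mult_left_mono)
  qed
qed

end

section \<open>The Stieltjes integral as a dyadic sum\<close>

lemma ennreal_inverse_inverse: "inverse (inverse x) = (x :: ennreal)"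
  using one_divide_one_divide_ennreal[of x] by (simp add: divide_ennreal_def)

lemma ennreal_inverse_antimono: "x \<le> y \<Longrightarrow> inverse y \<le> inverse (x :: ennreal)"
proof (cases x; cases y)
  fix a b assume "x \<le> y" "0 \<le> a" "x = ennreal a" "0 \<le> b" "y = ennreal b"
  then show ?thesis
    by (cases "a = 0") (auto simp: inverse_ennreal intro!: ennreal_leI le_imp_inverse_le)
qed (auto simp: top_unique)

lemma ennreal_inverse_le_iff: "inverse x \<le> y \<longleftrightarrow> inverse y \<le> (x :: ennreal)"
  by (metis ennreal_inverse_antimono ennreal_inverse_inverse)

lemma epow_inverse: "0 < r \<Longrightarrow> epow (inverse x) r = inverse (epow x r)"
proof (cases x)
  case (real a)
  assume "0 < r"
  then show ?thesis using real
    by (cases "a = 0") (auto simp: inverse_ennreal epow_ennreal inverse_powr less_le)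
qed simp

context weight_profile
begin

abbreviation q :: real where "q \<equiv> theta_conj \<theta>"

text \<open>The function whose left limits form \<open>Fw\<close>; it is 0 where \<open>W\<close> is
  infinite.\<close>

definition Wq :: "real \<Rightarrow> ennreal" where "Wq s = inverse (epow (W s) q)"

lemma Wq_mono: "0 < q \<Longrightarrow> s \<le> t \<Longrightarrow> Wq s \<le> Wq t"
  unfolding Wq_def by (intro ennreal_inverse_antimono epow_mono W_antimono) auto

lemma Wq_less_top: "Wq s < top"
  by (simp add: Wq_def less_top[symmetric])

lemma Wq_le_iff: "0 < q \<Longrightarrow> y \<le> Wq s \<longleftrightarrow> W s \<le> epow (inverse y) (1 / q)"
  unfolding Wq_def
  by (metis ennreal_inverse_antimono ennreal_inverse_inverse le_epow_inverse_iff)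

text \<open>Levels of \<open>W\<close> are levels of W^-q at the powers of 2^q; this is why the
  intervals in the variable y have ratio 2^q.\<close>

lemma pow2_le_Wq_iff: "0 < q \<Longrightarrow> 0 < s \<Longrightarrow> ennreal (2 powr (of_int k * q)) \<le> Wq s \<longleftrightarrow> s \<in> level_above k"
  by (simp add: Wq_le_iff level_above_def le_level_iff flip: epow_pow2 epow_inverse) (simp add: epow_inverse inverse_pow2)

lemma wnorm_left_eq: "wnorm_left \<theta> \<omega> t = (INF s\<in>{..<t}. W s)"
proof -
  have "(W \<longlongrightarrow> (INF s\<in>{..<t}. W s)) (at_left t)"
  proof (rule order_tendstoI)
    fix a assume "a < (INF s\<in>{..<t}. W s)"
    then have "a < W s" if "s < t" for s
      using that by (meson INF_lower lessThan_iff less_le_trans)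
    then show "eventually (\<lambda>s. a < W s) (at_left t)"
      by (auto simp: eventually_at_left[of "t - 1" t] intro!: exI[of _ "t - 1"])
  next
    fix a assume "(INF s\<in>{..<t}. W s) < a"
    then obtain s0 where s0: "s0 < t" "W s0 < a" by (auto simp: INF_less_iff)
    then have "W s < a" if "s0 < s" for s
      using W_antimono[of s0 s] that by (auto intro: le_less_trans)
    then show "eventually (\<lambda>s. W s < a) (at_left t)"
      using s0(1) by (auto simp: eventually_at_left[of "t - 1" t] intro!: exI[of _ s0])
  qed
  then show ?thesis unfolding wnorm_left_def by (intro tendsto_Lim) auto
qed

abbreviation F :: "real \<Rightarrow> real" where "F \<equiv> Fw \<theta> \<omega>"

text \<open>Powers preserve order and inversion reverses it, so the infimum that is the left limit
  of \<open>W\<close> turns into a supremum. It is at most \<open>Wq t\<close> and hence finite, so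
  nothing is lost by taking real values in \<open>Fw\<close>.\<close>

lemma ennreal_F:
  assumes q: "0 < q" shows "ennreal (F t) = (SUP s\<in>{..<t}. Wq s)"
proof -
  have "inverse (epow (INF s\<in>{..<t}. W s) q) = (SUP s\<in>{..<t}. Wq s)"
  proof (rule antisym)
    let ?y = "SUP s\<in>{..<t}. Wq s"
    have "epow (inverse ?y) (1 / q) \<le> W s" if "s < t" for s
    proof -
      have "Wq s \<le> ?y" using that by (intro SUP_upper) auto
      then have "inverse ?y \<le> inverse (Wq s)" by (rule ennreal_inverse_antimono)
      then show ?thesis using q by (simp add: Wq_def ennreal_inverse_inverse epow_inverse_le_iff)
    qed
    then have "epow (inverse ?y) (1 / q) \<le> (INF s\<in>{..<t}. W s)" by (auto intro: INF_greatest)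
    then have "inverse ?y \<le> epow (INF s\<in>{..<t}. W s) q" using q by (simp add: epow_inverse_le_iff)
    then show "inverse (epow (INF s\<in>{..<t}. W s) q) \<le> ?y" by (subst ennreal_inverse_le_iff)
  next
    show "(SUP s\<in>{..<t}. Wq s) \<le> inverse (epow (INF s\<in>{..<t}. W s) q)"
      unfolding Wq_def using q
      by (intro SUP_least ennreal_inverse_antimono epow_mono INF_lower) auto
  qed
  moreover have "(SUP s\<in>{..<t}. Wq s) \<le> Wq t"
    using q by (intro SUP_least Wq_mono) auto
  then have "(SUP s\<in>{..<t}. Wq s) < top" using Wq_less_top by (rule le_less_trans)
  ultimately show ?thesis by (simp add: Fw_def wnorm_left_eq)
qed

lemma F_nonneg: "0 \<le> F t"
  by (simp add: Fw_def)

lemma F_le_Wq: "0 < q \<Longrightarrow> ennreal (F t) \<le> Wq t"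
  by (auto simp: ennreal_F intro!: SUP_least Wq_mono)

lemma Wq_le_F: "0 < q \<Longrightarrow> s < t \<Longrightarrow> Wq s \<le> ennreal (F t)"
  by (auto simp: ennreal_F intro!: SUP_upper)

lemma F_mono: assumes "0 < q" shows "mono F"
proof
  fix s t :: real assume "s \<le> t"
  then have "ennreal (F s) \<le> ennreal (F t)"
    using assms by (simp add: ennreal_F) (intro SUP_subset_mono, auto)
  then show "F s \<le> F t" using F_nonneg by (simp add: ennreal_le_iff)
qed

lemma F_left_continuous: assumes q: "0 < q" shows "continuous (at_left t) F"
  unfolding continuous_within
proof (rule order_tendstoI)
  fix a assume a: "a < F t"
  have "\<exists>s<t. a < F s"
  proof (cases "a < 0")
    case True
    then show ?thesis using F_nonneg by (intro exI[of _ "t - 1"]) (auto intro: less_le_trans)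
  next
    case False
    then have "ennreal a < (SUP s\<in>{..<t}. Wq s)" using a by (simp add: ennreal_lessI flip: ennreal_F[OF q])
    then obtain s where s: "s < t" "ennreal a < Wq s" by (auto simp: less_SUP_iff)
    have "Wq s \<le> ennreal (F ((s + t) / 2))" using s by (intro Wq_le_F q) auto
    with s(2) have "ennreal a < ennreal (F ((s + t) / 2))" by (rule less_le_trans)
    then have "a < F ((s + t) / 2)" using False by (simp add: ennreal_less_iff)
    then show ?thesis using s(1) by (intro exI[of _ "(s + t) / 2"]) auto
  qed
  then obtain s where "s < t" "a < F s" by blast
  then have "\<forall>r>s. a < F r" using monoD[OF F_mono[OF q]] by (meson less_le_trans less_imp_le)
  then show "eventually (\<lambda>s. a < F s) (at_left t)"
    using \<open>s < t\<close> by (auto simp: eventually_at_left[of "t - 1" t] intro!: exI[of _ s])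
next
  fix a assume "F t < a"
  then have "\<forall>r<t. F r < a" using monoD[OF F_mono[OF q]] by (meson le_less_trans less_imp_le)
  then show "eventually (\<lambda>s. F s < a) (at_left t)"
    by (auto simp: eventually_at_left[of "t - 1" t] intro!: exI[of _ "t - 1"])
qed

text \<open>Left of 0 the tail norm is constantly \<open>W 0\<close>. So the values y below
  \<open>F 0\<close> = W(0)^-q form a range that the integral over t > 0 cannot see.\<close>

lemma F_nonpos: assumes q: "0 < q" and t: "t \<le> 0" shows "ennreal (F t) = Wq 0"
proof -
  have "W s = W 0" if "s < t" for s
  proof -
    have "{s<..} \<inter> {0<..} = {0<..} \<inter> {0::real<..}" using that t by auto
    then show ?thesis unfolding wnorm_def by metis
  qed
  then have "(SUP s\<in>{..<t}. Wq s) = (SUP s\<in>{..<t}. Wq 0)"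
    by (intro SUP_cong) (auto simp: Wq_def)
  also have "\<dots> = Wq 0" by (rule cSUP_const) (auto intro: lt_ex)
  finally show ?thesis using ennreal_F[OF q] by simp
qed

text \<open>The Stieltjes measure has no atom at 0: otherwise \<open>F\<close> would stay above some
  y > F 0 on all t > 0, against the right continuity of \<open>W\<close> at 0. Consequently
  \<open>T y\<close> is positive for y above \<open>F 0\<close>, and restricting the integral to t >
  0 loses nothing there.\<close>

lemma F_right_continuous_0:
  assumes q: "0 < q" and y: "F 0 < y" shows "\<exists>t>0. F t \<le> y"
proof (rule ccontr)
  assume *: "\<not> ?thesis"
  have y0: "0 \<le> y" using F_nonneg[of 0] y by simp
  have "W 0 \<le> epow (inverse (ennreal y)) (1 / q)"
  proof (rule W_right_continuous)
    fix s :: real assume s: "0 < s"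
    then have "ennreal y \<le> ennreal (F s)" using * by (intro ennreal_leI) auto
    also have "\<dots> \<le> Wq s" by (rule F_le_Wq[OF q])
    finally show "W s \<le> epow (inverse (ennreal y)) (1 / q)" using q by (simp add: Wq_le_iff)
  qed
  then have "ennreal y \<le> ennreal (F 0)" using q by (simp add: F_nonpos flip: Wq_le_iff)
  then show False using y F_nonneg by (simp add: ennreal_le_iff)
qed

definition T :: "real \<Rightarrow> real" where "T y = Sup {t. F t \<le> y}"

definition J :: "real set" where "J = {y. (\<exists>a. F a \<le> y) \<and> (\<exists>b. y < F b)}"

lemma J_iff: "0 < q \<Longrightarrow> y \<in> J \<longleftrightarrow> F 0 \<le> y \<and> (\<exists>b. y < F b)"
proof -
  assume q: "0 < q"
  have "F 0 \<le> F a" for a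
  proof (cases "0 \<le> a")
    case False
    then have "ennreal (F 0) = ennreal (F a)" using F_nonpos[OF q, of a] F_nonpos[OF q, of 0] by simp
    then show ?thesis using F_nonneg by simp
  qed (rule monoD[OF F_mono[OF q]])
  then show ?thesis by (auto simp: J_def intro: order_trans)
qed

lemma bdd_above_F: "0 < q \<Longrightarrow> y \<in> J \<Longrightarrow> bdd_above {t. F t \<le> y}"
proof -
  assume "0 < q" "y \<in> J"
  then obtain b where b: "y < F b" by (auto simp: J_def)
  have "t \<le> b" if "F t \<le> y" for t
    using monoD[OF F_mono[OF \<open>0 < q\<close>], of b t] b that by linarith
  then show ?thesis by (intro bdd_aboveI[of _ b]) simp
qed

lemma T_less: "0 < q \<Longrightarrow> y \<in> J \<Longrightarrow> T y < t \<Longrightarrow> y < F t"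
  using cSup_upper[of t "{t. F t \<le> y}"] bdd_above_F[of y] by (force simp: T_def)

lemma T_pos: assumes "0 < q" "y \<in> J" "F 0 < y" shows "0 < T y"
proof -
  obtain t where "0 < t" "F t \<le> y" using F_right_continuous_0 assms by blast
  then show ?thesis using cSup_upper[of t "{t. F t \<le> y}"] bdd_above_F assms by (force simp: T_def)
qed

lemma less_F_level_above: "0 < q \<Longrightarrow> 0 < t \<Longrightarrow> 2 powr (of_int k * q) < F t \<Longrightarrow> t \<in> level_above k"
  using order_trans[OF ennreal_leI F_le_Wq] by (simp flip: pow2_le_Wq_iff)

text \<open>Beyond \<open>T y\<close> the function \<open>F\<close> exceeds y, hence 2^(k q), which
  means level k. Together with \<open>T_le\<close> this places the image of the k-th dyadic interval
  between \<open>rad k\<close> and \<open>rad (k + 1)\<close>.\<close>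

lemma le_T: assumes "0 < q" "y \<in> J" "0 < T y" "2 powr (of_int k * q) \<le> y" shows "rad k \<le> T y"
proof (rule dense_ge)
  fix t assume "T y < t"
  then show "rad k \<le> t" using assms T_less[of y t] by (intro rad_le less_F_level_above) auto
qed

lemma level_above_le_F:
  assumes "0 < q" "s \<in> level_above k" "s < t" shows "2 powr (of_int k * q) \<le> F t"
proof -
  have "ennreal (2 powr (of_int k * q)) \<le> Wq s"
    using assms by (subst pow2_le_Wq_iff) (auto simp: level_above_def)
  also have "\<dots> \<le> ennreal (F t)" using assms by (intro Wq_le_F)
  finally show ?thesis by (simp add: ennreal_le_iff F_nonneg)
qed

lemma T_le:
  assumes "0 < q" "y \<in> J" "level_above k \<noteq> {}" "y < 2 powr (of_int k * q)" shows "T y \<le> rad k"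
  unfolding T_def
proof (rule cSup_least)
  show "{t. F t \<le> y} \<noteq> {}" using assms(2) by (auto simp: J_def)
  fix t assume t: "t \<in> {t. F t \<le> y}"
  show "t \<le> rad k"
  proof (rule ccontr)
    assume "\<not> t \<le> rad k"
    then have "2 powr (of_int k * q) \<le> F t"
      by (intro level_above_le_F[of "(rad k + t) / 2"] assms(1) rad_less assms(3)) auto
    then show False using t assms(4) by simp
  qed
qed

lemma level_above_less_F:
  assumes "0 < q" "level_above k \<noteq> {}" "y < 2 powr (of_int k * q)" shows "\<exists>b. y < F b"
proof -
  obtain s where "s \<in> level_above k" using assms by blast
  then have "2 powr (of_int k * q) \<le> F (s + 1)" using level_above_le_F assms by auto
  with assms(3) have "y < F (s + 1)" by (rule less_le_trans)
  then show ?thesis by blast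
qed

lemma nn_integral_F:
  assumes q: "0 < q" and N: "antimono N"
  shows "(\<integral>\<^sup>+ t\<in>{0<..}. epow (N t) q \<partial>ls_measure_left F)
    = (\<integral>\<^sup>+ y\<in>J. epow (N (T y)) q * indicator {0<..} (T y) \<partial>lborel)"
    and "(\<lambda>y. epow (N (T y)) q * indicator {0<..} (T y) * indicator J y) \<in> borel_measurable lborel"
proof -
  define h where "h t = epow (N t) q * indicator {0<..} t" for t
  have [measurable]: "N \<in> borel_measurable borel" by (rule antimono_borel_measurable[OF N])
  have h: "h \<in> borel_measurable borel" unfolding h_def[abs_def] by measurable
  note F = F_mono[OF q] F_left_continuous[OF q]
  show "(\<integral>\<^sup>+ t\<in>{0<..}. epow (N t) q \<partial>ls_measure_left F)
    = (\<integral>\<^sup>+ y\<in>J. epow (N (T y)) q * indicator {0<..} (T y) \<partial>lborel)"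
    using nn_integral_ls_measure_left[OF F h] by (simp add: h_def J_def T_def)
  have "(\<lambda>y. h (T y)) \<in> borel_measurable (restrict_space lborel J)"
    using measurable_compose[OF ls_measure_left_eq_distr(2)[OF F] h] by (simp add: T_def J_def)
  moreover have "J \<inter> space lborel \<in> sets lborel"
    using ls_measure_left_eq_distr(1)[OF F] by (simp add: J_def)
  ultimately show "(\<lambda>y. epow (N (T y)) q * indicator {0<..} (T y) * indicator J y) \<in> borel_measurable lborel"
    by (simp add: borel_measurable_restrict_space_iff_ennreal h_def)
qed

definition dyadic :: "int \<Rightarrow> real set" where "dyadic k = {2 powr (of_int k * q)..<2 powr (of_int (k + 1) * q)}"

lemma dyadic_measurable [measurable]: "dyadic k \<in> sets borel"
  by (simp add: dyadic_def)

lemma mem_dyadic_iff: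
  assumes "0 < q" shows "y \<in> dyadic k \<longleftrightarrow> 0 < y \<and> k = \<lfloor>log 2 y / q\<rfloor>"
proof (cases "0 < y")
  case True
  have "y \<in> dyadic k \<longleftrightarrow> of_int k * q \<le> log 2 y \<and> log 2 y < of_int (k + 1) * q"
    using True by (auto simp: dyadic_def le_log_iff log_less_iff)
  also have "\<dots> \<longleftrightarrow> of_int k \<le> log 2 y / q \<and> log 2 y / q < of_int k + 1"
    using assms by (simp add: pos_le_divide_eq pos_divide_less_eq)
  also have "\<dots> \<longleftrightarrow> \<lfloor>log 2 y / q\<rfloor> = k" by (rule floor_eq_iff[symmetric])
  finally show ?thesis using True by auto
next
  case False
  have "0 < 2 powr (of_int k * q)" by simp
  then have "y \<notin> dyadic k" using False unfolding dyadic_def atLeastLessThan_iff by linarith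
  then show ?thesis using False by simp
qed

lemma emeasure_dyadic:
  assumes "0 < q"
  shows "emeasure lborel (dyadic k) = ennreal (2 powr (of_int k * q) * (2 powr q - 1))"
proof -
  have "2 powr (of_int (k + 1) * q) = 2 powr (of_int k * q) * 2 powr q"
    by (simp add: algebra_simps flip: powr_add)
  moreover have "2 powr (of_int k * q) \<le> 2 powr (of_int (k + 1) * q)"
    using assms by (intro powr_mono) auto
  ultimately show ?thesis unfolding dyadic_def by (simp add: algebra_simps)
qed

text \<open>The integral of a step function; the k-th interval has length 2^(k q) (2^q - 1).\<close>

lemma sum_dyadic:
  assumes "0 < q"
  shows "(\<integral>\<^sup>+ y. (\<integral>\<^sup>+ k. epow (a k) q * indicator (dyadic k) y \<partial>count_space UNIV) \<partial>lborel)
    = ennreal (2 powr q - 1) * (\<integral>\<^sup>+ k. epow (pow2 k * a k) q \<partial>count_space UNIV)"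
proof -
  have "(\<integral>\<^sup>+ y. (\<integral>\<^sup>+ k. epow (a k) q * indicator (dyadic k) y \<partial>count_space UNIV) \<partial>lborel)
    = (\<integral>\<^sup>+ k. (\<integral>\<^sup>+ y. epow (a k) q * indicator (dyadic k) y \<partial>lborel) \<partial>count_space UNIV)"
    by (rule nn_integral_count_space_nn_integral) auto
  also have "\<dots> = (\<integral>\<^sup>+ k. ennreal (2 powr q - 1) * epow (pow2 k * a k) q \<partial>count_space UNIV)"
  proof (rule nn_integral_cong)
    fix k :: int
    have "1 \<le> 2 powr q" using assms by (intro ge_one_powr_ge_zero) auto
    then show "(\<integral>\<^sup>+ y. epow (a k) q * indicator (dyadic k) y \<partial>lborel) = ennreal (2 powr q - 1) * epow (pow2 k * a k) q"
      using assms by (simp add: nn_integral_cmult_indicator emeasure_dyadic epow_mult epow_pow2 ennreal_mult ac_simps)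
  qed
  finally show ?thesis by (simp add: nn_integral_cmult)
qed

text \<open>An upper bound uses the left end point: \<open>N\<close> decreases, and
  \<open>rad k\<close> is at most \<open>T y\<close> on the k-th interval.\<close>

lemma integral_F_le_sum:
  assumes q: "0 < q" and N: "antimono N" and a: "\<And>k. level_above k \<noteq> {} \<Longrightarrow> N (rad k) \<le> a k"
  shows "(\<integral>\<^sup>+ t\<in>{0<..}. epow (N t) q \<partial>ls_measure_left F)
    \<le> ennreal (2 powr q - 1) * (\<integral>\<^sup>+ k. epow (pow2 k * a k) q \<partial>count_space UNIV)"
proof -
  have "(\<integral>\<^sup>+ t\<in>{0<..}. epow (N t) q \<partial>ls_measure_left F)
    = (\<integral>\<^sup>+ y\<in>J. epow (N (T y)) q * indicator {0<..} (T y) \<partial>lborel)"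
    by (rule nn_integral_F[OF q N])
  also have "\<dots> \<le> (\<integral>\<^sup>+ y. (\<integral>\<^sup>+ k. epow (a k) q * indicator (dyadic k) y \<partial>count_space UNIV) \<partial>lborel)"
    using AE_lborel_singleton[of "0::real"]
  proof (intro nn_integral_mono_AE, eventually_elim)
    case (elim y)
    show ?case
    proof (cases "y \<in> J \<and> 0 < T y")
      case True
      then have y: "0 < y" using elim F_nonneg[of 0] by (simp add: J_iff[OF q])
      define k where "k = \<lfloor>log 2 y / q\<rfloor>"
      have dyadic: "y \<in> dyadic k" using y by (simp add: mem_dyadic_iff[OF q] k_def)
      then have ky: "2 powr (of_int k * q) \<le> y" by (simp add: dyadic_def)
      obtain b where "y < F b" using True by (auto simp: J_def)
      \<comment> \<open>The maximum with 1 gives a positive radius of level k, so that the level is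
        nonempty and \<open>a k\<close> is controlled.\<close>
      then have "y < F (max b 1)" using monoD[OF F_mono[OF q], of b "max b 1"] by simp
      then have "max b 1 \<in> level_above k" using ky by (intro less_F_level_above q) auto
      then have "N (rad k) \<le> a k" using a by blast
      moreover have "N (T y) \<le> N (rad k)" using le_T[OF q _ _ ky] True N by (auto simp: antimono_def)
      ultimately have "epow (N (T y)) q \<le> epow (a k) q" using q by simp
      also have "\<dots> = (\<integral>\<^sup>+ k. epow (a k) q * indicator (dyadic k) y \<partial>count_space UNIV)"
        by (subst nn_integral_count_space_indicator_disjoint[where \<kappa> = "\<lambda>y. \<lfloor>log 2 y / q\<rfloor>" and B = dyadic])
          (use dyadic q in \<open>auto simp: mem_dyadic_iff k_def\<close>)
      finally show ?thesis using True by simp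
    qed (auto simp: indicator_def)
  qed
  also have "\<dots> = ennreal (2 powr q - 1) * (\<integral>\<^sup>+ k. epow (pow2 k * a k) q \<partial>count_space UNIV)"
    by (rule sum_dyadic[OF q])
  finally show ?thesis .
qed

text \<open>Here \<open>T y\<close> has to be bounded from above, by \<open>rad (k + 1)\<close>. So
  the k-th interval controls the term of index k + 1, and undoing the shift costs 2^q. For y up to
  \<open>F 0\<close> there is no t > 0 to compare with; \<open>N 0\<close> is used instead, and the
  length \<open>F 0\<close> = W(0)^-q of this range produces the last term.\<close>

lemma sum_le_integral_F:
  assumes q: "0 < q" and N: "antimono N" and a: "\<And>k. level_above k \<noteq> {} \<Longrightarrow> a k \<le> N (rad k)"
    and a0: "\<And>k. level_above k = {} \<Longrightarrow> a k = 0"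
  shows "(\<integral>\<^sup>+ k. epow (pow2 k * a k) q \<partial>count_space UNIV)
    \<le> ennreal (2 powr q / (2 powr q - 1)) *
      ((\<integral>\<^sup>+ t\<in>{0<..}. epow (N t) q \<partial>ls_measure_left F) + epow (N 0 / W 0) q)" (is "?S \<le> _ * (?I + _)")
proof -
  define d where "d = 2 powr q"
  have d: "1 < d" using q by (simp add: d_def)
  have "ennreal (d - 1) * (\<integral>\<^sup>+ k. epow (pow2 k * a (k + 1)) q \<partial>count_space UNIV)
     = (\<integral>\<^sup>+ y. (\<integral>\<^sup>+ k. epow (a (k + 1)) q * indicator (dyadic k) y \<partial>count_space UNIV) \<partial>lborel)"
    unfolding d_def by (rule sum_dyadic[OF q, symmetric])
  also have "\<dots> \<le> (\<integral>\<^sup>+ y. epow (N 0) q * indicator {0..F 0} y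
      + epow (N (T y)) q * indicator {0<..} (T y) * indicator J y \<partial>lborel)"
  proof (rule nn_integral_mono)
    fix y
    define k where "k = \<lfloor>log 2 y / q\<rfloor>"
    have "(\<integral>\<^sup>+ k. epow (a (k + 1)) q * indicator (dyadic k) y \<partial>count_space UNIV)
      = epow (a (k + 1)) q * indicator (dyadic k) y"
      unfolding k_def
      by (rule nn_integral_count_space_indicator_disjoint[where \<kappa> = "\<lambda>y. \<lfloor>log 2 y / q\<rfloor>" and B = dyadic])
        (use q in \<open>auto simp: mem_dyadic_iff\<close>)
    also have "\<dots> \<le> epow (N 0) q * indicator {0..F 0} y
      + epow (N (T y)) q * indicator {0<..} (T y) * indicator J y"
    proof (cases "y \<in> dyadic k \<and> level_above (k + 1) \<noteq> {}")
      case True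
      then have y: "0 < y" "y < 2 powr (of_int (k + 1) * q)"
        using mem_dyadic_iff[OF q, of y k] by (auto simp: dyadic_def)
      have le: "a (k + 1) \<le> N (rad (k + 1))" using a True by blast
      show ?thesis
      proof (cases "y \<le> F 0")
        case y0: True
        have "N (rad (k + 1)) \<le> N 0" using N True rad_nonneg by (auto simp: antimono_def)
        with le have "epow (a (k + 1)) q \<le> epow (N 0) q" using q by simp
        then show ?thesis using y0 y by (auto simp: indicator_def intro: add_increasing2)
      next
        case False
        then have J: "y \<in> J" using level_above_less_F[OF q _ y(2)] True by (simp add: J_iff[OF q])
        then have "T y \<le> rad (k + 1)" using y True by (intro T_le q) auto
        then have "N (rad (k + 1)) \<le> N (T y)" using N by (auto simp: antimono_def)
        with le have "epow (a (k + 1)) q \<le> epow (N (T y)) q" using q by simp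
        then show ?thesis using J T_pos[OF q J] False by (auto simp: indicator_def)
      qed
    qed (use a0 in \<open>auto simp: indicator_def\<close>)
    finally show "(\<integral>\<^sup>+ k. epow (a (k + 1)) q * indicator (dyadic k) y \<partial>count_space UNIV)
      \<le> epow (N 0) q * indicator {0..F 0} y
      + epow (N (T y)) q * indicator {0<..} (T y) * indicator J y" .
  qed
  also have "\<dots> = (\<integral>\<^sup>+ y. epow (N 0) q * indicator {0..F 0} y \<partial>lborel) + ?I"
    using nn_integral_F[OF q N] by (subst nn_integral_add) auto
  also have "(\<integral>\<^sup>+ y. epow (N 0) q * indicator {0..F 0} y \<partial>lborel) = epow (N 0 / W 0) q"
    using q F_nonneg[of 0] F_nonpos[OF q, of 0]
    by (simp add: nn_integral_cmult_indicator Wq_def divide_ennreal_def epow_mult epow_inverse)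
  finally have *: "ennreal (d - 1) * (\<integral>\<^sup>+ k. epow (pow2 k * a (k + 1)) q \<partial>count_space UNIV)
    \<le> epow (N 0 / W 0) q + ?I" .
  have "?S = (\<integral>\<^sup>+ k. epow (pow2 (k + 1) * a (k + 1)) q \<partial>count_space UNIV)"
    by (rule nn_integral_bij_count_space[symmetric])
      (auto intro!: bij_betwI[where g = "\<lambda>k. k - 1"])
  also have "\<dots> = (\<integral>\<^sup>+ k. ennreal d * epow (pow2 k * a (k + 1)) q \<partial>count_space UNIV)"
    using q by (intro nn_integral_cong) (simp add: pow2_add epow_mult epow_pow2 d_def ac_simps)
  also have "\<dots> = ennreal d * (\<integral>\<^sup>+ k. epow (pow2 k * a (k + 1)) q \<partial>count_space UNIV)"
    by (simp add: nn_integral_cmult)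
  also have "\<dots> = ennreal (d / (d - 1)) * (ennreal (d - 1) * (\<integral>\<^sup>+ k. epow (pow2 k * a (k + 1)) q \<partial>count_space UNIV))"
    using d by (simp flip: mult.assoc ennreal_mult)
  also have "\<dots> \<le> ennreal (d / (d - 1)) * (epow (N 0 / W 0) q + ?I)"
    using * by (rule mult_left_mono) simp
  finally show ?thesis by (simp add: d_def add.commute)
qed

end

section \<open>Lower estimates\<close>

lemma mono_borel_measurable_lebesgue:
  fixes h :: "real \<Rightarrow> ennreal"
  assumes "mono h"
  shows "h \<in> borel_measurable lebesgue"
proof (rule measurable_completion, rule borel_measurableI_greater)
  fix y
  have "{x. y < h x} \<in> sets borel"
    using assms by (intro up_closed_borel) (auto simp: mono_def intro: less_le_trans)
  then show "{x \<in> space lborel. y < h x} \<in> sets lborel" by simp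
qed

text \<open>Distinct exponents make this part of the full geometric series.\<close>

lemma sum_half_powers_le:
  fixes e :: "'i \<Rightarrow> nat"
  assumes "finite K" "inj_on e K" shows "(\<Sum>k\<in>K. (1 / 2 :: real) ^ e k) \<le> 2"
proof -
  have "(\<Sum>k\<in>K. (1 / 2 :: real) ^ e k) = (\<Sum>n\<in>e ` K. (1 / 2) ^ n)"
    using assms(2) by (simp add: sum.reindex)
  also have "\<dots> \<le> (\<Sum>n. (1 / 2) ^ n)"
    using assms(1) by (intro sum_le_suminf summable_geometric) auto
  also have "\<dots> = 2" by (subst suminf_geometric) auto
  finally show ?thesis .
qed

lemma nn_integral_count_space_int_le:
  fixes h :: "int \<Rightarrow> ennreal"
  assumes "\<And>K. finite K \<Longrightarrow> sum h K \<le> c"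
  shows "(\<integral>\<^sup>+ k. h k \<partial>count_space UNIV) \<le> c"
proof -
  have "(\<integral>\<^sup>+ k. h k \<partial>count_space UNIV) = (\<Sum>n. h (int_decode n))"
    by (simp add: nn_integral_bij_count_space[OF bij_int_decode, symmetric] nn_integral_count_space_nat)
  also have "\<dots> \<le> c"
  proof (rule suminf_le_const)
    show "(\<Sum>i<n. h (int_decode i)) \<le> c" for n
      using assms[of "int_decode ` {..<n}"] by (simp add: sum.reindex inj_int_decode)
  qed simp
  finally show ?thesis .
qed

lemma powr_half: "k \<le> j \<Longrightarrow> 2 powr of_int (k - j) = (1 / 2 :: real) ^ nat (j - k)"
  by (simp add: powr_realpow[symmetric] powr_divide powr_minus_divide[symmetric])

section \<open>Admissible test functions and the discrete Hardy inequality\<close>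

context morrey
begin

abbreviation assoc :: "('a \<Rightarrow> real) \<Rightarrow> ennreal" where "assoc f \<equiv> assoc_norm p \<theta> \<omega> v f"

lemma Lp_norm_cmult:
  assumes "0 < c" and [measurable]: "g \<in> borel_measurable lebesgue" "A \<in> sets lebesgue"
  shows "Lp_norm p v A (\<lambda>x. c * g x) = ennreal c * Lp_norm p v A g"
proof -
  have "(\<integral>\<^sup>+ x\<in>A. ennreal (\<bar>c * g x\<bar> powr p * v x) \<partial>lebesgue)
    = (\<integral>\<^sup>+ x. ennreal (c powr p) * (ennreal (\<bar>g x\<bar> powr p * v x) * indicator A x) \<partial>lebesgue)"
    using assms(1) by (intro nn_integral_cong)
      (simp add: abs_mult powr_mult ennreal_mult' mult.assoc)
  then show ?thesis using assms(1) p_pos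
    by (simp add: Lp_norm_def nn_integral_cmult epow_mult epow_ennreal powr_powr)
qed

text \<open>Division by c moves the test function into the unit ball. A finite norm over the whole
  space secures the local integrability built into \<open>LM\<close>.\<close>

lemma le_assoc:
  assumes [measurable]: "f \<in> borel_measurable lebesgue" "g \<in> borel_measurable lebesgue"
    and fin: "Lp_norm p v UNIV g < top" and c: "0 < c" and le: "LMnorm p \<theta> \<omega> v g \<le> ennreal c"
  shows "(\<integral>\<^sup>+ x. ennreal \<bar>f x * g x\<bar> \<partial>lebesgue) \<le> ennreal c * assoc f"
proof -
  define h where "h = (\<lambda>x. (1 / c) * g x)"
  have [measurable]: "h \<in> borel_measurable lebesgue" unfolding h_def by measurable
  have Lp_norm_h: "Lp_norm p v A h = ennreal (1 / c) * Lp_norm p v A g" if "A \<in> sets lebesgue" for A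
    unfolding h_def using c that by (intro Lp_norm_cmult) auto
  have [measurable]: "(\<lambda>r. Lp_norm p v (ball 0 r) g) \<in> borel_measurable lebesgue"
    using p by (intro mono_borel_measurable_lebesgue monoI Lp_norm_mono subset_ball) auto
  have "LMnorm p \<theta> \<omega> v h
    = lnorm \<theta> {0<..} (\<lambda>r. ennreal (1 / c) * (ennreal (\<omega> r) * Lp_norm p v (ball 0 r) g))"
    unfolding LMnorm_eq by (simp add: Lp_norm_h ac_simps)
  also have "\<dots> \<le> ennreal (1 / c) * LMnorm p \<theta> \<omega> v g"
    unfolding LMnorm_eq by (intro lnorm_cmult_le theta_pos) auto
  also have "\<dots> \<le> ennreal (1 / c) * ennreal c" using le by (intro mult_left_mono) auto
  also have "\<dots> = 1" using c by (simp flip: ennreal_mult)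
  finally have h1: "LMnorm p \<theta> \<omega> v h \<le> 1" .
  have "(\<integral>\<^sup>+ x\<in>K. ennreal (\<bar>h x\<bar> powr p * v x) \<partial>lebesgue) < \<infinity>" for K
  proof -
    have "Lp_norm p v K h \<le> Lp_norm p v UNIV h" using p by (intro Lp_norm_mono) auto
    also have "\<dots> < top" using fin by (simp add: Lp_norm_h ennreal_mult_less_top)
    finally show ?thesis by (auto simp: Lp_norm_def less_top[symmetric])
  qed
  then have "h \<in> {g \<in> LM p \<theta> \<omega> v. LMnorm p \<theta> \<omega> v g \<le> 1}"
    using h1 by (auto simp: LM_def intro: le_less_trans)
  then have "(\<integral>\<^sup>+ x. ennreal \<bar>f x * h x\<bar> \<partial>lebesgue) \<le> assoc f"
    unfolding assoc_norm_def by (rule SUP_upper)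
  then have "ennreal c * (\<integral>\<^sup>+ x. ennreal \<bar>f x * h x\<bar> \<partial>lebesgue) \<le> ennreal c * assoc f"
    by (rule mult_left_mono) simp
  also have "ennreal c * (\<integral>\<^sup>+ x. ennreal \<bar>f x * h x\<bar> \<partial>lebesgue)
    = (\<integral>\<^sup>+ x. ennreal c * ennreal \<bar>f x * h x\<bar> \<partial>lebesgue)"
    by (rule nn_integral_cmult[symmetric]) measurable
  also have "\<dots> = (\<integral>\<^sup>+ x. ennreal \<bar>f x * g x\<bar> \<partial>lebesgue)"
    using c by (intro nn_integral_cong) (simp add: h_def abs_mult flip: ennreal_mult)
  finally show ?thesis .
qed

text \<open>A function of unit norm supported off the ball of radius t has local norm 0 up to t and
  at most 1 beyond, hence norm at most \<open>W t\<close> in X. This is the lower bound of (i); t =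
  0 gives the last term of (ii), and the quotient is 0 if \<open>W t\<close> is infinite.\<close>

lemma Nf_le_assoc:
  assumes f [measurable]: "f \<in> borel_measurable lebesgue" and t: "0 \<le> t"
  shows "Nf p v (- ball 0 t) f / W t \<le> assoc f"
proof (cases "W t = top")
  case False
  then obtain w where w: "W t = ennreal w" "0 < w"
    using W_pos[of t] by (cases "W t") auto
  have "Nf p v (- ball 0 t) f \<le> ennreal w * assoc f"
  proof (rule dense_le)
    fix c assume "c < Nf p v (- ball 0 t) f"
    from Nf_dual[OF p v f ball_measurable(2) this]
    obtain g where g [measurable]: "g \<in> borel_measurable lebesgue" and g0: "\<And>x. 0 \<le> g x"
      "\<And>x. x \<notin> - ball 0 t \<Longrightarrow> g x = 0" "Lp_norm p v UNIV g \<le> 1"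
      and c: "c \<le> (\<integral>\<^sup>+ x. ennreal (\<bar>f x\<bar> * g x) \<partial>lebesgue)" by blast
    have "LMnorm p \<theta> \<omega> v g \<le> W t"
      unfolding LMnorm_eq wnorm_def
    proof (intro lnorm_mono theta_pos AE_I2 impI)
      fix r :: real assume r: "r \<in> {0<..}"
      show "ennreal (\<omega> r) * Lp_norm p v (ball 0 r) g = 0
        \<or> r \<in> {t<..} \<inter> {0<..} \<and> ennreal (\<omega> r) * Lp_norm p v (ball 0 r) g \<le> ennreal (\<omega> r)"
      proof (cases "t < r")
        case True
        have "Lp_norm p v (ball 0 r) g \<le> Lp_norm p v UNIV g" using p by (intro Lp_norm_mono) auto
        also have "\<dots> \<le> 1" by fact
        finally show ?thesis using True r mult_left_mono[of _ 1 "ennreal (\<omega> r)"] by simp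
      next
        case False
        have "(\<lambda>x. ennreal (\<bar>g x\<bar> powr p * v x) * indicator (ball 0 r) x) = (\<lambda>x. 0)"
          using g0(2) False by (auto simp: indicator_def fun_eq_iff)
        then show ?thesis by (simp add: Lp_norm_def)
      qed
    qed
    then have "(\<integral>\<^sup>+ x. ennreal \<bar>f x * g x\<bar> \<partial>lebesgue) \<le> ennreal w * assoc f"
      using w g0(3) by (intro le_assoc f g) (auto intro: le_less_trans)
    with c g0(1) show "c \<le> ennreal w * assoc f" by (simp add: abs_mult)
  qed
  then show ?thesis using w by (auto intro!: divide_le_posI_ennreal)
qed simp

text \<open>Minkowski's inequality, obtained from convexity of the power. Functions outside
  \<open>L\<close> vanish on \<open>B\<close>; later \<open>B\<close> is a ball and \<open>L\<close>
  consists of the indices up to the level of its radius.\<close>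

lemma Lp_norm_sum_le:
  fixes c :: "'i \<Rightarrow> real" and g :: "'i \<Rightarrow> 'a \<Rightarrow> real"
  assumes K: "finite K" "L \<subseteq> K" and c: "\<And>k. k \<in> K \<Longrightarrow> 0 \<le> c k"
    and g: "\<And>k. k \<in> K \<Longrightarrow> g k \<in> borel_measurable lebesgue" "\<And>k x. k \<in> K \<Longrightarrow> 0 \<le> g k x"
      "\<And>k. k \<in> K \<Longrightarrow> Lp_norm p v UNIV (g k) \<le> 1" "\<And>k x. k \<in> K - L \<Longrightarrow> x \<in> B \<Longrightarrow> g k x = 0"
  shows "Lp_norm p v B (\<lambda>x. \<Sum>k\<in>K. c k * g k x) \<le> ennreal (\<Sum>k\<in>L. c k)"
proof -
  define s where "s = (\<Sum>k\<in>L. c k)"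
  have L: "finite L" using K finite_subset by blast
  have c': "0 \<le> c k" if "k \<in> L" for k using that K c by blast
  have s: "0 \<le> s" unfolding s_def using c' by (intro sum_nonneg)
  have gm: "(\<lambda>x. ennreal (\<bar>g k x\<bar> powr p * v x)) \<in> borel_measurable lebesgue" if "k \<in> L" for k
  proof -
    have [measurable]: "g k \<in> borel_measurable lebesgue" using that K g(1) by blast
    show ?thesis by measurable
  qed
  have "AE x in lebesgue. 0 < v x" using v by (simp add: Wts_def)
  then have "(\<integral>\<^sup>+ x\<in>B. ennreal (\<bar>\<Sum>k\<in>K. c k * g k x\<bar> powr p * v x) \<partial>lebesgue)
    \<le> (\<integral>\<^sup>+ x. (\<Sum>k\<in>L. ennreal (s powr (p - 1) * c k) * ennreal (\<bar>g k x\<bar> powr p * v x)) \<partial>lebesgue)"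
  proof (intro nn_integral_mono_AE, eventually_elim)
    case (elim x)
    show ?case
    proof (cases "x \<in> B")
      case True
      have "(\<Sum>k\<in>K. c k * g k x) = (\<Sum>k\<in>L. c k * g k x)"
        using K g(4) True by (intro sum.mono_neutral_right) auto
      moreover have "0 \<le> (\<Sum>k\<in>L. c k * g k x)"
        using c' K g(2) by (intro sum_nonneg mult_nonneg_nonneg) auto
      moreover have "(\<Sum>k\<in>L. c k * g k x) powr p
          \<le> s powr (p - 1) * (\<Sum>k\<in>L. c k * g k x powr p)"
        unfolding s_def using L p c' K g(2) by (intro powr_sum_le) auto
      ultimately have "\<bar>\<Sum>k\<in>K. c k * g k x\<bar> powr p * v x
          \<le> s powr (p - 1) * (\<Sum>k\<in>L. c k * g k x powr p) * v x"
        using elim by (simp add: mult_right_mono)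
      also have "\<dots> = (\<Sum>k\<in>L. s powr (p - 1) * c k * (\<bar>g k x\<bar> powr p * v x))"
        using g(2) K by (auto simp: sum_distrib_left sum_distrib_right intro!: sum.cong)
      finally have "ennreal (\<bar>\<Sum>k\<in>K. c k * g k x\<bar> powr p * v x)
          \<le> ennreal (\<Sum>k\<in>L. s powr (p - 1) * c k * (\<bar>g k x\<bar> powr p * v x))"
        by (rule ennreal_leI)
      also have "\<dots> = (\<Sum>k\<in>L. ennreal (s powr (p - 1) * c k) * ennreal (\<bar>g k x\<bar> powr p * v x))"
        using c' elim by (subst sum_ennreal[symmetric]) (auto simp: ennreal_mult intro!: sum.cong)
      finally show ?thesis using True by simp
    qed simp
  qed
  also have "\<dots> = (\<Sum>k\<in>L. ennreal (s powr (p - 1) * c k) * (\<integral>\<^sup>+ x. ennreal (\<bar>g k x\<bar> powr p * v x) \<partial>lebesgue))"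
    using gm by (subst nn_integral_sum) (auto simp: nn_integral_cmult intro!: sum.cong)
  also have "\<dots> \<le> (\<Sum>k\<in>L. ennreal (s powr (p - 1) * c k) * 1)"
    using g(3) K p_pos by (intro sum_mono mult_left_mono) (auto simp: Lp_norm_le_iff)
  also have "\<dots> = ennreal (s powr (p - 1) * s)"
    using c' by (simp add: sum_ennreal s_def sum_distrib_left)
  also have "\<dots> = epow (ennreal s) p"
    using s p powr_mult_base[of s "p - 1"] by (simp add: epow_ennreal mult.commute)
  finally show ?thesis using p_pos by (simp add: Lp_norm_le_iff s_def)
qed

text \<open>On block j the weight has mass at most 2^(-j \<theta>), which turns the profile into a
  convolution of a with the kernel 2^-(j - k), k \<le> j. Jensen's inequality with the kernel as
  weights, of total at most 2, gives 2^(\<theta> - 1), and summing the kernel over j gives another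
  2; the \<theta>-th root of 2^\<theta> is the bound. For infinite \<theta> the kernel summed over k
  gives 2 directly.\<close>

lemma weighted_profile_le:
  fixes a :: "int \<Rightarrow> real"
  assumes \<theta>1: "1 < \<theta>" and K: "finite K" and a: "\<And>k. k \<in> K \<Longrightarrow> 0 \<le> a k"
    and inf: "\<And>k. \<theta> = \<infinity> \<Longrightarrow> k \<in> K \<Longrightarrow> a k \<le> 1"
    and fin: "\<theta> \<noteq> \<infinity> \<Longrightarrow> (\<Sum>k\<in>K. a k powr enn2real \<theta>) \<le> 1"
    and \<phi>: "\<And>r. 0 < r \<Longrightarrow> \<phi> r \<le> ennreal (\<Sum>k\<in>{k\<in>K. k \<le> level r}. 2 powr of_int k * a k)"
  shows "lnorm \<theta> {0<..} (\<lambda>r. ennreal (\<omega> r) * \<phi> r) \<le> 2"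
proof -
  define S where "S j = (\<Sum>k\<in>{k\<in>K. k \<le> j}. 2 powr of_int k * a k)" for j
  have S0: "0 \<le> S j" for j unfolding S_def using a by (intro sum_nonneg) auto
  have \<phi>S: "\<phi> r \<le> ennreal (S (level r))" if "0 < r" for r using \<phi> that by (simp add: S_def)
  have pS: "pow2 (- j) * ennreal (S j) = ennreal (\<Sum>k\<in>{k\<in>K. k \<le> j}. (1 / 2) ^ nat (j - k) * a k)" for j
  proof -
    have "2 powr of_int (- j) * S j = (\<Sum>k\<in>{k\<in>K. k \<le> j}. 2 powr of_int (k - j) * a k)"
      unfolding S_def sum_distrib_left
      by (intro sum.cong) (auto simp: mult.assoc[symmetric] simp flip: powr_add)
    also have "\<dots> = (\<Sum>k\<in>{k\<in>K. k \<le> j}. (1 / 2) ^ nat (j - k) * a k)"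
      by (intro sum.cong) (auto simp: powr_half simp del: of_int_diff)
    finally show ?thesis using S0 by (simp add: pow2_def flip: ennreal_mult)
  qed
  have geo: "(\<Sum>k\<in>{k\<in>K. k \<le> j}. (1 / 2 :: real) ^ nat (j - k)) \<le> 2" for j
    using K by (intro sum_half_powers_le) (auto simp: inj_on_def)
  show ?thesis
  proof (cases "\<theta> = \<infinity>")
    case True
    have "AE r in lebesgue. \<forall>k. r \<in> block k \<longrightarrow> ennreal (\<omega> r) \<le> pow2 (- k)"
      using AE_omega_le_block[OF True] by (subst AE_all_countable) auto
    then have "AE r in lebesgue. r \<in> {0<..} \<longrightarrow> ennreal (\<omega> r) * \<phi> r \<le> 2"
    proof eventually_elim
      case (elim r)
      show ?case
      proof
        assume r: "r \<in> {0<..}"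
        have "ennreal (\<omega> r) * \<phi> r \<le> pow2 (- level r) * ennreal (S (level r))"
          using elim r \<phi>S[of r] by (intro mult_mono) (auto simp: block_def)
        also have "\<dots> \<le> ennreal (\<Sum>k\<in>{k\<in>K. k \<le> level r}. (1 / 2) ^ nat (level r - k) * 1)"
          unfolding pS using inf[OF True] by (intro ennreal_leI sum_mono mult_left_mono) auto
        also have "\<dots> \<le> ennreal 2" using geo[of "level r"] by (intro ennreal_leI) simp
        finally show "ennreal (\<omega> r) * \<phi> r \<le> 2" by simp
      qed
    qed
    then show ?thesis unfolding lnorm_le_iff[OF theta_pos] by (simp add: True)
  next
    case False
    define \<theta>' where "\<theta>' = enn2real \<theta>"
    have \<theta>': "1 < \<theta>'" using theta_conj_facts(2)[OF \<theta>1 False] by (simp add: \<theta>'_def)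
    let ?w = "\<lambda>r. epow (ennreal (\<omega> r)) \<theta>'"
    have "(\<integral>\<^sup>+ r\<in>{0<..}. epow (ennreal (\<omega> r) * \<phi> r) \<theta>' \<partial>lebesgue)
      \<le> (\<integral>\<^sup>+ r. (\<integral>\<^sup>+ j. ?w r * epow (ennreal (S j)) \<theta>' * indicator (block j) r \<partial>count_space UNIV) \<partial>lebesgue)"
    proof (rule nn_integral_mono)
      fix r
      have "(\<integral>\<^sup>+ j. ?w r * epow (ennreal (S j)) \<theta>' * indicator (block j) r \<partial>count_space UNIV)
        = ?w r * epow (ennreal (S (level r))) \<theta>' * indicator (block (level r)) r"
        by (rule nn_integral_count_space_indicator_disjoint[where \<kappa> = level and B = block])
          (auto simp: block_def)
      moreover have "epow (ennreal (\<omega> r) * \<phi> r) \<theta>' \<le> ?w r * epow (ennreal (S (level r))) \<theta>'" if "0 < r"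
        using \<theta>' \<phi>S[OF that] by (simp add: epow_mult mult_left_mono)
      ultimately show "epow (ennreal (\<omega> r) * \<phi> r) \<theta>' * indicator {0<..} r
        \<le> (\<integral>\<^sup>+ j. ?w r * epow (ennreal (S j)) \<theta>' * indicator (block j) r \<partial>count_space UNIV)"
        by (auto simp: block_def indicator_def)
    qed
    also have "\<dots> = (\<integral>\<^sup>+ j. (\<integral>\<^sup>+ r. ?w r * epow (ennreal (S j)) \<theta>' * indicator (block j) r \<partial>lebesgue) \<partial>count_space UNIV)"
    proof (rule nn_integral_count_space_nn_integral)
      fix j :: int
      have "(indicator (block j) :: real \<Rightarrow> ennreal) \<in> borel_measurable lebesgue"
        by (rule borel_measurable_indicator) simp
      moreover have "(\<lambda>r. ?w r * epow (ennreal (S j)) \<theta>') \<in> borel_measurable lebesgue"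
        by measurable
      ultimately show "(\<lambda>r. ?w r * epow (ennreal (S j)) \<theta>' * indicator (block j) r) \<in> borel_measurable lebesgue"
        by (rule borel_measurable_times_ennreal[rotated])
    qed simp
    also have "\<dots> \<le> (\<integral>\<^sup>+ j. (\<Sum>k\<in>K. ennreal (2 powr (\<theta>' - 1) * a k powr \<theta>') *
        (ennreal ((1 / 2) ^ nat (j - k)) * indicator {k..} j)) \<partial>count_space UNIV)"
    proof (rule nn_integral_mono)
      fix j :: int
      have "(\<integral>\<^sup>+ r. ?w r * epow (ennreal (S j)) \<theta>' * indicator (block j) r \<partial>lebesgue)
        = (\<integral>\<^sup>+ r. ?w r * indicator (block j) r * epow (ennreal (S j)) \<theta>' \<partial>lebesgue)"
        by (intro nn_integral_cong) (simp add: ac_simps)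
      also have "\<dots> = (\<integral>\<^sup>+ r. ?w r * indicator (block j) r \<partial>lebesgue) * epow (ennreal (S j)) \<theta>'"
      proof (rule nn_integral_multc)
        have "(indicator (block j) :: real \<Rightarrow> ennreal) \<in> borel_measurable lebesgue"
          by (rule borel_measurable_indicator) simp
        moreover have "?w \<in> borel_measurable lebesgue" by measurable
        ultimately show "(\<lambda>r. ?w r * indicator (block j) r) \<in> borel_measurable lebesgue"
          by (rule borel_measurable_times_ennreal[rotated])
      qed
      also have "(\<integral>\<^sup>+ r. ?w r * indicator (block j) r \<partial>lebesgue) = emeasure omega_measure (block j)"
      proof -
        have "block j \<inter> {0<..} = block j" by (auto simp: block_def)
        then show ?thesis by (simp add: emeasure_omega_measure \<theta>'_def)
      qed
      also have "emeasure omega_measure (block j) * epow (ennreal (S j)) \<theta>'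
        \<le> epow (pow2 (- j)) \<theta>' * epow (ennreal (S j)) \<theta>'"
        unfolding \<theta>'_def by (intro mult_right_mono omega_measure_block_le False) simp
      also have "\<dots> = epow (ennreal (\<Sum>k\<in>{k\<in>K. k \<le> j}. (1 / 2) ^ nat (j - k) * a k)) \<theta>'"
        using \<theta>' by (simp add: pS flip: epow_mult)
      also have "\<dots> = ennreal ((\<Sum>k\<in>{k\<in>K. k \<le> j}. (1 / 2) ^ nat (j - k) * a k) powr \<theta>')"
        using a by (intro epow_ennreal sum_nonneg) auto
      also have "\<dots> \<le> ennreal (2 powr (\<theta>' - 1) * (\<Sum>k\<in>{k\<in>K. k \<le> j}. (1 / 2) ^ nat (j - k) * a k powr \<theta>'))"
      proof (rule ennreal_leI)
        have "(\<Sum>k\<in>{k\<in>K. k \<le> j}. (1 / 2) ^ nat (j - k) * a k) powr \<theta>'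
          \<le> (\<Sum>k\<in>{k\<in>K. k \<le> j}. (1 / 2) ^ nat (j - k)) powr (\<theta>' - 1)
            * (\<Sum>k\<in>{k\<in>K. k \<le> j}. (1 / 2) ^ nat (j - k) * a k powr \<theta>')"
          using K a \<theta>' by (intro powr_sum_le) auto
        also have "\<dots> \<le> 2 powr (\<theta>' - 1) * (\<Sum>k\<in>{k\<in>K. k \<le> j}. (1 / 2) ^ nat (j - k) * a k powr \<theta>')"
          using geo[of j] \<theta>' by (intro mult_right_mono powr_mono2) (auto intro!: sum_nonneg)
        finally show "(\<Sum>k\<in>{k\<in>K. k \<le> j}. (1 / 2) ^ nat (j - k) * a k) powr \<theta>'
          \<le> 2 powr (\<theta>' - 1) * (\<Sum>k\<in>{k\<in>K. k \<le> j}. (1 / 2) ^ nat (j - k) * a k powr \<theta>')" .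
      qed
      also have "\<dots> = (\<Sum>k\<in>{k\<in>K. k \<le> j}. ennreal (2 powr (\<theta>' - 1) * a k powr \<theta>') * ennreal ((1 / 2) ^ nat (j - k)))"
        by (simp add: sum_distrib_left sum_ennreal ac_simps flip: ennreal_mult)
      also have "\<dots> = (\<Sum>k\<in>K. ennreal (2 powr (\<theta>' - 1) * a k powr \<theta>') *
        (ennreal ((1 / 2) ^ nat (j - k)) * indicator {k..} j))"
        using K by (intro sum.mono_neutral_cong_left) (auto simp: indicator_def)
      finally show "(\<integral>\<^sup>+ r. ?w r * epow (ennreal (S j)) \<theta>' * indicator (block j) r \<partial>lebesgue)
        \<le> (\<Sum>k\<in>K. ennreal (2 powr (\<theta>' - 1) * a k powr \<theta>') *
        (ennreal ((1 / 2) ^ nat (j - k)) * indicator {k..} j))" .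
    qed
    also have "\<dots> = (\<Sum>k\<in>K. ennreal (2 powr (\<theta>' - 1) * a k powr \<theta>') *
        (\<integral>\<^sup>+ j. ennreal ((1 / 2) ^ nat (j - k)) * indicator {k..} j \<partial>count_space UNIV))"
      by (simp add: nn_integral_sum nn_integral_cmult)
    \<comment> \<open>The order of summation has been reversed: k is now fixed and the kernel is
      summed over j from k on.\<close>
    also have "\<dots> \<le> (\<Sum>k\<in>K. ennreal (2 powr (\<theta>' - 1) * a k powr \<theta>') * ennreal 2)"
    proof (intro sum_mono mult_left_mono nn_integral_count_space_int_le)
      fix k and M :: "int set" assume M: "finite M"
      have "(\<Sum>j\<in>M. ennreal ((1 / 2) ^ nat (j - k)) * indicator {k..} j)
        = (\<Sum>j\<in>M \<inter> {k..}. ennreal ((1 / 2) ^ nat (j - k)))"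
        using M by (intro sum.mono_neutral_cong_right) (auto simp: indicator_def)
      also have "\<dots> = ennreal (\<Sum>j\<in>M \<inter> {k..}. (1 / 2) ^ nat (j - k))"
        by (simp add: sum_ennreal)
      also have "\<dots> \<le> ennreal 2"
        using M by (intro ennreal_leI sum_half_powers_le) (auto simp: inj_on_def)
      finally show "(\<Sum>j\<in>M. ennreal ((1 / 2) ^ nat (j - k)) * indicator {k..} j) \<le> ennreal 2" .
    qed simp
    also have "\<dots> = ennreal (2 powr \<theta>' * (\<Sum>k\<in>K. a k powr \<theta>'))"
      by (simp add: sum_ennreal sum_distrib_left powr_diff flip: ennreal_mult del: ennreal_numeral)
    also have "\<dots> \<le> ennreal (2 powr \<theta>' * 1)"
      using fin[OF False] by (intro ennreal_leI mult_left_mono) (auto simp: \<theta>'_def)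
    also have "\<dots> = epow 2 \<theta>'" using epow_ennreal[of 2 \<theta>'] by simp
    finally show ?thesis unfolding lnorm_le_iff[OF theta_pos] using False by (simp add: \<theta>'_def)
  qed
qed

end

section \<open>The associate norm compared with the Stieltjes integral\<close>

context morrey
begin

abbreviation N :: "('a \<Rightarrow> real) \<Rightarrow> real \<Rightarrow> ennreal" where "N f t \<equiv> Nf p v (- ball 0 t) f"

lemma N_antimono: "antimono (N f)"
  using p by (intro antimonoI Nf_mono) auto

text \<open>Finiteness puts half of a nonzero \<open>N f (rad k)\<close> strictly below it, as the
  choice of a dual function requires.\<close>

lemma N_rad_finite:
  assumes "f \<in> borel_measurable lebesgue" "assoc f < top" "level_above k \<noteq> {}"
  shows "N f (rad k) < top"
proof -
  have W: "W (rad k) < top" using W_rad_le[OF assms(3)] by (rule le_less_trans) simp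
  then have "N f (rad k) = N f (rad k) / W (rad k) * W (rad k)"
    by (simp add: ennreal_divide_times)
  also have "\<dots> \<le> assoc f * W (rad k)"
    using assms by (intro mult_right_mono Nf_le_assoc rad_nonneg) auto
  also have "\<dots> < top" using W assms(2) by (simp add: ennreal_mult_less_top)
  finally show ?thesis .
qed

text \<open>One factor 2 is due to dual functions that attain only half of
  \<open>N f (rad k)\<close>, the other to the norm of their combination in X. Finite sums keep the
  norm of that combination over the whole space finite, as \<open>le_assoc\<close> asks.\<close>

lemma sum_le_assoc:
  fixes a :: "int \<Rightarrow> real"
  assumes f [measurable]: "f \<in> borel_measurable lebesgue" and fin_f: "assoc f < top"
    and \<theta>1: "1 < \<theta>" and K: "finite K" "\<And>k. k \<in> K \<Longrightarrow> level_above k \<noteq> {}" and a: "\<And>k. k \<in> K \<Longrightarrow> 0 \<le> a k"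
    and inf: "\<And>k. \<theta> = \<infinity> \<Longrightarrow> k \<in> K \<Longrightarrow> a k \<le> 1"
    and fin: "\<theta> \<noteq> \<infinity> \<Longrightarrow> (\<Sum>k\<in>K. a k powr enn2real \<theta>) \<le> 1"
  shows "(\<Sum>k\<in>K. ennreal (a k) * (pow2 k * N f (rad k))) \<le> 4 * assoc f"
proof -
  have "\<exists>g :: 'a \<Rightarrow> real. g \<in> borel_measurable lebesgue \<and> (\<forall>x. 0 \<le> g x) \<and>
      (\<forall>x\<in>ball 0 (rad k). g x = 0) \<and> Lp_norm p v UNIV g \<le> 1 \<and>
      N f (rad k) \<le> 2 * (\<integral>\<^sup>+ x. ennreal (\<bar>f x\<bar> * g x) \<partial>lebesgue)" if k: "k \<in> K" for k
  proof (cases "N f (rad k) = 0")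
    case True
    then show ?thesis by (intro exI[of _ "\<lambda>x. 0"]) (simp add: Lp_norm_def)
  next
    case False
    obtain n where n: "N f (rad k) = ennreal n" "0 < n"
      using N_rad_finite[OF f fin_f K(2)[OF k]] False by (cases "N f (rad k)") auto
    have "ennreal (n / 2) < N f (rad k)" using n by (simp add: ennreal_less_iff)
    from Nf_dual[OF p v f ball_measurable(2) this]
    obtain g where "g \<in> borel_measurable lebesgue" "\<And>x. 0 \<le> g x"
      "\<And>x. x \<notin> - ball 0 (rad k) \<Longrightarrow> g x = 0" "Lp_norm p v UNIV g \<le> 1"
      and c: "ennreal (n / 2) \<le> (\<integral>\<^sup>+ x. ennreal (\<bar>f x\<bar> * g x) \<partial>lebesgue)" by blast
    moreover have "N f (rad k) = 2 * ennreal (n / 2)"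
      using n by (simp add: ennreal_mult[symmetric] flip: ennreal_numeral)
    ultimately show ?thesis by (intro exI[of _ g]) (auto intro: mult_left_mono)
  qed
  then have "\<forall>k\<in>K. \<exists>g :: 'a \<Rightarrow> real. g \<in> borel_measurable lebesgue \<and> (\<forall>x. 0 \<le> g x) \<and>
      (\<forall>x\<in>ball 0 (rad k). g x = 0) \<and> Lp_norm p v UNIV g \<le> 1 \<and>
      N f (rad k) \<le> 2 * (\<integral>\<^sup>+ x. ennreal (\<bar>f x\<bar> * g x) \<partial>lebesgue)" ..
  from bchoice[OF this] obtain g :: "int \<Rightarrow> 'a \<Rightarrow> real" where g: "\<And>k. k \<in> K \<Longrightarrow> g k \<in> borel_measurable lebesgue"
    "\<And>k x. k \<in> K \<Longrightarrow> 0 \<le> g k x" "\<And>k x. k \<in> K \<Longrightarrow> x \<in> ball 0 (rad k) \<Longrightarrow> g k x = 0"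
    "\<And>k. k \<in> K \<Longrightarrow> Lp_norm p v UNIV (g k) \<le> 1"
    "\<And>k. k \<in> K \<Longrightarrow> N f (rad k) \<le> 2 * (\<integral>\<^sup>+ x. ennreal (\<bar>f x\<bar> * g k x) \<partial>lebesgue)"
    by blast
  define c where "c k = 2 powr of_int k * a k" for k :: int
  have c: "0 \<le> c k" if "k \<in> K" for k using a[OF that] by (simp add: c_def)
  define G where "G = (\<lambda>x. \<Sum>k\<in>K. c k * g k x)"
  have [measurable]: "G \<in> borel_measurable lebesgue"
    unfolding G_def using g(1) by (intro borel_measurable_sum borel_measurable_times) auto
  have "Lp_norm p v UNIV G \<le> ennreal (\<Sum>k\<in>K. c k)"
    unfolding G_def by (rule Lp_norm_sum_le) (use K c g in auto)
  also have "\<dots> < top" by simp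
  finally have GU: "Lp_norm p v UNIV G < top" .
  have "LMnorm p \<theta> \<omega> v G \<le> 2"
    unfolding LMnorm_eq
  proof (rule weighted_profile_le[OF \<theta>1 K(1) a inf fin])
    fix r :: real assume r: "0 < r"
    have "Lp_norm p v (ball 0 r) G \<le> ennreal (\<Sum>k\<in>{k\<in>K. k \<le> level r}. c k)"
      unfolding G_def
    proof (rule Lp_norm_sum_le)
      \<comment> \<open>An index above the level of r has \<open>rad k\<close> at least r, so
        \<open>g k\<close> vanishes on the whole ball.\<close>
      fix k x assume k: "k \<in> K - {k \<in> K. k \<le> level r}" and "x \<in> ball (0::'a) r"
      then have "\<not> rad k < r" using rad_less[OF K(2), of k r] by (auto simp: level_above_def)
      then show "g k x = 0" using k \<open>x \<in> ball 0 r\<close> by (intro g(3)) auto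
    qed (use K c g in auto)
    then show "Lp_norm p v (ball 0 r) G \<le> ennreal (\<Sum>k\<in>{k\<in>K. k \<le> level r}. 2 powr of_int k * a k)"
      by (simp add: c_def)
  qed auto
  then have GA: "(\<integral>\<^sup>+ x. ennreal \<bar>f x * G x\<bar> \<partial>lebesgue) \<le> ennreal 2 * assoc f"
    using GU by (intro le_assoc) auto
  have "(\<Sum>k\<in>K. ennreal (a k) * (pow2 k * N f (rad k))) = (\<Sum>k\<in>K. ennreal (c k) * N f (rad k))"
    using a by (intro sum.cong) (simp_all add: c_def pow2_def ennreal_mult ac_simps)
  also have "\<dots> \<le> (\<Sum>k\<in>K. ennreal (c k) * (2 * (\<integral>\<^sup>+ x. ennreal (\<bar>f x\<bar> * g k x) \<partial>lebesgue)))"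
    using g(5) by (intro sum_mono mult_left_mono) auto
  also have "\<dots> = 2 * (\<Sum>k\<in>K. ennreal (c k) * (\<integral>\<^sup>+ x. ennreal (\<bar>f x\<bar> * g k x) \<partial>lebesgue))"
    by (simp add: sum_distrib_left ac_simps)
  also have "(\<Sum>k\<in>K. ennreal (c k) * (\<integral>\<^sup>+ x. ennreal (\<bar>f x\<bar> * g k x) \<partial>lebesgue))
    = (\<integral>\<^sup>+ x. (\<Sum>k\<in>K. ennreal (c k) * ennreal (\<bar>f x\<bar> * g k x)) \<partial>lebesgue)"
  proof -
    have m: "(\<lambda>x. ennreal (\<bar>f x\<bar> * g k x)) \<in> borel_measurable lebesgue" if "k \<in> K" for k
    proof -
      have [measurable]: "g k \<in> borel_measurable lebesgue" using g(1) that by blast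
      show ?thesis by measurable
    qed
    then show ?thesis by (subst nn_integral_sum) (auto simp: nn_integral_cmult)
  qed
  also have "\<dots> = (\<integral>\<^sup>+ x. ennreal \<bar>f x * G x\<bar> \<partial>lebesgue)"
  proof (rule nn_integral_cong)
    fix x
    have "(\<Sum>k\<in>K. ennreal (c k) * ennreal (\<bar>f x\<bar> * g k x)) = (\<Sum>k\<in>K. ennreal (c k * (\<bar>f x\<bar> * g k x)))"
      using c g(2) by (intro sum.cong refl ennreal_mult[symmetric]) auto
    also have "\<dots> = ennreal (\<Sum>k\<in>K. c k * (\<bar>f x\<bar> * g k x))"
      using c g(2) by (intro sum_ennreal) auto
    also have "(\<Sum>k\<in>K. c k * (\<bar>f x\<bar> * g k x)) = \<bar>f x\<bar> * G x"
      by (simp add: G_def sum_distrib_left ac_simps)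
    also have "\<dots> = \<bar>f x * G x\<bar>"
      using c g(2) by (simp add: abs_mult G_def sum_nonneg)
    finally show "(\<Sum>k\<in>K. ennreal (c k) * ennreal (\<bar>f x\<bar> * g k x)) = ennreal \<bar>f x * G x\<bar>" .
  qed
  also have "2 * \<dots> \<le> 2 * (ennreal 2 * assoc f)" using GA by (intro mult_left_mono) auto
  also have "\<dots> = 4 * assoc f" by (simp flip: mult.assoc)
  finally show ?thesis by (simp add: mult_left_mono)
qed

lemma sum_pow_le_assoc:
  assumes f: "f \<in> borel_measurable lebesgue" and fin_f: "assoc f < top"
    and \<theta>1: "1 < \<theta>" and K: "finite K" "\<And>k. k \<in> K \<Longrightarrow> level_above k \<noteq> {}"
  shows "(\<Sum>k\<in>K. epow (pow2 k * N f (rad k)) q) \<le> epow (4 * assoc f) q"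
proof (cases "\<theta> = \<infinity>")
  case True
  then have q: "q = 1" by (rule theta_conj_facts(3)[OF \<theta>1])
  have "(\<Sum>k\<in>K. ennreal 1 * (pow2 k * N f (rad k))) \<le> 4 * assoc f"
    by (rule sum_le_assoc[OF f fin_f \<theta>1 K]) (use True in auto)
  then show ?thesis by (simp add: q)
next
  case False
  define \<theta>' where "\<theta>' = enn2real \<theta>"
  have q: "1 < \<theta>'" "1 < q" "1 / q + 1 / \<theta>' = 1"
    using theta_conj_facts(2)[OF \<theta>1 False] by (auto simp: \<theta>'_def)
  then have q\<theta>: "(q - 1) * \<theta>' = q" by (simp add: field_simps)
  define b where "b k = enn2real (pow2 k * N f (rad k))" for k
  have b: "pow2 k * N f (rad k) = ennreal (b k)" if "k \<in> K" for k
    using N_rad_finite[OF f fin_f K(2)[OF that]] by (simp add: b_def ennreal_mult_less_top)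
  have b0: "0 \<le> b k" for k by (simp add: b_def)
  define B where "B = (\<Sum>k\<in>K. b k powr q)"
  have B0: "0 \<le> B" unfolding B_def by (intro sum_nonneg) auto
  have sum: "(\<Sum>k\<in>K. epow (pow2 k * N f (rad k)) q) = ennreal B"
    using b0 by (simp add: b epow_ennreal sum_ennreal B_def)
  show ?thesis
  proof (cases "B = 0")
    case True
    then show ?thesis by (simp add: sum)
  next
    case B: False
    with B0 have B: "0 < B" by simp
    \<comment> \<open>The extremal sequence for the pairing of l^q with l^\<theta>: its norm is 1
      because (q - 1) \<theta> = q, and its pairing with b is B^(1 - 1/\<theta>) = B^(1/q).\<close>
    define a where "a k = b k powr (q - 1) / B powr (1 / \<theta>')" for k
    have "(\<Sum>k\<in>K. ennreal (a k) * (pow2 k * N f (rad k))) \<le> 4 * assoc f"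
    proof (rule sum_le_assoc[OF f fin_f \<theta>1 K])
      have "(\<Sum>k\<in>K. a k powr \<theta>') = (\<Sum>k\<in>K. b k powr q / B)"
        using B q by (intro sum.cong) (auto simp: a_def powr_divide powr_powr q\<theta>)
      also have "\<dots> = 1" using B by (simp add: B_def flip: sum_divide_distrib)
      finally show "(\<Sum>k\<in>K. a k powr enn2real \<theta>) \<le> 1" by (simp add: \<theta>'_def)
    qed (use False in \<open>auto simp: a_def\<close>)
    moreover have "(\<Sum>k\<in>K. ennreal (a k) * (pow2 k * N f (rad k))) = ennreal (B powr (1 / q))"
    proof -
      have "(\<Sum>k\<in>K. ennreal (a k) * (pow2 k * N f (rad k))) = ennreal (\<Sum>k\<in>K. a k * b k)"
        using b0 by (simp add: b sum_ennreal a_def flip: ennreal_mult)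
      also have "(\<Sum>k\<in>K. a k * b k) = (\<Sum>k\<in>K. b k powr q / B powr (1 / \<theta>'))"
        using powr_mult_base[OF b0, of _ "q - 1"] by (intro sum.cong) (auto simp: a_def mult.commute)
      also have "\<dots> = B powr 1 / B powr (1 / \<theta>')"
        using B by (simp add: B_def flip: sum_divide_distrib)
      also have "\<dots> = B powr (1 - 1 / \<theta>')" by (rule powr_diff[symmetric])
      also have "1 - 1 / \<theta>' = 1 / q" using q by simp
      finally show ?thesis .
    qed
    ultimately have "epow (ennreal B) (1 / q) \<le> 4 * assoc f" using B by (simp add: epow_ennreal)
    then show ?thesis using q by (simp add: sum epow_inverse_le_iff)
  qed
qed

text \<open>The factor 2^q - 1 is at most 2^q; its q-th root 2 multiplies the 4 from
  \<open>sum_pow_le_assoc\<close>.\<close>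

lemma integral_F_le_assoc:
  assumes f: "f \<in> borel_measurable lebesgue" and \<theta>1: "1 < \<theta>"
  shows "epow (\<integral>\<^sup>+ t\<in>{0<..}. epow (N f t) q \<partial>ls_measure_left F) (1 / q) \<le> 8 * assoc f"
proof (cases "assoc f = top")
  case True
  then show ?thesis by (simp add: ennreal_mult_top)
next
  case False
  have q: "0 < q" using theta_conj_facts(1)[OF \<theta>1] by simp
  \<comment> \<open>Empty levels are given the value 0, since \<open>rad k\<close> means nothing
    there.\<close>
  define a where "a k = (if level_above k = {} then 0 else N f (rad k))" for k
  have "(\<integral>\<^sup>+ t\<in>{0<..}. epow (N f t) q \<partial>ls_measure_left F)
    \<le> ennreal (2 powr q - 1) * (\<integral>\<^sup>+ k. epow (pow2 k * a k) q \<partial>count_space UNIV)"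
    by (rule integral_F_le_sum[OF q N_antimono]) (simp add: a_def)
  also have "\<dots> \<le> ennreal (2 powr q) * epow (4 * assoc f) q"
  proof (intro mult_mono nn_integral_count_space_int_le)
    fix K :: "int set" assume K: "finite K"
    have "(\<Sum>k\<in>K. epow (pow2 k * a k) q) = (\<Sum>k\<in>{k\<in>K. level_above k \<noteq> {}}. epow (pow2 k * N f (rad k)) q)"
      using K by (intro sum.mono_neutral_cong_right) (auto simp: a_def)
    also have "\<dots> \<le> epow (4 * assoc f) q"
      using K False by (intro sum_pow_le_assoc f \<theta>1) (auto simp: less_top)
    finally show "(\<Sum>k\<in>K. epow (pow2 k * a k) q) \<le> epow (4 * assoc f) q" .
  qed (auto intro: ennreal_leI)
  also have "\<dots> = epow (ennreal 2 * (4 * assoc f)) q"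
    using q by (simp add: epow_mult epow_ennreal del: ennreal_numeral)
  finally show ?thesis using q by (simp add: epow_inverse_le_iff flip: mult.assoc)
qed

lemma assoc_le_sum:
  assumes \<theta>1: "1 < \<theta>"
  shows "\<exists>C>0. \<forall>f. f \<in> borel_measurable lebesgue \<longrightarrow> assoc f \<le> ennreal C *
    (epow (\<integral>\<^sup>+ t\<in>{0<..}. epow (N f t) q \<partial>ls_measure_left F) (1 / q) + N f 0 / W 0)"
proof -
  have q: "0 < q" using theta_conj_facts(1)[OF \<theta>1] by simp
  obtain C where C: "0 < C" and le: "\<And>f g. f \<in> borel_measurable lebesgue \<Longrightarrow> g \<in> borel_measurable lebesgue \<Longrightarrow>
    LMnorm p \<theta> \<omega> v g \<le> 1 \<Longrightarrow> (\<integral>\<^sup>+ x. ennreal \<bar>f x * g x\<bar> \<partial>lebesgue) \<le> ennreal C *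
      epow (\<integral>\<^sup>+ k. epow (pow2 k * Nf p v (annulus k) f) q \<partial>count_space UNIV) (1 / q)"
    using integral_le_sum_pow[OF \<theta>1] by blast
  \<comment> \<open>The outer 2 allows for two terms, the integral and the extra term, each at most
    \<open>epow R q\<close>; the fraction is the constant of
    \<open>sum_le_integral_F\<close>.\<close>
  define D where "D = 2 * (2 powr q / (2 powr q - 1))"
  have "1 < 2 powr q" using q by simp
  then have D: "0 < D" by (simp add: D_def)
  show ?thesis
  proof (intro exI[of _ "C * D powr (1 / q)"] conjI allI impI)
    show "0 < C * D powr (1 / q)" using C D by simp
    fix f :: "'a \<Rightarrow> real" assume f: "f \<in> borel_measurable lebesgue"
    define I where "I = (\<integral>\<^sup>+ t\<in>{0<..}. epow (N f t) q \<partial>ls_measure_left F)"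
    define R where "R = epow I (1 / q) + N f 0 / W 0"
    have "(\<integral>\<^sup>+ k. epow (pow2 k * Nf p v (annulus k) f) q \<partial>count_space UNIV)
      \<le> ennreal (2 powr q / (2 powr q - 1)) * (I + epow (N f 0 / W 0) q)"
      unfolding I_def
    proof (rule sum_le_integral_F[OF q N_antimono])
      show "Nf p v (annulus k) f \<le> N f (rad k)" for k
        using p by (intro Nf_mono) (auto simp: annulus_def block_eq not_less dest: rad_le)
      show "Nf p v (annulus k) f = 0" if "level_above k = {}" for k
      proof -
        have "annulus k = {}" using that by (auto simp: annulus_def block_eq)
        then show ?thesis using p by simp
      qed
    qed
    also have "\<dots> \<le> ennreal (2 powr q / (2 powr q - 1)) * (epow R q + epow R q)"
    proof (intro mult_left_mono add_mono)
      show "I \<le> epow R q" using q by (simp add: R_def flip: epow_inverse_le_iff)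
      show "epow (N f 0 / W 0) q \<le> epow R q" using q by (simp add: R_def)
    qed simp
    also have "\<dots> = ennreal D * epow R q"
    proof -
      have "ennreal D = ennreal (2 powr q / (2 powr q - 1)) + ennreal (2 powr q / (2 powr q - 1))"
        using \<open>1 < 2 powr q\<close> by (simp add: D_def flip: ennreal_plus)
      then show ?thesis by (simp only: distrib_left distrib_right)
    qed
    also have "\<dots> = epow (ennreal (D powr (1 / q)) * R) q"
      using q D by (simp add: epow_mult epow_ennreal powr_powr)
    finally have sum: "epow (\<integral>\<^sup>+ k. epow (pow2 k * Nf p v (annulus k) f) q \<partial>count_space UNIV) (1 / q)
      \<le> ennreal (D powr (1 / q)) * R" using q by (simp add: epow_inverse_le_iff)
    have "assoc f \<le> ennreal C * (ennreal (D powr (1 / q)) * R)"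
      unfolding assoc_norm_def
    proof (rule SUP_least)
      fix g assume "g \<in> {g \<in> LM p \<theta> \<omega> v. LMnorm p \<theta> \<omega> v g \<le> 1}"
      then have "(\<integral>\<^sup>+ x. ennreal \<bar>f x * g x\<bar> \<partial>lebesgue) \<le> ennreal C *
        epow (\<integral>\<^sup>+ k. epow (pow2 k * Nf p v (annulus k) f) q \<partial>count_space UNIV) (1 / q)"
        by (intro le f) (auto simp: LM_def)
      also have "\<dots> \<le> ennreal C * (ennreal (D powr (1 / q)) * R)" using sum by (rule mult_left_mono) simp
      finally show "(\<integral>\<^sup>+ x. ennreal \<bar>f x * g x\<bar> \<partial>lebesgue) \<le> ennreal C * (ennreal (D powr (1 / q)) * R)" .
    qed
    then show "assoc f \<le> ennreal (C * D powr (1 / q)) *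
      (epow (\<integral>\<^sup>+ t\<in>{0<..}. epow (N f t) q \<partial>ls_measure_left F) (1 / q) + N f 0 / W 0)"
      using C by (simp add: R_def I_def ennreal_mult mult.assoc)
  qed
qed

end

theorem theorem4p4:
  fixes p :: real and \<theta> :: ennreal and \<omega> :: "real \<Rightarrow> real"
    and v :: "'a::euclidean_space \<Rightarrow> real"
  assumes hp: "1 \<le> p" and h\<theta>: "0 < \<theta>" and h\<omega>: "\<omega> \<in> Omega \<theta>" and hv: "v \<in> Wts"
  shows "(\<theta> \<le> 1 \<longrightarrow>
           (\<exists>c>0. \<exists>C>0. \<forall>f::'a \<Rightarrow> real. f \<in> borel_measurable lebesgue \<longrightarrow>
              ennreal c * (SUP t\<in>{0<..}. Nf p v (- ball 0 t) f / wnorm \<theta> \<omega> t)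
                \<le> assoc_norm p \<theta> \<omega> v f \<and>
              assoc_norm p \<theta> \<omega> v f
                \<le> ennreal C * (SUP t\<in>{0<..}. Nf p v (- ball 0 t) f / wnorm \<theta> \<omega> t)))
       \<and> (1 < \<theta> \<longrightarrow>
           (\<exists>c>0. \<exists>C>0. \<forall>f::'a \<Rightarrow> real. f \<in> borel_measurable lebesgue \<longrightarrow>
              (let R = epow (\<integral>\<^sup>+ t\<in>{0<..}. epow (Nf p v (- ball 0 t) f) (theta_conj \<theta>)
                              \<partial>ls_measure_left (Fw \<theta> \<omega>)) (1 / theta_conj \<theta>)
                       + Nf p v UNIV f / wnorm \<theta> \<omega> 0
               in ennreal c * R \<le> assoc_norm p \<theta> \<omega> v f \<and>
                  assoc_norm p \<theta> \<omega> v f \<le> ennreal C * R)))"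
proof -
  interpret morrey \<theta> \<omega> p v
    using assms by unfold_locales
  show ?thesis
  proof (intro conjI impI)
    assume \<theta>1: "\<theta> \<le> 1"
    obtain C where C: "0 < C" and le: "\<And>f g S. f \<in> borel_measurable lebesgue \<Longrightarrow> g \<in> borel_measurable lebesgue \<Longrightarrow>
        LMnorm p \<theta> \<omega> v g \<le> 1 \<Longrightarrow> (\<forall>t>0. Nf p v (- ball 0 t) f / W t \<le> S) \<Longrightarrow>
        (\<integral>\<^sup>+ x. ennreal \<bar>f x * g x\<bar> \<partial>lebesgue) \<le> ennreal C * S"
      using integral_le_Sup[OF \<theta>1] by blast
    show "\<exists>c>0. \<exists>C>0. \<forall>f::'a \<Rightarrow> real. f \<in> borel_measurable lebesgue \<longrightarrow>
              ennreal c * (SUP t\<in>{0<..}. Nf p v (- ball 0 t) f / wnorm \<theta> \<omega> t)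
                \<le> assoc_norm p \<theta> \<omega> v f \<and>
              assoc_norm p \<theta> \<omega> v f
                \<le> ennreal C * (SUP t\<in>{0<..}. Nf p v (- ball 0 t) f / wnorm \<theta> \<omega> t)"
    \<comment> \<open>The lower constant is 1 because \<open>Nf_le_assoc\<close> bounds each
      quotient separately.\<close>
    proof (rule exI[of _ 1], intro exI[of _ C] conjI allI impI C)
      fix f :: "'a \<Rightarrow> real" assume f: "f \<in> borel_measurable lebesgue"
      show "ennreal 1 * (SUP t\<in>{0<..}. N f t / W t) \<le> assoc f"
        using f by (auto intro!: SUP_least Nf_le_assoc)
      show "assoc f \<le> ennreal C * (SUP t\<in>{0<..}. N f t / W t)"
        unfolding assoc_norm_def using f
        by (intro SUP_least le) (auto simp: LM_def intro: SUP_upper)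
    qed simp
  next
    assume \<theta>1: "1 < \<theta>"
    obtain C where C: "0 < C" and le: "\<And>f. f \<in> borel_measurable lebesgue \<Longrightarrow> assoc f \<le> ennreal C *
        (epow (\<integral>\<^sup>+ t\<in>{0<..}. epow (N f t) q \<partial>ls_measure_left F) (1 / q) + N f 0 / W 0)"
      using assoc_le_sum[OF \<theta>1] by blast
    show "\<exists>c>0. \<exists>C>0. \<forall>f::'a \<Rightarrow> real. f \<in> borel_measurable lebesgue \<longrightarrow>
              (let R = epow (\<integral>\<^sup>+ t\<in>{0<..}. epow (Nf p v (- ball 0 t) f) (theta_conj \<theta>)
                              \<partial>ls_measure_left (Fw \<theta> \<omega>)) (1 / theta_conj \<theta>)
                       + Nf p v UNIV f / wnorm \<theta> \<omega> 0
               in ennreal c * R \<le> assoc_norm p \<theta> \<omega> v f \<and>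
                  assoc_norm p \<theta> \<omega> v f \<le> ennreal C * R)"
      unfolding Let_def
    \<comment> \<open>9 = 8 + 1: the integral contributes 8, and the extra term, the case t = 0 of
      \<open>Nf_le_assoc\<close>, contributes 1.\<close>
    proof (rule exI[of _ "1 / 9"], intro exI[of _ C] conjI allI impI C)
      fix f :: "'a \<Rightarrow> real" assume f: "f \<in> borel_measurable lebesgue"
      have U: "- ball (0::'a) 0 = UNIV" by simp
      let ?R = "epow (\<integral>\<^sup>+ t\<in>{0<..}. epow (N f t) q \<partial>ls_measure_left F) (1 / q) + Nf p v UNIV f / W 0"
      have "?R \<le> 8 * assoc f + assoc f"
        using integral_F_le_assoc[OF f \<theta>1] Nf_le_assoc[OF f, of 0] by (intro add_mono) (simp_all only: U order_refl)
      also have "\<dots> = 9 * assoc f" using distrib_right[of 8 1 "assoc f"] by simp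
      finally have "ennreal (1 / 9) * ?R \<le> ennreal (1 / 9) * (ennreal 9 * assoc f)"
        by (intro mult_left_mono) auto
      also have "\<dots> = assoc f" by (simp flip: mult.assoc ennreal_mult del: ennreal_numeral)
      finally show "ennreal (1 / 9) * ?R \<le> assoc f" .
      show "assoc f \<le> ennreal C * ?R" using le[OF f] by (simp only: U)
    qed simp
  qed
qed

end
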